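(* Let $\mathcal N_t$ be the number of trees at time $t$ in the cylindrical Hastings-Levitov$(0)$ process $\mathrm{CHL}_N$ with particle size $\lambda>0$. There exists a random variable $\mathcal N_\infty$ such that $\mathcal N_t\to\mathcal N_\infty$ almost surely as $t\to\infty$, and $$\mathbb{E}[\mathcal N_\infty]=\frac{\pi}{2\arctan\frac{\delta(N,\lambda)}{\sqrt{1-\delta(N,\lambda)^2}}},\qquad \delta(N,\lambda)=1-\frac{2}{e^{\lambda/N}+1}.$$ In particular, $$\lim_{N\to\infty}\frac{\mathbb{E}[\mathcal N_\infty]}{N}=\frac{\pi}{\lambda}.$$
   Context: Slit maps. Fix real numbers $\lambda>0$ and $N\ge 1$. Let $\mathbb T_N=\mathbb R/2\pi N\mathbb Z$, identified with $[0,2\pi N)$ and with the boundary $\{\operatorname{Im} z=0\}$ of the cylinder $\mathbb T^N=\{z\in\mathbb C:\operatorname{Im} z>0\}/(z\sim z+2\pi N)$. Put $\delta=\delta(N,\lambda)=1-\frac{2}{e^{\lambda/N}+1}\in(0,1)$. Let $\mathbb D_0=\{|z|>1\}$, $\mathbb H=\{\operatorname{Im} z>0\}$, $f_N:\mathbb T^N\to\mathbb D_0$, $f_N(z)=e^{-iz/N}$; $g:\mathbb D_0\to\mathbb H$, $g(z)=i\frac{z-1}{z+1}$; $\phi_a:\mathbb H\to\mathbb H\setminus[0,ia]$, $\phi_a(z)=\sqrt{z^2(1-a^2)-a^2}$ (conformal branch). Define $S^{N,\lambda}=f_N^{-1}\circ g^{-1}\circ\phi_{\delta}\circ g\circ f_N$,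 a conformal map $\mathbb T^N\to\mathbb T^N\setminus[0,i\lambda]$, extended continuously to $\mathbb T_N$; then $S^{N,\lambda}(0)=i\lambda$ and $S^{N,\lambda}(\mathbb T_N)=\mathbb T_N\cup[0,i\lambda]$. For $x\in\mathbb T_N$ the slit map centered at $x$ is $S^{N,\lambda}_x(z)=x+S^{N,\lambda}(z-x)$ (modulo $2\pi N$). The process $\mathrm{CHL}_N$. Let $P$ be a Poisson point process of intensity $1$ on $\mathbb R_+\times\mathbb T_N$, with points $(t_1,x_1),(t_2,x_2),\dots$, $0<t_1<t_2<\cdots$. For $t\ge0$ let $n=\#\{j:t_j\le t\}$ and $\mathcal C_t^{N,\lambda}=S^{N,\lambda}_{x_1}\circ S^{N,\lambda}_{x_2}\circ\cdots\circ S^{N,\lambda}_{x_n}$ (identity if $n=0$). Trees. The trees at time $t$ are the connected components of $\mathcal C^{N,\lambda}_t(\mathbb T_N)\setminus\mathbb T_N$, and $\mathcal N_t$ denotes their number. *)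

theory Defs
  imports "HOL-Probability.Probability"
begin

section \<open>The cylinder\<close>

text \<open>
  A point of the closed cylinder, i.e. of \<open>{z. Im z \<ge> 0}\<close> modulo \<open>2 \<pi> N\<close>, is represented by its
  representative with real part in \<open>[0, 2 \<pi> N)\<close>. The topology is not the one of this strip
  as a subset of the plane, but the quotient topology.
\<close>

definition cyl_rep :: "real \<Rightarrow> complex \<Rightarrow> complex" where
  "cyl_rep N z = z - of_real (2 * pi * N * of_int \<lfloor>Re z / (2 * pi * N)\<rfloor>)"

definition open_cyl :: "real \<Rightarrow> complex set" where
  "open_cyl N = {z. 0 \<le> Re z \<and> Re z < 2 * pi * N \<and> 0 < Im z}"

definition cyl_boundary :: "real \<Rightarrow> complex set" where
  "cyl_boundary N = {z. 0 \<le> Re z \<and> Re z < 2 * pi * N \<and> Im z = 0}"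

definition closed_cyl :: "real \<Rightarrow> complex set" where
  "closed_cyl N = open_cyl N \<union> cyl_boundary N"

definition cyl_topology :: "real \<Rightarrow> complex topology" where
  "cyl_topology N = topology (\<lambda>U. U \<subseteq> closed_cyl N \<and>
     openin (top_of_set {z. 0 \<le> Im z}) {z. 0 \<le> Im z \<and> cyl_rep N z \<in> U})"

lemma openin_cyl_topology:
  "openin (cyl_topology N) U \<longleftrightarrow> U \<subseteq> closed_cyl N \<and>
     openin (top_of_set {z. 0 \<le> Im z}) {z. 0 \<le> Im z \<and> cyl_rep N z \<in> U}"
proof -
  let ?X = "top_of_set {z::complex. 0 \<le> Im z}"
  let ?pre = "\<lambda>U. {z. 0 \<le> Im z \<and> cyl_rep N z \<in> U}"
  have "istopology (\<lambda>U. U \<subseteq> closed_cyl N \<and> openin ?X (?pre U))"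
    unfolding istopology_def
  proof (intro conjI allI impI)
    fix S T assume "S \<subseteq> closed_cyl N \<and> openin ?X (?pre S)" "T \<subseteq> closed_cyl N \<and> openin ?X (?pre T)"
    moreover have "?pre (S \<inter> T) = ?pre S \<inter> ?pre T" by auto
    ultimately show "S \<inter> T \<subseteq> closed_cyl N" "openin ?X (?pre (S \<inter> T))" by (auto intro: openin_Int)
  next
    fix K assume K: "\<forall>U\<in>K. U \<subseteq> closed_cyl N \<and> openin ?X (?pre U)"
    then show "\<Union>K \<subseteq> closed_cyl N" by blast
    have "?pre (\<Union>K) = \<Union>(?pre ` K)" by auto
    moreover have "openin ?X (\<Union>(?pre ` K))" by (rule openin_Union) (use K in auto)
    ultimately show "openin ?X (?pre (\<Union>K))" by (simp only:)
  qed
  then show ?thesis by (simp add: cyl_topology_def topology_inverse')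
qed

lemma cyl_rep_in_closed_cyl:
  assumes "0 < N" "0 \<le> Im z" shows "cyl_rep N z \<in> closed_cyl N"
proof -
  have "0 < 2 * pi * N" using assms by simp
  then have "of_int \<lfloor>Re z / (2 * pi * N)\<rfloor> * (2 * pi * N) \<le> Re z"
    "Re z < (of_int \<lfloor>Re z / (2 * pi * N)\<rfloor> + 1) * (2 * pi * N)"
    by (simp_all add: floor_divide_lower floor_divide_upper)
  then show ?thesis
    using assms by (auto simp: cyl_rep_def closed_cyl_def open_cyl_def cyl_boundary_def algebra_simps)
qed

lemma cyl_rep_closed_cyl: "z \<in> closed_cyl N \<Longrightarrow> cyl_rep N z = z"
proof -
  assume "z \<in> closed_cyl N"
  then have "0 \<le> Re z" "Re z < 2 * pi * N"
    by (auto simp: closed_cyl_def open_cyl_def cyl_boundary_def)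
  then have "\<lfloor>Re z / (2 * pi * N)\<rfloor> = 0"
    by (simp add: floor_eq_iff field_simps)
  then show ?thesis by (simp add: cyl_rep_def)
qed

lemma topspace_cyl_topology:
  assumes "0 < N" shows "topspace (cyl_topology N) = closed_cyl N"
proof -
  have "{z. 0 \<le> Im z \<and> cyl_rep N z \<in> closed_cyl N} = {z. 0 \<le> Im z}"
    using cyl_rep_in_closed_cyl[OF assms] by auto
  then have "openin (cyl_topology N) (closed_cyl N)"
    by (metis order_refl openin_cyl_topology openin_topspace topspace_euclidean_subtopology)
  moreover have "topspace (cyl_topology N) \<subseteq> closed_cyl N"
    using openin_cyl_topology openin_topspace by blast
  ultimately show ?thesis using openin_subset by blast
qed

lemma quotient_map_cyl_rep:
  assumes "0 < N"
  shows "quotient_map (top_of_set {z. 0 \<le> Im z}) (cyl_topology N) (cyl_rep N)"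
proof -
  have "cyl_rep N ` {z. 0 \<le> Im z} = closed_cyl N"
  proof
    show "cyl_rep N ` {z. 0 \<le> Im z} \<subseteq> closed_cyl N"
      using cyl_rep_in_closed_cyl[OF assms] by auto
    show "closed_cyl N \<subseteq> cyl_rep N ` {z. 0 \<le> Im z}"
    proof
      fix z assume z: "z \<in> closed_cyl N"
      then have "0 \<le> Im z" by (auto simp: closed_cyl_def open_cyl_def cyl_boundary_def)
      then show "z \<in> cyl_rep N ` {z. 0 \<le> Im z}" using cyl_rep_closed_cyl[OF z] by force
    qed
  qed
  then show ?thesis
    by (auto simp: quotient_map_def topspace_cyl_topology[OF assms] openin_cyl_topology)
qed

section \<open>Slit maps\<close>

definition slit_delta :: "real \<Rightarrow> real \<Rightarrow> real" where
  "slit_delta N lam = 1 - 2 / (exp (lam / N) + 1)"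

definition ext_disk :: "complex set" where
  "ext_disk = {z. 1 < norm z}"

definition cyl_to_disk :: "real \<Rightarrow> complex \<Rightarrow> complex" where
  "cyl_to_disk N z = exp (- \<i> * z / of_real N)"

definition disk_to_half_plane :: "complex \<Rightarrow> complex" where
  "disk_to_half_plane z = \<i> * (z - 1) / (z + 1)"

text \<open>
  For \<open>z\<close> in the open upper half-plane and \<open>0 < a < 1\<close>, the argument of \<^const>\<open>csqrt\<close> below avoids
  the branch cut \<open>(-\<infinity>, 0]\<close>; so this is the holomorphic branch of
  \<open>\<surd>(z\<^sup>2 (1 - a\<^sup>2) - a\<^sup>2)\<close> with values in the upper half-plane.
\<close>

definition half_plane_slit :: "real \<Rightarrow> complex \<Rightarrow> complex" where
  "half_plane_slit a z = \<i> * csqrt (- (z\<^sup>2 * of_real (1 - a\<^sup>2) - of_real (a\<^sup>2)))"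

lemma half_plane_slit_square:
  "(half_plane_slit a z)\<^sup>2 = z\<^sup>2 * of_real (1 - a\<^sup>2) - of_real (a\<^sup>2)"
  by (simp add: half_plane_slit_def power_mult_distrib)

lemma half_plane_slit_branch:
  assumes "0 < a" "a < 1" "0 < Im z"
  shows "- (z\<^sup>2 * of_real (1 - a\<^sup>2) - of_real (a\<^sup>2)) \<notin> \<real>\<^sub>\<le>\<^sub>0" "0 < Im (half_plane_slit a z)"
proof -
  have a: "0 < 1 - a\<^sup>2" "0 < a\<^sup>2" using assms by (auto simp: power_less_one_iff)
  show *: "- (z\<^sup>2 * of_real (1 - a\<^sup>2) - of_real (a\<^sup>2)) \<notin> \<real>\<^sub>\<le>\<^sub>0"
  proof
    let ?w = "- (z\<^sup>2 * of_real (1 - a\<^sup>2) - of_real (a\<^sup>2))"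
    assume "?w \<in> \<real>\<^sub>\<le>\<^sub>0"
    then have le: "Re ?w \<le> 0" and im: "Im ?w = 0" by (simp_all add: complex_nonpos_Reals_iff)
    have "Im ?w = - (2 * Re z * Im z * (1 - a\<^sup>2))" by (simp add: Im_power2)
    then have "Re z = 0" using im a assms(3) by simp
    then have "Re ?w = (Im z)\<^sup>2 * (1 - a\<^sup>2) + a\<^sup>2" by (simp add: Re_power2)
    moreover have "0 \<le> (Im z)\<^sup>2 * (1 - a\<^sup>2)" using a by simp
    ultimately show False using le a by linarith
  qed
  have "Re (csqrt w) \<noteq> 0" if w: "w \<notin> \<real>\<^sub>\<le>\<^sub>0" for w
  proof
    assume "Re (csqrt w) = 0"
    then have "Re ((csqrt w)\<^sup>2) \<le> 0" "Im ((csqrt w)\<^sup>2) = 0"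
      unfolding Re_power2 Im_power2 by simp_all
    then have "Re w \<le> 0" "Im w = 0" unfolding power2_csqrt by simp_all
    with w show False by (simp add: complex_nonpos_Reals_iff)
  qed
  from this[OF *] show "0 < Im (half_plane_slit a z)"
    using csqrt_principal[of "- (z\<^sup>2 * of_real (1 - a\<^sup>2) - of_real (a\<^sup>2))"]
    by (auto simp: half_plane_slit_def simp del: csqrt.simps)
qed

text \<open>
  The slit map is defined on representatives in the half-plane \<open>Im z \<ge> 0\<close> (it has period
  \<open>2 \<pi> N\<close>) and takes values in \<^term>\<open>closed_cyl N\<close>. On the boundary line it is the continuous
  extension, the limit being taken in the cylinder.
\<close>

definition slit_map_interior :: "real \<Rightarrow> real \<Rightarrow> complex \<Rightarrow> complex" where
  "slit_map_interior N lam =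
     the_inv_into (open_cyl N) (cyl_to_disk N) \<circ> the_inv_into ext_disk disk_to_half_plane \<circ>
     half_plane_slit (slit_delta N lam) \<circ> disk_to_half_plane \<circ> cyl_to_disk N"

definition slit_map :: "real \<Rightarrow> real \<Rightarrow> complex \<Rightarrow> complex" where
  "slit_map N lam z =
     (if 0 < Im z then slit_map_interior N lam z
      else (THE w. limitin (cyl_topology N) (slit_map_interior N lam) w (at z within {u. 0 < Im u})))"

definition slit_map_at :: "real \<Rightarrow> real \<Rightarrow> real \<Rightarrow> complex \<Rightarrow> complex" where
  "slit_map_at N lam x z = cyl_rep N (of_real x + slit_map N lam (z - of_real x))"

section \<open>Poisson point processes\<close>

text \<open>
  A point process with intensity measure \<open>\<mu>\<close> (assumed diffuse, so that a realisation is a set of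
  points): independent Poisson counts. Almost sure finiteness of \<open>P \<omega> \<inter> A\<close> is required because
  \<^const>\<open>card\<close> vanishes on infinite sets. The Poisson weights are written out so that \<open>\<mu> A = 0\<close>
  is covered, which \<^const>\<open>poisson_pmf\<close> excludes.
\<close>

definition poisson_point_process :: "'a measure \<Rightarrow> 'b measure \<Rightarrow> ('a \<Rightarrow> 'b set) \<Rightarrow> bool" where
  "poisson_point_process M \<mu> P \<longleftrightarrow>
     prob_space M \<and>
     (\<forall>\<omega>\<in>space M. P \<omega> \<subseteq> space \<mu>) \<and>
     (\<forall>A\<in>sets \<mu>. emeasure \<mu> A < \<infinity> \<longrightarrow>
        (AE \<omega> in M. finite (P \<omega> \<inter> A)) \<and>
        (\<lambda>\<omega>. card (P \<omega> \<inter> A)) \<in> measurable M (count_space UNIV) \<and>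
        (\<forall>k. measure M {\<omega>\<in>space M. card (P \<omega> \<inter> A) = k} =
               measure \<mu> A ^ k / fact k * exp (- measure \<mu> A))) \<and>
     (\<forall>(I :: nat set) A. finite I \<and> disjoint_family_on A I \<and>
        (\<forall>i\<in>I. A i \<in> sets \<mu> \<and> emeasure \<mu> (A i) < \<infinity>) \<longrightarrow>
        prob_space.indep_vars M (\<lambda>_. count_space UNIV) (\<lambda>i \<omega>. card (P \<omega> \<inter> A i)) I)"

definition space_time_measure :: "real \<Rightarrow> (real \<times> real) measure" where
  "space_time_measure N = restrict_space lborel ({0..} \<times> {0..<2 * pi * N})"

section \<open>The process and its trees\<close>

text \<open>
  Almost surely only finitely many points have arrived by time \<open>t\<close>, at distinct times; the junk
  values of \<^const>\<open>sorted_list_of_set\<close> and \<^const>\<open>The\<close> matter only on a null event.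
\<close>

definition arrival_positions :: "(real \<times> real) set \<Rightarrow> real \<Rightarrow> real list" where
  "arrival_positions Q t =
     map (\<lambda>s. THE x. (s, x) \<in> Q) (sorted_list_of_set {s. s \<le> t \<and> (\<exists>x. (s, x) \<in> Q)})"

definition chl_map :: "real \<Rightarrow> real \<Rightarrow> (real \<times> real) set \<Rightarrow> real \<Rightarrow> complex \<Rightarrow> complex" where
  "chl_map N lam Q t = foldr (\<circ>) (map (slit_map_at N lam) (arrival_positions Q t)) id"

definition chl_trees :: "real \<Rightarrow> real \<Rightarrow> (real \<times> real) set \<Rightarrow> real \<Rightarrow> complex set set" where
  "chl_trees N lam Q t =
     connected_components_of
       (subtopology (cyl_topology N) (chl_map N lam Q t ` cyl_boundary N - cyl_boundary N))"

text \<open>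
  The set of trees is finite: each of the finitely many particles contributes a connected set.
\<close>

definition num_trees :: "real \<Rightarrow> real \<Rightarrow> (real \<times> real) set \<Rightarrow> real \<Rightarrow> nat" where
  "num_trees N lam Q t = card (chl_trees N lam Q t)"

end

theory Submission
  imports Defs "HOL-Real_Asymp.Real_Asymp"
begin

text \<open>
  Composing one more slit map at \<open>x\<close> adds the image of one slit to the cluster, and the image
  is a new tree iff the base point \<open>x\<close> is still mapped to the boundary; otherwise it is attached to an
  existing tree. So the expected number of trees is a sum of the probabilities that a uniform point falls
  into the set of exposed points, those still mapped to the boundary. A slit map pulls the exposed set back:
  it destroys an arc of width \<open>2 \<alpha>\<close>, where \<open>\<alpha> = 2 N arctan (\<delta> / \<surd>(1 - \<delta>\<^sup>2))\<close>, and since its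
  centre is uniform, Fubini's theorem shows that the expected exposed length is multiplied by
  \<open>1 - \<alpha> / (\<pi> N)\<close> with each particle, whatever the slit map does outside the arc. The resulting geometric
  series has sum \<open>\<pi> N / \<alpha>\<close>.

  To work with the Poisson process through its counts only, time is cut into dyadic slots: the
  positions found in the slots that hold exactly one point are independent and identically distributed,
  and almost surely, for fine enough slots, they are all the points up to a given time.
\<close>

section \<open>Connected components and attached arcs\<close>

text \<open>The obstacle is that \<open>slit_map\<close> is given on the boundary by
  \<open>The\<close> of a limit in a quotient topology. Everything is therefore carried by z ->
  exp(-iz/N), a homeomorphism onto the closed exterior of the unit disk, to explicit continuous maps
  and to components of plane sets. A new slit map is composed innermost, so the old cluster stays
  where it is and the tree count can only grow in time. By rotation invariance, whether a boundary
  point x survives a slit at y, and how far it is moved, depends only on v = x - y; this is what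
  Fubini exploits. The constant: the half-plane coordinate of the point v is tan(v/(2N)), and v
  stays on the boundary iff tan^2(v/(2N)) >= delta^2/(1 - delta^2). With slots of length h, the
  probability of exactly one point in a slot is 2 pi N q with q = h exp(-2 pi N h), and a slot
  shrinks the expected exposed length by the factor 1 - 2 alpha q. In the prefactor of the geometric
  sum q cancels, so only the power that remains at time n depends on the mesh; it tends to exp(-2
  alpha n).\<close>

lemma connected_components_of_top_of_set:
  "connected_components_of (top_of_set S) = components S"
proof -
  have "connected_component_of (top_of_set S) x y \<longleftrightarrow> connected_component S x y" for x y
    unfolding connected_component_of_def connected_component_def
    by (metis connectedin_iff_connected connectedin_subtopology)
  then have "connected_component_of (top_of_set S) = connected_component S" by (intro ext)
  then show ?thesis
    by (simp add: connected_components_of_def components_def)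
qed

text \<open>The traces of \<open>S\<close> and \<open>T\<close> on \<open>D\<close> are closed in
  \<open>D\<close> and complementary, so each is clopen in a connected set.\<close>

lemma connected_subset_Un_separated:
  fixes S T :: "'a::topological_space set"
  assumes "closedin (top_of_set (S \<union> T)) S" "closedin (top_of_set (S \<union> T)) T" "S \<inter> T = {}"
    and "connected D" "D \<subseteq> S \<union> T"
  shows "D \<subseteq> S \<or> D \<subseteq> T"
proof -
  have *: "closedin (top_of_set D) (D \<inter> R)" if R: "closedin (top_of_set (S \<union> T)) R" for R
  proof -
    obtain F where "closed F" "R = (S \<union> T) \<inter> F" using R closedin_closed by metis
    then have "D \<inter> R = D \<inter> F" using assms(5) by blast
    then show ?thesis using \<open>closed F\<close> closedin_closed by blast
  qed
  have "closedin (top_of_set D) (D \<inter> S)" "closedin (top_of_set D) (D \<inter> T)"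
    using * assms(1,2) by blast+
  moreover have "D - D \<inter> S = D \<inter> T" using assms by auto
  ultimately have "closedin (top_of_set D) (D \<inter> S)" "openin (top_of_set D) (D \<inter> S)"
    by (auto simp: openin_closedin_eq)
  then have "D \<inter> S = {} \<or> D \<inter> S = D"
    using assms(4) connected_clopen by blast
  then show ?thesis using assms(5) by auto
qed

text \<open>A connected subset of the union lies on one side, so maximality in the union and
  maximality in that side are the same.\<close>

lemma components_Un_separated:
  fixes S T :: "'a::topological_space set"
  assumes "closedin (top_of_set (S \<union> T)) S" "closedin (top_of_set (S \<union> T)) T" "S \<inter> T = {}"
  shows "components (S \<union> T) = components S \<union> components T"
proof -
  note sep = connected_subset_Un_separated[OF assms]
  have *: "C \<in> components (S \<union> T) \<longleftrightarrow> C \<in> components S \<or> C \<in> components T" for C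
    unfolding in_components_maximal
    apply (rule iffI)
    subgoal using sep[of C] by (metis sup.coboundedI1 sup.coboundedI2)
    subgoal
      apply (elim disjE conjE)
      subgoal using assms(3) sep
        by (smt (verit, best) Int_subset_iff inf.absorb_iff2 inf.orderE sup.coboundedI1 subset_empty order_trans)
      subgoal using assms(3) sep
        by (smt (verit, best) Int_subset_iff inf.absorb_iff2 inf.orderE sup.coboundedI2 subset_empty order_trans)
      done
    done
  then show ?thesis by blast
qed

text \<open>The case of a new tree: the connected set \<open>A\<close> is its own only
  component.\<close>

lemma components_insert_separated:
  fixes K A :: "'a::topological_space set"
  assumes "closedin (top_of_set (K \<union> A)) K" "closedin (top_of_set (K \<union> A)) A" "K \<inter> A = {}"
    and "connected A" "A \<noteq> {}" "finite (components K)"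
  shows "finite (components (K \<union> A))" "card (components (K \<union> A)) = Suc (card (components K))"
proof -
  have "components A = {A}"
    using assms by (simp add: connected_eq_components_subset_sing components_eq_sing_iff)
  then have *: "components (K \<union> A) = insert A (components K)"
    using components_Un_separated[OF assms(1-3)] by auto
  have "A \<notin> components K"
    using assms in_components_subset by blast
  then show "finite (components (K \<union> A))" "card (components (K \<union> A)) = Suc (card (components K))"
    using assms unfolding * by auto
qed

text \<open>The case of an attached arc: \<open>A\<close> becomes closed only together with its foot
  \<open>p\<close>, which lies in \<open>K\<close>. The component \<open>C\<close> of
  \<open>p\<close> absorbs \<open>A\<close>. The union \<open>U\<close> of the other components is
  closed because they are finitely many, so it separates from the enlarged component.\<close>

lemma components_attach_connected:
  fixes K A :: "'a::topological_space set"
  assumes K: "closedin (top_of_set (K \<union> A)) K"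
    and A: "closedin (top_of_set (K \<union> A)) (insert p A)"
    and "K \<inter> A = {}" "p \<in> K" "connected (insert p A)" and fin: "finite (components K)"
  shows "finite (components (K \<union> A))" "card (components (K \<union> A)) = card (components K)"
proof -
  obtain C where C: "C \<in> components K" "p \<in> C"
    using \<open>p \<in> K\<close> by (metis Union_components UnionE)
  define U where "U = \<Union>(components K - {C})"
  have KU: "K = C \<union> U"
    using C Union_components[of K] unfolding U_def by blast
  have CU: "C \<inter> U = {}"
    using C components_eq unfolding U_def by fast
  have clC: "closedin (top_of_set K) C" using C closedin_component by blast
  have clU: "closedin (top_of_set K) U"
    unfolding U_def using fin closedin_component by (intro closedin_Union) auto
  have conC: "connected C" "C \<noteq> {}" using C in_components_connected in_components_nonempty by auto
  have sing: "components S = {S}" if "connected S" "S \<noteq> {}" for S :: "'a set"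
    using that by (simp add: connected_eq_components_subset_sing components_eq_sing_iff)
  have compK: "components K = insert C (components U)"
    using components_Un_separated[of C U] clC clU CU sing[OF conC] unfolding KU by auto
  have nC: "C \<notin> components U"
    using CU conC in_components_subset by blast
  define B where "B = C \<union> insert p A"
  have "connected B" unfolding B_def
    using conC C assms by (intro connected_Un) auto
  then have sB: "components B = {B}" by (intro sing) (auto simp: B_def)
  have KA: "K \<union> A = B \<union> U" using KU C by (auto simp: B_def)
  have BU: "B \<inter> U = {}" using CU C assms(3) KU by (auto simp: B_def)
  have "closedin (top_of_set (K \<union> A)) C" "closedin (top_of_set (K \<union> A)) U"
    using closedin_trans[OF clC K] closedin_trans[OF clU K] by auto
  then have "closedin (top_of_set (B \<union> U)) B" "closedin (top_of_set (B \<union> U)) U"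
    using A closedin_Un[of "top_of_set (K \<union> A)" C "insert p A"] unfolding KA[symmetric] unfolding B_def by auto
  from components_Un_separated[OF this BU]
  have compKA: "components (K \<union> A) = insert B (components U)"
    unfolding KA sB by auto
  have nB: "B \<notin> components U"
    using BU conC in_components_subset unfolding B_def by blast
  have "finite (components U)" using fin unfolding compK by auto
  then show "finite (components (K \<union> A))" "card (components (K \<union> A)) = card (components K)"
    unfolding compK compKA using nC nB by auto
qed

section \<open>The slit map of the half-plane\<close>

text \<open>
  \<^const>\<open>half_plane_slit\<close> does not extend continuously to the real axis, where the argument of
  \<^const>\<open>csqrt\<close> meets the branch cut. The same root in terms of real square roots does.
\<close>

definition slit_root :: "real \<Rightarrow> complex \<Rightarrow> complex" where
  "slit_root a z = (let u = z\<^sup>2 * of_real (1 - a\<^sup>2) - of_real (a\<^sup>2) in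
     Complex ((if 0 \<le> Re z then 1 else -1) * sqrt ((norm u + Re u) / 2)) (sqrt ((norm u - Re u) / 2)))"

lemma Im_slit_root: "0 \<le> Im (slit_root a z)"
  using complex_Re_le_cmod[of "z\<^sup>2 * of_real (1 - a\<^sup>2) - of_real (a\<^sup>2)"]
  by (simp add: slit_root_def Let_def)

text \<open>The classical real formula for a complex square root. The two radicals multiply to |Im
  u| / 2, and the sign \<open>s\<close> turns the absolute value into Im u.\<close>

lemma square_half_norm:
  fixes u :: complex
  assumes "s\<^sup>2 = 1" "0 \<le> s * Im u"
  shows "(Complex (s * sqrt ((norm u + Re u) / 2)) (sqrt ((norm u - Re u) / 2)))\<^sup>2 = u"
proof -
  have 1: "0 \<le> norm u + Re u" "0 \<le> norm u - Re u"
    using abs_Re_le_cmod[of u] by linarith+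
  have n: "(norm u)\<^sup>2 = (Re u)\<^sup>2 + (Im u)\<^sup>2" by (simp add: cmod_power2)
  have "2 * (sqrt ((norm u + Re u) / 2) * sqrt ((norm u - Re u) / 2)) = sqrt ((Im u)\<^sup>2)"
  proof -
    have "sqrt ((norm u + Re u) / 2) * sqrt ((norm u - Re u) / 2)
        = sqrt ((norm u + Re u) / 2 * ((norm u - Re u) / 2))" by (rule real_sqrt_mult[symmetric])
    also have "(norm u + Re u) / 2 * ((norm u - Re u) / 2) = (Im u)\<^sup>2 / 2\<^sup>2"
      using n by (simp add: field_simps power2_eq_square)
    finally show ?thesis by (simp add: real_sqrt_divide)
  qed
  then have a: "2 * (sqrt ((norm u + Re u) / 2) * sqrt ((norm u - Re u) / 2)) = \<bar>Im u\<bar>" by simp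
  have s: "s = 1 \<or> s = -1" using assms(1) by (simp add: power2_eq_1_iff)
  have "Im u = s * \<bar>Im u\<bar>" using s assms(2) by auto
  then have "2 * (s * sqrt ((norm u + Re u) / 2) * sqrt ((norm u - Re u) / 2)) = Im u"
    using a by (metis (no_types, opaque_lifting) mult.assoc mult.left_commute)
  moreover have "(s * sqrt ((norm u + Re u) / 2))\<^sup>2 - (sqrt ((norm u - Re u) / 2))\<^sup>2 = Re u"
    using 1 by (simp add: power_mult_distrib assms(1) field_simps)
  ultimately show ?thesis
    by (simp add: complex_eq_iff Re_power2 Im_power2 mult.assoc)
qed

section \<open>Algebra, continuity and boundary values of the root\<close>

context
  fixes a :: real
  assumes a: "0 < a" "a < 1"
begin

lemma square_bounds: "0 < a\<^sup>2" "a\<^sup>2 < 1"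
  using a by (auto simp: power_less_one_iff)

text \<open>On the closed half-plane the radicand has imaginary part 2 Re z Im z (1 - a^2), whose
  sign is that of Re z; hence the sign chosen in \<open>slit_root\<close>.\<close>

lemma slit_root_square:
  assumes "0 \<le> Im z" shows "(slit_root a z)\<^sup>2 = z\<^sup>2 * of_real (1 - a\<^sup>2) - of_real (a\<^sup>2)"
proof -
  let ?u = "z\<^sup>2 * of_real (1 - a\<^sup>2) - of_real (a\<^sup>2)"
  have "Im ?u = 2 * Re z * Im z * (1 - a\<^sup>2)" by (simp add: Im_power2)
  then have "(if 0 \<le> Re z then 1 else -1) * Im ?u = 2 * \<bar>Re z\<bar> * Im z * (1 - a\<^sup>2)" by (simp only:) simp
  moreover have "0 \<le> 2 * \<bar>Re z\<bar> * Im z * (1 - a\<^sup>2)" using assms square_bounds by simp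
  ultimately have "0 \<le> (if 0 \<le> Re z then 1 else -1) * Im ?u" by linarith
  then show ?thesis unfolding slit_root_def Let_def by (intro square_half_norm) auto
qed

text \<open>Both sides are roots of the same number, hence equal up to sign, and their imaginary
  parts exclude the minus sign.\<close>

lemma slit_root_interior:
  assumes "0 < Im z" shows "slit_root a z = half_plane_slit a z"
proof -
  have "(slit_root a z)\<^sup>2 = (half_plane_slit a z)\<^sup>2"
    using assms slit_root_square[of z] half_plane_slit_square[of a z] by simp
  then have "slit_root a z = half_plane_slit a z \<or> slit_root a z = - half_plane_slit a z"
    by (simp add: power2_eq_iff)
  then show ?thesis
    using Im_slit_root[of a z] half_plane_slit_branch(2)[OF a assms] by (auto simp del: half_plane_slit_def)
qed

lemma slit_root_Im_pos: "0 < Im z \<Longrightarrow> 0 < Im (slit_root a z)"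
  using slit_root_interior half_plane_slit_branch(2)[OF a] by simp

text \<open>The sign factor jumps at the imaginary axis, but there the radicand is a negative real,
  so the real part \<open>f\<close> vanishes and the two halves glue.\<close>

lemma continuous_on_slit_root: "continuous_on {z. 0 \<le> Im z} (slit_root a)"
proof -
  define u where "u z = z\<^sup>2 * of_real (1 - a\<^sup>2) - of_real (a\<^sup>2)" for z :: complex
  define f where "f z = sqrt ((norm (u z) + Re (u z)) / 2)" for z
  have cu: "continuous_on UNIV f" "continuous_on UNIV (\<lambda>z. sqrt ((norm (u z) - Re (u z)) / 2))"
    unfolding u_def f_def by (auto intro!: continuous_intros)
  have f0: "f z = 0" if "Re z = 0" for z
  proof -
    have "u z = of_real (- ((Im z)\<^sup>2 * (1 - a\<^sup>2)) - a\<^sup>2)"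
      using that by (simp add: u_def complex_eq_iff Re_power2 Im_power2)
    moreover have "- ((Im z)\<^sup>2 * (1 - a\<^sup>2)) - a\<^sup>2 \<le> 0" using square_bounds
      by (smt (verit) mult_nonneg_nonneg zero_le_power2)
    ultimately have "norm (u z) + Re (u z) = 0" by (simp del: of_real_add of_real_diff)
    then show ?thesis by (simp add: f_def)
  qed
  have "continuous_on ({z. 0 \<le> Re z} \<union> {z. Re z \<le> 0}) (\<lambda>z. if 0 \<le> Re z then f z else - f z)"
    by (intro continuous_on_cases closed_halfspace_Re_ge closed_halfspace_Re_le)
       (auto intro!: continuous_intros continuous_on_subset[OF cu(1)] simp: f0)
  moreover have "({z. 0 \<le> Re z} \<union> {z. Re z \<le> 0}) = UNIV" by auto
  moreover have "(\<lambda>z. if 0 \<le> Re z then f z else - f z) = (\<lambda>z. (if 0 \<le> Re z then 1 else -1) * f z)" by auto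
  ultimately have "continuous_on UNIV (\<lambda>z. (if 0 \<le> Re z then 1 else -1) * f z)" by (simp only:)
  then have "continuous_on UNIV (\<lambda>z. Complex ((if 0 \<le> Re z then 1 else -1)
    * f z) (sqrt ((norm (u z) - Re (u z)) / 2)))"
    using cu(2) by (simp add: continuous_on_Complex)
  moreover have "slit_root a = (\<lambda>z. Complex ((if 0 \<le> Re z then 1 else -1)
    * f z) (sqrt ((norm (u z) - Re (u z)) / 2)))"
    by (rule ext) (simp add: slit_root_def Let_def u_def f_def)
  ultimately show ?thesis using continuous_on_subset by (metis subset_UNIV)
qed

lemma slit_root_inj: "inj_on (slit_root a) {z. 0 < Im z}"
proof (rule inj_onI)
  fix z w assume zw: "z \<in> {z. 0 < Im z}" "w \<in> {z. 0 < Im z}" "slit_root a z = slit_root a w"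
  then have "z\<^sup>2 * of_real (1 - a\<^sup>2) - of_real (a\<^sup>2) = w\<^sup>2 * of_real (1 - a\<^sup>2) - of_real (a\<^sup>2)"
    using slit_root_square[of z] slit_root_square[of w] by (metis mem_Collect_eq less_imp_le)
  then have "z\<^sup>2 * of_real (1 - a\<^sup>2) = w\<^sup>2 * of_real (1 - a\<^sup>2)" by (metis diff_add_cancel)
  moreover have "complex_of_real (1 - a\<^sup>2) \<noteq> 0" using square_bounds by (simp only: of_real_eq_0_iff)
  ultimately have "z\<^sup>2 = w\<^sup>2" by (metis mult_cancel_right)
  then show "z = w" using zw by (auto simp: power2_eq_iff)
qed

text \<open>A preimage would satisfy Re z = 0 and (Im z)^2 (1 - a^2) = y^2 - a^2 <= 0: the slit is
  hit only from the real line.\<close>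

lemma slit_root_not_slit:
  assumes "0 < Im z" "0 < y" "y \<le> a" shows "slit_root a z \<noteq> \<i> * of_real y"
proof
  assume "slit_root a z = \<i> * of_real y"
  then have e: "z\<^sup>2 * of_real (1 - a\<^sup>2) - of_real (a\<^sup>2) = of_real (- (y\<^sup>2))"
    using slit_root_square[of z] assms by (simp add: power_mult_distrib)
  from arg_cong[OF e, of Im] have "Re z = 0" using assms square_bounds by (simp add: Im_power2)
  with arg_cong[OF e, of Re] have "(Im z)\<^sup>2 * (1 - a\<^sup>2) = y\<^sup>2 - a\<^sup>2" by (simp add: Re_power2)
  moreover have "(Im z)\<^sup>2 * (1 - a\<^sup>2) > 0" using assms square_bounds by simp
  moreover have "y\<^sup>2 \<le> a\<^sup>2" using assms by simp
  ultimately show False by linarith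
qed

text \<open>The point i corresponds to infinity in the exterior of the disk. The radicand is -1 only
  if z^2 = -1, so no finite point is sent to infinity.\<close>

lemma slit_root_neq_i:
  assumes "0 \<le> Im z" "z \<noteq> \<i>" shows "slit_root a z \<noteq> \<i>"
proof
  assume "slit_root a z = \<i>"
  then have e: "z\<^sup>2 * of_real (1 - a\<^sup>2) - of_real (a\<^sup>2) = -1"
    using slit_root_square[of z] assms by simp
  have "(z\<^sup>2 + 1) * of_real (1 - a\<^sup>2) = (z\<^sup>2 * of_real (1 - a\<^sup>2) - of_real (a\<^sup>2)) + 1"
    by (simp add: algebra_simps)
  then have "(z\<^sup>2 + 1) * of_real (1 - a\<^sup>2) = 0" unfolding e by simp
  moreover have "complex_of_real (1 - a\<^sup>2) \<noteq> 0" using square_bounds by (simp only: of_real_eq_0_iff)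
  ultimately have "z\<^sup>2 = \<i>\<^sup>2" by (simp add: add_eq_0_iff2)
  then have "z = - \<i>" using assms unfolding power2_eq_iff by simp
  then show False using assms by simp
qed

lemma slit_root_real:
  fixes x :: real
  defines "v \<equiv> x\<^sup>2 * (1 - a\<^sup>2) - a\<^sup>2"
  shows "slit_root a (of_real x) = (if 0 \<le> v then of_real ((if 0 \<le> x then 1 else -1) * sqrt v) else \<i>
    * of_real (sqrt (- v)))"
proof -
  have "(of_real x)\<^sup>2 * of_real (1 - a\<^sup>2) - of_real (a\<^sup>2) = complex_of_real v" by (simp add: v_def)
  then have "slit_root a (of_real x) = Complex ((if 0 \<le> x then 1 else -1) * sqrt ((\<bar>v\<bar>
    + v) / 2)) (sqrt ((\<bar>v\<bar> - v) / 2))"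
    unfolding slit_root_def Let_def by (simp only: norm_of_real Re_complex_of_real)
  then show ?thesis unfolding v_def[symmetric] by (simp add: complex_eq_iff)
qed

text \<open>Real x with x^2 (1 - a^2) < a^2 fold onto the slit and the others cover the line. The
  foot 0 is counted with the line, hence the half-open range.\<close>

lemma slit_root_reals: "slit_root a ` \<real> = \<real> \<union> (\<lambda>y. \<i> * of_real y) ` {0<..a}"
proof (intro equalityI subsetI)
  fix w assume "w \<in> slit_root a ` \<real>"
  then obtain x :: real where w: "w = slit_root a (of_real x)" by (auto elim: Reals_cases)
  define v where "v = x\<^sup>2 * (1 - a\<^sup>2) - a\<^sup>2"
  have "- v \<le> a\<^sup>2" using square_bounds by (simp add: v_def)
  then have "sqrt (- v) \<le> a" using a real_le_lsqrt[of a "-v"]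
    by (metis less_eq_real_def real_sqrt_abs abs_of_nonneg real_sqrt_le_iff)
  then show "w \<in> \<real> \<union> (\<lambda>y. \<i> * of_real y) ` {0<..a}"
    using w slit_root_real[of x] unfolding v_def[symmetric] by (auto simp del: of_real_mult)
next
  fix w assume "w \<in> \<real> \<union> (\<lambda>y. \<i> * of_real y) ` {0<..a}"
  then consider r where "w = complex_of_real r" | y where "0 < y" "y \<le> a" "w = \<i> * complex_of_real y"
    by (auto elim: Reals_cases)
  then show "w \<in> slit_root a ` \<real>"
  proof cases
    case 1
    \<comment> \<open>Solves x^2 (1 - a^2) - a^2 = r^2 with the sign of \<open>r\<close>. Both ends
      of the folded interval map to 0; for r = 0 the right one is taken.\<close>
    define x where "x = (if 0 \<le> r then 1 else -1) * sqrt ((r\<^sup>2 + a\<^sup>2) / (1 - a\<^sup>2))"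
    have "x\<^sup>2 = (r\<^sup>2 + a\<^sup>2) / (1 - a\<^sup>2)" using square_bounds by (simp add: x_def power_mult_distrib)
    then have v: "x\<^sup>2 * (1 - a\<^sup>2) - a\<^sup>2 = r\<^sup>2" using square_bounds by simp
    have "0 < (r\<^sup>2 + a\<^sup>2) / (1 - a\<^sup>2)" using square_bounds by (simp add: add_nonneg_pos)
    then have "0 \<le> x \<longleftrightarrow> 0 \<le> r" by (auto simp: x_def)
    then have "slit_root a (of_real x) = of_real r"
      using slit_root_real[of x] unfolding v by auto
    then show ?thesis using 1 by (metis Reals_of_real imageI)
  next
    case 2
    define x where "x = sqrt ((a\<^sup>2 - y\<^sup>2) / (1 - a\<^sup>2))"
    have "y\<^sup>2 \<le> a\<^sup>2" using 2 by simp
    then have "x\<^sup>2 = (a\<^sup>2 - y\<^sup>2) / (1 - a\<^sup>2)" using square_bounds by (simp add: x_def)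
    then have v: "x\<^sup>2 * (1 - a\<^sup>2) - a\<^sup>2 = - (y\<^sup>2)" using square_bounds by simp
    have "slit_root a (of_real x) = \<i> * of_real y"
      using slit_root_real[of x] 2 unfolding v by auto
    then show ?thesis using 2 by (metis Reals_of_real imageI)
  qed
qed

text \<open>Growth at infinity, which becomes continuity of the disk map at -1.\<close>

lemma norm_slit_root_ge:
  assumes "0 \<le> Im z" shows "(norm z)\<^sup>2 * (1 - a\<^sup>2) - a\<^sup>2 \<le> (norm (slit_root a z))\<^sup>2"
proof -
  have "(norm (slit_root a z))\<^sup>2 = norm (z\<^sup>2 * of_real (1 - a\<^sup>2) - of_real (a\<^sup>2))"
    using slit_root_square[OF assms] by (metis norm_power)
  also have "\<dots> \<ge> norm (z\<^sup>2 * of_real (1 - a\<^sup>2)) - norm (complex_of_real (a\<^sup>2))" by (rule norm_triangle_ineq2)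
  finally show ?thesis using square_bounds by (simp add: norm_mult norm_power del: of_real_diff of_real_power)
qed

end

section \<open>The cylinder as the exterior of the unit disk\<close>

lemma cyl_to_disk_eq_iff:
  assumes "0 < N"
  shows "cyl_to_disk N z = cyl_to_disk N w \<longleftrightarrow> (\<exists>k::int. z = w + of_real (2 * pi * N * of_int k))"
proof -
  have "cyl_to_disk N z = cyl_to_disk N w \<longleftrightarrow>
     (\<exists>k::int. - \<i> * z / of_real N = - \<i> * w / of_real N + (of_int (2 * k) * pi) * \<i>)"
    unfolding cyl_to_disk_def by (rule exp_eq)
  also have "\<dots> \<longleftrightarrow> (\<exists>k::int. z = w + of_real (2 * pi * N * of_int (- k)))"
  proof (intro arg_cong[where f = Ex] ext)
    fix k :: int
    have "- \<i> * z / of_real N = - \<i> * w / of_real N + (of_int (2 * k) * pi) * \<i> \<longleftrightarrow>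
      - \<i> * z = - \<i> * w + (of_int (2 * k) * pi) * \<i> * of_real N" using assms by (simp add: field_simps)
    also have "\<dots> \<longleftrightarrow> \<i> * (- \<i> * z) = \<i> * (- \<i> * w + (of_int (2 * k) * pi) * \<i> * of_real N)"
      by (metis complex_i_not_zero mult_left_cancel)
    also have "\<dots> \<longleftrightarrow> z = w + of_real (2 * pi * N * of_int (- k))"
      by (simp add: algebra_simps)
    finally show "(- \<i> * z / of_real N = - \<i> * w / of_real N + (of_int (2 * k) * pi) * \<i>) = (z = w + of_real (2
      * pi * N * of_int (- k)))" .
  qed
  also have "\<dots> \<longleftrightarrow> (\<exists>k::int. z = w + of_real (2 * pi * N * of_int k))"
    by (metis minus_minus)
  finally show ?thesis .
qed

lemma cyl_to_disk_rep: "0 < N \<Longrightarrow> cyl_to_disk N (cyl_rep N z) = cyl_to_disk N z"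
  unfolding cyl_to_disk_eq_iff cyl_rep_def by (intro exI[of _ "- \<lfloor>Re z / (2 * pi * N)\<rfloor>"]) simp

lemma norm_cyl_to_disk: "norm (cyl_to_disk N z) = exp (Im z / N)"
  by (simp add: cyl_to_disk_def)

lemma norm_cyl_to_disk_ge: "0 < N \<Longrightarrow> 1 \<le> norm (cyl_to_disk N z) \<longleftrightarrow> 0 \<le> Im z"
  by (simp add: norm_cyl_to_disk zero_le_divide_iff)

lemma norm_cyl_to_disk_gt: "0 < N \<Longrightarrow> 1 < norm (cyl_to_disk N z) \<longleftrightarrow> 0 < Im z"
  by (simp add: norm_cyl_to_disk zero_less_divide_iff)

lemma norm_cyl_to_disk_eq: "0 < N \<Longrightarrow> norm (cyl_to_disk N z) = 1 \<longleftrightarrow> Im z = 0"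
  by (simp add: norm_cyl_to_disk)

lemma cyl_rep_eq_iff:
  assumes "0 < N" shows "cyl_rep N z = cyl_rep N w \<longleftrightarrow> cyl_to_disk N z = cyl_to_disk N w"
proof
  assume "cyl_rep N z = cyl_rep N w" then show "cyl_to_disk N z = cyl_to_disk N w"
    by (metis assms cyl_to_disk_rep)
next
  assume "cyl_to_disk N z = cyl_to_disk N w"
  then obtain k :: int where k: "z = w + of_real (2 * pi * N * of_int k)"
    using cyl_to_disk_eq_iff assms by blast
  have "Re z / (2 * pi * N) = Re w / (2 * pi * N) + of_int k"
    using assms by (simp add: k field_simps)
  then show "cyl_rep N z = cyl_rep N w" by (simp add: cyl_rep_def k algebra_simps)
qed

lemma cyl_to_disk_inj: "0 < N \<Longrightarrow> inj_on (cyl_to_disk N) (closed_cyl N)"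
  using cyl_rep_eq_iff[of N] cyl_rep_closed_cyl[of _ N] by (intro inj_onI) (metis (no_types))

lemma cyl_to_disk_surj:
  assumes "0 < N" "w \<noteq> 0" obtains z where "cyl_to_disk N z = w"
proof
  show "cyl_to_disk N (\<i> * of_real N * Ln w) = w"
    using assms by (simp add: cyl_to_disk_def)
qed

lemma cyl_to_disk_closed_cyl:
  assumes "0 < N" shows "cyl_to_disk N ` closed_cyl N = {w. 1 \<le> norm w}"
proof (intro equalityI subsetI)
  fix w :: complex assume w: "w \<in> {w. 1 \<le> norm w}"
  then have "w \<noteq> 0" by auto
  then obtain z where z: "cyl_to_disk N z = w" using cyl_to_disk_surj assms by blast
  then have "cyl_rep N z \<in> closed_cyl N"
    using w norm_cyl_to_disk_ge[OF assms] by (intro cyl_rep_in_closed_cyl assms) auto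
  then show "w \<in> cyl_to_disk N ` closed_cyl N" using z cyl_to_disk_rep[OF assms, of z] by (metis imageI)
qed (auto simp: norm_cyl_to_disk_ge[OF assms] closed_cyl_def open_cyl_def cyl_boundary_def)

lemma cyl_to_disk_open_cyl:
  assumes "0 < N" shows "cyl_to_disk N ` open_cyl N = ext_disk"
proof (intro equalityI subsetI)
  fix w assume w: "w \<in> ext_disk"
  then obtain z where z: "z \<in> closed_cyl N" "w = cyl_to_disk N z"
    using cyl_to_disk_closed_cyl[OF assms] by (force simp: ext_disk_def)
  then have "z \<in> open_cyl N" using w norm_cyl_to_disk_gt[OF assms]
    by (auto simp: ext_disk_def closed_cyl_def cyl_boundary_def)
  then show "w \<in> cyl_to_disk N ` open_cyl N" using z by blast
qed (auto simp: norm_cyl_to_disk_gt[OF assms] open_cyl_def ext_disk_def)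

lemma cyl_to_disk_boundary:
  assumes "0 < N" shows "cyl_to_disk N ` cyl_boundary N = {w. norm w = 1}"
proof (intro equalityI subsetI)
  fix w :: complex assume w: "w \<in> {w. norm w = 1}"
  then obtain z where z: "z \<in> closed_cyl N" "w = cyl_to_disk N z"
    using cyl_to_disk_closed_cyl[OF assms] by force
  then have "z \<in> cyl_boundary N" using w norm_cyl_to_disk_eq[OF assms]
    by (auto simp: closed_cyl_def open_cyl_def)
  then show "w \<in> cyl_to_disk N ` cyl_boundary N" using z by blast
qed (auto simp: norm_cyl_to_disk_eq[OF assms] cyl_boundary_def)

lemma continuous_map_cyl_to_disk:
  assumes "0 < N"
  shows "continuous_map (cyl_topology N) (top_of_set {w. 1 \<le> norm w}) (cyl_to_disk N)"
proof (rule continuous_compose_quotient_map[OF quotient_map_cyl_rep[OF assms]])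
  have "continuous_on {z. 0 \<le> Im z} (cyl_to_disk N)"
    unfolding cyl_to_disk_def using assms by (auto intro!: continuous_intros)
  then have "continuous_map (top_of_set {z. 0 \<le> Im z}) (top_of_set {w. 1 \<le> norm w}) (cyl_to_disk N)"
    by (auto simp: continuous_map_in_subtopology norm_cyl_to_disk_ge[OF assms])
  then show "continuous_map (top_of_set {z. 0 \<le> Im z}) (top_of_set {w. 1 \<le> norm w}) (cyl_to_disk N \<circ> cyl_rep N)"
    by (rule continuous_map_eq) (simp add: cyl_to_disk_rep[OF assms])
qed

lemma Hausdorff_cyl_topology: "0 < N \<Longrightarrow> Hausdorff_space (cyl_topology N)"
  by (rule Hausdorff_space_injective_preimage[OF _ continuous_map_cyl_to_disk[of N]])
     (auto simp: topspace_cyl_topology cyl_to_disk_inj intro: Hausdorff_space_subtopology)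

lemma limitin_cyl_rep:
  assumes N: "0 < N" and z: "0 \<le> Im z" and lim: "(f \<longlongrightarrow> z) F" and ev: "eventually (\<lambda>x. 0 \<le> Im (f x)) F"
  shows "limitin (cyl_topology N) (\<lambda>x. cyl_rep N (f x)) (cyl_rep N z) F"
proof -
  have "limitin (top_of_set {z. 0 \<le> Im z}) f z F"
    using assms by (auto simp: limitin_subtopology)
  from continuous_map_limit[OF quotient_imp_continuous_map[OF quotient_map_cyl_rep[OF N]] this]
  show ?thesis by (simp add: o_def)
qed

text \<open>This is continuity of the inverse of \<open>cyl_to_disk\<close>. The ratio of the two
  images tends to 1, where \<open>Ln\<close> is continuous, so the lift \<open>h\<close> of
  \<open>f\<close> to the plane converges to \<open>w\<close>; the quotient map brings the limit
  back to the cylinder.\<close>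

lemma limitin_cyl_topology:
  assumes N: "0 < N" and w: "w \<in> closed_cyl N" and f: "eventually (\<lambda>x. f x \<in> closed_cyl N) F"
    and lim: "((\<lambda>x. cyl_to_disk N (f x)) \<longlongrightarrow> cyl_to_disk N w) F"
  shows "limitin (cyl_topology N) f w F"
proof -
  define h where "h x = w + \<i> * of_real N * Ln (cyl_to_disk N (f x) / cyl_to_disk N w)" for x
  have nz: "cyl_to_disk N z \<noteq> 0" for z by (simp add: cyl_to_disk_def)
  have Imw: "0 \<le> Im w" using w by (auto simp: closed_cyl_def open_cyl_def cyl_boundary_def)
  have "((\<lambda>x. cyl_to_disk N (f x) / cyl_to_disk N w) \<longlongrightarrow> 1) F"
    using tendsto_divide[OF lim tendsto_const nz[of w]] nz[of w] by simp
  then have "((\<lambda>x. Ln (cyl_to_disk N (f x) / cyl_to_disk N w)) \<longlongrightarrow> Ln 1) F"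
    by (rule tendsto_Ln) simp
  then have "(h \<longlongrightarrow> w + \<i> * of_real N * Ln 1) F"
    unfolding h_def by (intro tendsto_add tendsto_mult tendsto_const)
  then have hlim: "(h \<longlongrightarrow> w) F" by simp
  have Eh: "cyl_to_disk N (h x) = cyl_to_disk N (f x)" for x
  proof -
    have "- \<i> * (w + \<i> * of_real N * u) / of_real N = - \<i> * w / of_real N + u" for u
      using N by (simp add: field_simps)
    then have "cyl_to_disk N (h x) = cyl_to_disk N w * exp (Ln (cyl_to_disk N (f x) / cyl_to_disk N w))"
      unfolding h_def cyl_to_disk_def by (simp only: exp_add)
    then show ?thesis using nz by simp
  qed
  have hf: "eventually (\<lambda>x. cyl_rep N (h x) = f x) F"
    using f by eventually_elim (metis Eh N cyl_rep_closed_cyl cyl_rep_eq_iff)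
  have "eventually (\<lambda>x. 0 \<le> Im (h x)) F"
    using f by eventually_elim (metis Eh N norm_cyl_to_disk_ge cyl_to_disk_closed_cyl imageI mem_Collect_eq)
  from limitin_cyl_rep[OF N Imw hlim this]
  have "limitin (cyl_topology N) (\<lambda>x. cyl_rep N (h x)) w F"
    using cyl_rep_closed_cyl[OF w] by simp
  then show ?thesis
    by (rule limitin_transform_eventually[OF hf])
qed

text \<open>Lets components in the quotient topology be counted as components of subsets of the
  plane.\<close>

lemma homeomorphic_map_cyl_to_disk:
  assumes N: "0 < N"
  shows "homeomorphic_map (cyl_topology N) (top_of_set {w. 1 \<le> norm w}) (cyl_to_disk N)"
proof -
  let ?W = "{w::complex. 1 \<le> norm w}"
  define g where "g = the_inv_into (closed_cyl N) (cyl_to_disk N)"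
  have gE: "g (cyl_to_disk N z) = z" if "z \<in> closed_cyl N" for z
    using that cyl_to_disk_inj[OF N] by (simp add: g_def the_inv_into_f_f)
  have g: "g w \<in> closed_cyl N" "cyl_to_disk N (g w) = w" if "w \<in> ?W" for w
  proof -
    have w: "w \<in> cyl_to_disk N ` closed_cyl N" using that cyl_to_disk_closed_cyl[OF N] by simp
    show "g w \<in> closed_cyl N" unfolding g_def using the_inv_into_into[OF cyl_to_disk_inj[OF N] w] by auto
    show "cyl_to_disk N (g w) = w" unfolding g_def using f_the_inv_into_f[OF cyl_to_disk_inj[OF N] w] .
  qed
  have eq: "atin_within euclidean w S = at w within S" for w :: complex and S
    by (auto simp: filter_eq_iff eventually_atin_within eventually_at_topological)
  have "continuous_map (top_of_set ?W) (cyl_topology N) g"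
    unfolding continuous_map_atin
  proof
    fix w assume w: "w \<in> topspace (top_of_set ?W)"
    then have w': "w \<in> ?W" by simp
    have "limitin (cyl_topology N) g (g w) (at w within ?W)"
    proof (rule limitin_cyl_topology[OF N g(1)[OF w']])
      show "eventually (\<lambda>x. g x \<in> closed_cyl N) (at w within ?W)"
        using g by (auto simp: eventually_at_topological)
      have "eventually (\<lambda>x. x = cyl_to_disk N (g x)) (at w within ?W)"
        using g by (auto simp: eventually_at_topological)
      from tendsto_cong[OF this, of w]
      show "((\<lambda>x. cyl_to_disk N (g x)) \<longlongrightarrow> cyl_to_disk N (g w)) (at w within ?W)"
        unfolding g(2)[OF w'] by (simp only: tendsto_ident_at)
    qed
    then show "limitin (cyl_topology N) g (g w) (atin (top_of_set ?W) w)"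
      using w' by (simp add: atin_subtopology_within eq)
  qed
  then have "homeomorphic_maps (cyl_topology N) (top_of_set ?W) (cyl_to_disk N) g"
    using continuous_map_cyl_to_disk[OF N] g gE
    by (auto simp: homeomorphic_maps_def topspace_cyl_topology[OF N])
  then show ?thesis using homeomorphic_map_maps by blast
qed

section \<open>The slit map of the exterior of the disk\<close>

text \<open>The inverse Moebius map of \<open>disk_to_half_plane\<close>; its pole i is the image of
  infinity.\<close>

definition half_plane_to_disk :: "complex \<Rightarrow> complex" where
  "half_plane_to_disk z = (\<i> + z) / (\<i> - z)"

text \<open>The half-plane coordinate of -1 is infinity, which the half-plane map fixes; its value
  at -1 is therefore set by hand.\<close>

definition disk_slit :: "real \<Rightarrow> complex \<Rightarrow> complex" where
  "disk_slit a w = (if w = -1 then -1 else half_plane_to_disk (slit_root a (disk_to_half_plane w)))"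

text \<open>The image of the segment from 0 to ia, without its foot 1. For a =
  \<open>slit_delta N lam\<close> the tip is (1 + a)/(1 - a) = exp(lam/N), a slit of height lam on
  the cylinder.\<close>

definition radial_slit :: "real \<Rightarrow> complex set" where
  "radial_slit a = (\<lambda>y. of_real ((1 + y) / (1 - y))) ` {0<..a}"

lemma half_plane_to_disk_inverse:
  assumes "w \<noteq> -1" shows "half_plane_to_disk (disk_to_half_plane w) = w" "disk_to_half_plane w \<noteq> \<i>"
proof -
  have nz: "w + 1 \<noteq> 0" using assms by (simp add: add_eq_0_iff2)
  have 1: "\<i> + disk_to_half_plane w = 2 * \<i> * w / (w + 1)" "\<i> - disk_to_half_plane w = 2 * \<i> / (w + 1)"
    using nz by (simp_all add: disk_to_half_plane_def field_simps)
  show "half_plane_to_disk (disk_to_half_plane w) = w"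
    unfolding half_plane_to_disk_def 1 using nz by simp
  show "disk_to_half_plane w \<noteq> \<i>" using 1(2) nz by auto
qed

lemma disk_to_half_plane_inverse:
  assumes "z \<noteq> \<i>" shows "disk_to_half_plane (half_plane_to_disk z) = z" "half_plane_to_disk z \<noteq> -1"
proof -
  have nz: "\<i> - z \<noteq> 0" using assms by simp
  have 1: "half_plane_to_disk z - 1 = 2 * z / (\<i> - z)" "half_plane_to_disk z + 1 = 2 * \<i> / (\<i> - z)"
    using nz by (simp_all add: half_plane_to_disk_def field_simps)
  show "disk_to_half_plane (half_plane_to_disk z) = z"
    unfolding disk_to_half_plane_def 1 using nz by simp
  show "half_plane_to_disk z \<noteq> -1" using 1(2) nz by auto
qed

lemma Im_disk_to_half_plane:
  assumes "w \<noteq> -1" shows "Im (disk_to_half_plane w) = ((norm w)\<^sup>2 - 1) / (norm (w + 1))\<^sup>2"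
proof -
  have "disk_to_half_plane w = \<i> * ((w - 1) * cnj (w + 1)) / of_real ((norm (w + 1))\<^sup>2)"
    unfolding disk_to_half_plane_def using assms
    by (subst complex_div_cnj) (simp add: mult.assoc)
  then have "Im (disk_to_half_plane w) = Re ((w - 1) * cnj (w + 1)) / (norm (w + 1))\<^sup>2"
    by (simp only: Im_divide_of_real Im_i_times)
  also have "Re ((w - 1) * cnj (w + 1)) = (norm w)\<^sup>2 - 1"
    unfolding cmod_power2 by (simp add: power2_eq_square algebra_simps)
  finally show ?thesis .
qed

lemma disk_to_half_plane_norm:
  assumes "w \<noteq> -1"
  shows "0 \<le> Im (disk_to_half_plane w) \<longleftrightarrow> 1 \<le> norm w"
    and "0 < Im (disk_to_half_plane w) \<longleftrightarrow> 1 < norm w"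
    and "Im (disk_to_half_plane w) = 0 \<longleftrightarrow> norm w = 1"
proof -
  have "0 < (norm (w + 1))\<^sup>2" using assms by (simp add: add_eq_0_iff2)
  moreover have "1 \<le> (norm w)\<^sup>2 \<longleftrightarrow> 1 \<le> norm w" "1 < (norm w)\<^sup>2 \<longleftrightarrow> 1 < norm w" "(norm w)\<^sup>2 = 1 \<longleftrightarrow> norm w = 1"
    using power_mono_iff[of 1 "norm w" 2] power_mono_iff[of "norm w" 1 2] by (auto simp: power2_eq_1_iff)
  ultimately show "0 \<le> Im (disk_to_half_plane w) \<longleftrightarrow> 1 \<le> norm w"
    and "0 < Im (disk_to_half_plane w) \<longleftrightarrow> 1 < norm w"
    and "Im (disk_to_half_plane w) = 0 \<longleftrightarrow> norm w = 1"
    using assms by (simp_all add: Im_disk_to_half_plane zero_le_divide_iff zero_less_divide_iff add_eq_0_iff2)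
qed

lemma norm_half_plane_to_disk:
  assumes "z \<noteq> \<i>"
  shows "1 \<le> norm (half_plane_to_disk z) \<longleftrightarrow> 0 \<le> Im z"
    and "1 < norm (half_plane_to_disk z) \<longleftrightarrow> 0 < Im z"
    and "norm (half_plane_to_disk z) = 1 \<longleftrightarrow> Im z = 0"
  using disk_to_half_plane_norm[of "half_plane_to_disk z"] disk_to_half_plane_inverse[OF assms] by auto

lemma disk_to_half_plane_inj: "inj_on disk_to_half_plane (- {-1})"
  by (intro inj_onI) (metis ComplD half_plane_to_disk_inverse(1) insertI1)

section \<open>The disk slit map on the circle and in the exterior\<close>

context
  fixes a :: real
  assumes a: "0 < a" "a < 1"
begin

lemma slit_root_disk_neq_i:
  assumes "w \<noteq> -1" "1 \<le> norm w" shows "slit_root a (disk_to_half_plane w) \<noteq> \<i>"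
  using slit_root_neq_i[OF a] assms disk_to_half_plane_norm half_plane_to_disk_inverse by blast

lemma norm_disk_slit: "1 \<le> norm w \<Longrightarrow> 1 \<le> norm (disk_slit a w)"
  using norm_half_plane_to_disk(1)[OF slit_root_disk_neq_i[of w]] Im_slit_root by (auto simp: disk_slit_def)

lemma norm_disk_slit_gt: "1 < norm w \<Longrightarrow> 1 < norm (disk_slit a w)"
  using norm_half_plane_to_disk(2)[OF slit_root_disk_neq_i[of w]] slit_root_Im_pos[OF a] disk_to_half_plane_norm(2)[of w]
  by (auto simp: disk_slit_def)

lemma disk_slit_inj: "inj_on (disk_slit a) {w. 1 < norm w}"
proof (rule inj_onI)
  fix v w :: complex assume v: "v \<in> {w. 1 < norm w}" and w: "w \<in> {w. 1 < norm w}" and eq: "disk_slit a v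
    = disk_slit a w"
  have n1: "v \<noteq> -1" "w \<noteq> -1" using v w by auto
  have "slit_root a (disk_to_half_plane v) = slit_root a (disk_to_half_plane w)"
  proof -
    have "disk_to_half_plane (disk_slit a u) = slit_root a (disk_to_half_plane u)" if "1 < norm u" "u \<noteq> -1" for u
      using that disk_to_half_plane_inverse(1)[OF slit_root_disk_neq_i[of u]] by (simp add: disk_slit_def)
    then show ?thesis using eq v w n1 by (metis mem_Collect_eq)
  qed
  then have "disk_to_half_plane v = disk_to_half_plane w"
    using slit_root_inj[OF a] disk_to_half_plane_norm(2) n1 v w by (auto simp: inj_on_def)
  then show "v = w" using half_plane_to_disk_inverse(1) n1 by metis
qed

lemma half_plane_to_disk_imaginary:
  "half_plane_to_disk (\<i> * of_real y) = of_real ((1 + y) / (1 - y))"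
proof -
  have "half_plane_to_disk (\<i> * of_real y) = (\<i> * (1 + of_real y)) / (\<i> * (1 - of_real y))"
    by (simp add: half_plane_to_disk_def algebra_simps)
  then show ?thesis by simp
qed

lemma radial_slit_eq: "radial_slit a = half_plane_to_disk ` (\<lambda>y. \<i> * of_real y) ` {0<..a}"
  unfolding radial_slit_def image_image half_plane_to_disk_imaginary ..

lemma disk_slit_notin_radial_slit:
  assumes "1 < norm w" shows "disk_slit a w \<notin> radial_slit a"
proof
  assume "disk_slit a w \<in> radial_slit a"
  then obtain y where y: "0 < y" "y \<le> a" "disk_slit a w = half_plane_to_disk (\<i> * of_real y)"
    unfolding radial_slit_eq by auto
  have w: "w \<noteq> -1" "1 \<le> norm w" using assms by auto
  have "\<i> * of_real y \<noteq> \<i>" using y a by auto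
  then have "slit_root a (disk_to_half_plane w) = \<i> * of_real y"
    using y(3) w slit_root_disk_neq_i[OF w] disk_to_half_plane_inverse(1) by (metis disk_slit_def)
  then show False
    using slit_root_not_slit[OF a] y disk_to_half_plane_norm(2)[OF w(1)] assms by blast
qed

lemma norm_radial_slit:
  assumes "w \<in> radial_slit a" shows "1 < norm w"
proof -
  obtain y where y: "0 < y" "y \<le> a" "w = of_real ((1 + y) / (1 - y))"
    using assms by (auto simp: radial_slit_def)
  have "1 < (1 + y) / (1 - y)" using y a by (simp add: field_simps)
  also have "\<dots> \<le> norm w" unfolding y(3) norm_of_real by (rule abs_ge_self)
  finally show ?thesis .
qed

lemma disk_to_half_plane_circle: "disk_to_half_plane ` ({w. norm w = 1} - {-1}) = \<real>"
proof (intro equalityI subsetI)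
  fix z :: complex assume "z \<in> \<real>"
  then have "Im z = 0" "z \<noteq> \<i>" by (auto simp: complex_is_Real_iff)
  then show "z \<in> disk_to_half_plane ` ({w. norm w = 1} - {-1})"
    using disk_to_half_plane_inverse[of z] norm_half_plane_to_disk(3)[of z] by (intro image_eqI[of _ _
      "half_plane_to_disk z"]) auto
next
  fix z assume "z \<in> disk_to_half_plane ` ({w. norm w = 1} - {-1})"
  then obtain w where "z = disk_to_half_plane w" "norm w = 1" "w \<noteq> -1" by auto
  then show "z \<in> \<real>" using disk_to_half_plane_norm(3)[of w] by (simp add: complex_is_Real_iff)
qed

lemma disk_slit_circle: "disk_slit a ` {w. norm w = 1} = {w. norm w = 1} \<union> radial_slit a"
proof -
  have "disk_slit a ` ({w. norm w = 1} - {-1})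
    = half_plane_to_disk ` slit_root a ` disk_to_half_plane ` ({w. norm w = 1} - {-1})"
    unfolding image_image by (intro image_cong) (auto simp: disk_slit_def)
  also have "\<dots> = half_plane_to_disk ` disk_to_half_plane ` ({w. norm w = 1} - {-1}) \<union> radial_slit a"
    unfolding disk_to_half_plane_circle slit_root_reals[OF a] radial_slit_eq image_Un ..
  also have "half_plane_to_disk ` disk_to_half_plane ` ({w. norm w = 1} - {-1}) = {w. norm w = 1} - {-1}"
    unfolding image_image using half_plane_to_disk_inverse(1) by (auto simp: image_iff)
  finally have "insert (disk_slit a (-1)) (disk_slit a ` ({w. norm w = 1} - {-1})) = insert (-1) ({w. norm w
    = 1} - {-1} \<union> radial_slit a)"
    by (simp add: disk_slit_def)
  moreover have "insert (disk_slit a (-1)) (disk_slit a ` ({w. norm w = 1} - {-1})) = disk_slit a ` {w. norm w = 1}"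
    unfolding image_insert[symmetric] by (rule arg_cong) auto
  moreover have "insert (-1) ({w. norm w = 1} - {-1} \<union> radial_slit a) = {w. norm w = 1} \<union> radial_slit a" by auto
  ultimately show ?thesis by simp
qed

text \<open>The half-plane coordinate of w is a real x with x^2 = (1 - Re w)/(1 + Re w), the squared
  tangent of the half angle; w stays on the circle iff x^2 (1 - a^2) >= a^2. Written with (1 + Re
  w)/2, the squared cosine, the criterion also covers w = -1.\<close>

lemma norm_disk_slit_eq_1:
  assumes w: "norm w = 1" shows "norm (disk_slit a w) = 1 \<longleftrightarrow> (1 + Re w) / 2 \<le> 1 - a\<^sup>2"
proof (cases "w = -1")
  case True then show ?thesis using square_bounds[OF a] by (simp add: disk_slit_def)
next
  case False
  let ?z = "disk_to_half_plane w"
  have "Im ?z = 0" using w False disk_to_half_plane_norm(3) by blast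
  then obtain x where x: "?z = of_real x" by (metis complex_is_Real_iff Reals_cases)
  have "norm (disk_slit a w) = 1 \<longleftrightarrow> Im (slit_root a ?z) = 0"
    using False w norm_half_plane_to_disk(3)[OF slit_root_disk_neq_i[of w]] by (auto simp: disk_slit_def)
  also have "\<dots> \<longleftrightarrow> 0 \<le> x\<^sup>2 * (1 - a\<^sup>2) - a\<^sup>2"
    unfolding x slit_root_real[OF a] by simp
  also have "\<dots> \<longleftrightarrow> (1 + Re w) / 2 \<le> 1 - a\<^sup>2"
  proof -
    have 1: "(Re w)\<^sup>2 + (Im w)\<^sup>2 = 1" using w by (metis cmod_power2 power_one)
    have eqs: "(norm (w - 1))\<^sup>2 = 2 - 2 * Re w" "(norm (w + 1))\<^sup>2 = 2 + 2 * Re w"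
      unfolding cmod_power2 using 1 by (simp_all add: power2_eq_square algebra_simps)
    have "x\<^sup>2 = (norm ?z)\<^sup>2" by (simp add: x)
    also have "\<dots> = (norm (w - 1))\<^sup>2 / (norm (w + 1))\<^sup>2"
      by (simp add: disk_to_half_plane_def norm_divide norm_mult power_divide)
    finally have x2: "x\<^sup>2 = (2 - 2 * Re w) / (2 + 2 * Re w)" unfolding eqs .
    have "0 < (norm (w + 1))\<^sup>2" using False by (simp add: add_eq_0_iff2)
    then have p: "0 < 2 + 2 * Re w" using \<open>(norm (w + 1))\<^sup>2 = 2 + 2 * Re w\<close> by simp
    show ?thesis unfolding x2 using p by (auto simp: field_simps)
  qed
  finally show ?thesis .
qed

text \<open>As w tends to -1 its half-plane coordinate tends to infinity, and so does the root s by
  \<open>norm_slit_root_ge\<close>. The return map equals 2i/(i - s) - 1, which then tends to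
  -1.\<close>

lemma disk_slit_tendsto_m1: "(disk_slit a \<longlongrightarrow> -1) (at (-1) within {w. 1 \<le> norm w})"
proof -
  let ?F = "at (-1) within {w::complex. 1 \<le> norm w}"
  let ?s = "\<lambda>w. slit_root a (disk_to_half_plane w)"
  have "filterlim (\<lambda>w::complex. w + 1) (at 0) ?F"
    unfolding filterlim_at by (auto intro!: tendsto_eq_intros simp: eventually_at_filter add_eq_0_iff2)
  moreover have "((\<lambda>w::complex. \<i> * (w - 1)) \<longlongrightarrow> \<i> * (-1 - 1)) ?F"
    by (intro tendsto_intros)
  ultimately have "filterlim disk_to_half_plane at_infinity ?F"
    unfolding disk_to_half_plane_def by (intro filterlim_divide_at_infinity) auto
  then have g: "filterlim (\<lambda>w. norm (disk_to_half_plane w)) at_top ?F"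
    by (simp add: filterlim_at_infinity_conv_norm_at_top)
  have "filterlim (\<lambda>w. - (a\<^sup>2) + (norm (disk_to_half_plane w))\<^sup>2 * (1 - a\<^sup>2)) at_top ?F"
    using square_bounds[OF a]
    by (intro filterlim_tendsto_add_at_top[OF tendsto_const] filterlim_at_top_mult_tendsto_pos[OF tendsto_const]
        filterlim_pow_at_top g) auto
  moreover have "eventually (\<lambda>w. - (a\<^sup>2) + (norm (disk_to_half_plane w))\<^sup>2 * (1 - a\<^sup>2) \<le> (norm (?s w))\<^sup>2) ?F"
    unfolding eventually_at_filter
  proof (intro always_eventually allI impI)
    fix w :: complex assume "w \<noteq> -1" "w \<in> {w. 1 \<le> norm w}"
    then have "0 \<le> Im (disk_to_half_plane w)" using disk_to_half_plane_norm(1) by simp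
    from norm_slit_root_ge[OF a this]
    show "- (a\<^sup>2) + (norm (disk_to_half_plane w))\<^sup>2 * (1 - a\<^sup>2) \<le> (norm (?s w))\<^sup>2" by simp
  qed
  ultimately have "filterlim (\<lambda>w. (norm (?s w))\<^sup>2) at_top ?F"
    by (rule filterlim_at_top_mono)
  then have "filterlim (\<lambda>w. sqrt ((norm (?s w))\<^sup>2)) at_top ?F"
    by (rule filterlim_compose[OF sqrt_at_top])
  then have s: "filterlim ?s at_infinity ?F"
    by (simp add: filterlim_at_infinity_conv_norm_at_top)
  have "filterlim (\<lambda>w. \<i> + - ?s w) at_infinity ?F"
    using s by (intro tendsto_add_filterlim_at_infinity[OF tendsto_const]) (simp add: filterlim_at_infinity_conv_norm_at_top)
  then have "((\<lambda>w. 2 * \<i> / (\<i> + - ?s w)) \<longlongrightarrow> 0) ?F"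
    by (rule tendsto_divide_0[OF tendsto_const])
  from tendsto_add[OF this tendsto_const[of "-1"]]
  have "((\<lambda>w. 2 * \<i> / (\<i> + - ?s w) + -1) \<longlongrightarrow> -1) ?F" by simp
  then show ?thesis
  proof (rule Lim_transform_eventually)
    show "eventually (\<lambda>w. 2 * \<i> / (\<i> + - ?s w) + -1 = disk_slit a w) ?F"
      unfolding eventually_at_filter
    proof (intro always_eventually allI impI)
      fix w :: complex assume w: "w \<noteq> -1" "w \<in> {w. 1 \<le> norm w}"
      then have "?s w \<noteq> \<i>" using slit_root_disk_neq_i by simp
      then show "2 * \<i> / (\<i> + - ?s w) + -1 = disk_slit a w"
        using w by (simp add: disk_slit_def half_plane_to_disk_def field_simps)
    qed
  qed
qed

lemma continuous_on_disk_slit: "continuous_on {w. 1 \<le> norm w} (disk_slit a)"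
proof -
  let ?W = "{w::complex. 1 \<le> norm w}"
  let ?s = "\<lambda>w. slit_root a (disk_to_half_plane w)"
  have g: "continuous_on (?W - {-1}) disk_to_half_plane"
    unfolding disk_to_half_plane_def by (auto intro!: continuous_intros simp: add_eq_0_iff2)
  have "continuous_on (?W - {-1}) ?s"
    by (rule continuous_on_compose2[OF continuous_on_slit_root[OF a] g]) (auto simp: disk_to_half_plane_norm)
  then have "continuous_on (?W - {-1}) (\<lambda>w. half_plane_to_disk (?s w))"
    unfolding half_plane_to_disk_def using slit_root_disk_neq_i by (intro continuous_intros) force+
  then have c: "continuous_on (?W - {-1}) (disk_slit a)"
    by (rule continuous_on_eq) (auto simp: disk_slit_def)
  have "continuous (at w within ?W) (disk_slit a)" if "w \<in> ?W" for w
  proof (cases "w = -1")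
    case True
    then show ?thesis using disk_slit_tendsto_m1 by (simp add: continuous_within disk_slit_def)
  next
    case False
    then have "continuous (at w within ?W - {-1}) (disk_slit a)"
      using c that by (auto simp: continuous_on_eq_continuous_within)
    moreover have "at w within ?W - {-1} = at w within ?W"
      using False by (intro at_within_nhd[of _ "- {-1}"]) auto
    ultimately show ?thesis by simp
  qed
  then show ?thesis by (simp add: continuous_on_eq_continuous_within)
qed

end

section \<open>Trees in the exterior of the disk\<close>

lemma slit_delta_bounds: "0 < lam \<Longrightarrow> 0 < N \<Longrightarrow> 0 < slit_delta N lam" "slit_delta N lam < 1"
  by (simp_all add: slit_delta_def add_pos_pos)

text \<open>Translation by \<open>x\<close> on the cylinder is rotation by
  \<open>cyl_to_disk N x\<close> here, so this is \<open>slit_map_at\<close> seen in the disk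
  exterior.\<close>

definition rot_slit :: "real \<Rightarrow> real \<Rightarrow> real \<Rightarrow> complex \<Rightarrow> complex" where
  "rot_slit N a x w = cyl_to_disk N (of_real x) * disk_slit a (w / cyl_to_disk N (of_real x))"

definition disk_chl :: "real \<Rightarrow> real \<Rightarrow> real list \<Rightarrow> complex \<Rightarrow> complex" where
  "disk_chl N a xs = foldr (\<circ>) (map (rot_slit N a) xs) id"

definition tree_count :: "real \<Rightarrow> real \<Rightarrow> real list \<Rightarrow> nat" where
  "tree_count N a xs = card (components (disk_chl N a xs ` {w. norm w = 1} - {w. norm w = 1}))"

definition exposed :: "real \<Rightarrow> real \<Rightarrow> real list \<Rightarrow> real \<Rightarrow> bool" where
  "exposed N a xs x \<longleftrightarrow> norm (disk_chl N a xs (cyl_to_disk N (of_real x))) = 1"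

lemma norm_cyl_to_disk_real [simp]: "norm (cyl_to_disk N (of_real x)) = 1"
  by (simp add: norm_cyl_to_disk)

lemma cyl_to_disk_real_nonzero [simp]: "cyl_to_disk N (of_real x) \<noteq> 0"
  by (simp add: cyl_to_disk_def)

lemma cyl_to_disk_add: "cyl_to_disk N (z + w) = cyl_to_disk N z * cyl_to_disk N w"
proof -
  have "- \<i> * (z + w) / of_real N = - \<i> * z / of_real N + - \<i> * w / of_real N"
    by (simp add: ring_distribs add_divide_distrib diff_divide_distrib)
  then show ?thesis unfolding cyl_to_disk_def by (simp only: exp_add)
qed

lemma cyl_to_disk_diff: "cyl_to_disk N (z - w) = cyl_to_disk N z / cyl_to_disk N w"
  using cyl_to_disk_add[of N "z - w" w] by (simp add: cyl_to_disk_def)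

lemma closed_cyl_Im: "z \<in> closed_cyl N \<Longrightarrow> 0 \<le> Im z"
  by (auto simp: closed_cyl_def open_cyl_def cyl_boundary_def)

lemma continuous_on_cyl_to_disk: "0 < N \<Longrightarrow> continuous_on S (cyl_to_disk N)"
  unfolding cyl_to_disk_def by (auto intro!: continuous_intros)

section \<open>Transport of the slit maps from the cylinder\<close>

context
  fixes N lam :: real
  assumes N: "0 < N" and lam: "0 < lam"
begin

lemmas delta_bounds = slit_delta_bounds(1)[OF lam N] slit_delta_bounds(2)[of N lam]

lemma slit_map_interior:
  assumes z: "0 < Im z"
  shows "slit_map_interior N lam z \<in> open_cyl N"
    and "cyl_to_disk N (slit_map_interior N lam z) = disk_slit (slit_delta N lam) (cyl_to_disk N z)"
proof -
  let ?w = "cyl_to_disk N z"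
  let ?z = "slit_root (slit_delta N lam) (disk_to_half_plane ?w)"
  have w: "1 < norm ?w" using norm_cyl_to_disk_gt[OF N] z by simp
  then have w1: "?w \<noteq> -1" by auto
  have g: "0 < Im (disk_to_half_plane ?w)" using disk_to_half_plane_norm(2)[OF w1] w by simp
  have zn: "?z \<noteq> \<i>" using slit_root_disk_neq_i[OF delta_bounds w1] w by simp
  have ext: "half_plane_to_disk ?z \<in> ext_disk"
    using norm_half_plane_to_disk(2)[OF zn] slit_root_Im_pos[OF delta_bounds g] by (simp add: ext_disk_def)
  have "inj_on disk_to_half_plane ext_disk"
    by (rule inj_on_subset[OF disk_to_half_plane_inj]) (auto simp: ext_disk_def)
  from the_inv_into_f_eq[OF this disk_to_half_plane_inverse(1)[OF zn] ext]
  have "the_inv_into ext_disk disk_to_half_plane ?z = disk_slit (slit_delta N lam) ?w"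
    using w1 by (simp add: disk_slit_def)
  then have eq: "slit_map_interior N lam z
    = the_inv_into (open_cyl N) (cyl_to_disk N) (disk_slit (slit_delta N lam) ?w)"
    using slit_root_interior[OF delta_bounds g] by (simp add: slit_map_interior_def)
  have inj: "inj_on (cyl_to_disk N) (open_cyl N)"
    by (rule inj_on_subset[OF cyl_to_disk_inj[OF N]]) (auto simp: closed_cyl_def)
  have im: "disk_slit (slit_delta N lam) ?w \<in> cyl_to_disk N ` open_cyl N"
    using norm_disk_slit_gt[OF delta_bounds w] by (simp add: cyl_to_disk_open_cyl[OF N] ext_disk_def)
  show "slit_map_interior N lam z \<in> open_cyl N"
    unfolding eq using the_inv_into_into[OF inj im] by auto
  show "cyl_to_disk N (slit_map_interior N lam z) = disk_slit (slit_delta N lam) ?w"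
    unfolding eq by (rule f_the_inv_into_f[OF inj im])
qed

lemma at_within_upper_half_plane:
  assumes "Im z = 0" shows "at z within {u. 0 < Im u} \<noteq> bot"
proof -
  have "z islimpt {u. 0 < Im u}"
    unfolding islimpt_approachable
  proof (intro allI impI)
    fix e :: real assume "0 < e"
    then show "\<exists>x'\<in>{u. 0 < Im u}. x' \<noteq> z \<and> dist x' z < e"
      using assms by (intro bexI[of _ "z + \<i> * of_real (e / 2)"]) (auto simp: dist_norm norm_mult)
  qed
  then show ?thesis by (simp add: trivial_limit_within)
qed

text \<open>On the boundary, continuity of \<open>disk_slit\<close> supplies a limit
  \<open>w\<close> along the open half-plane. The cylinder is Hausdorff and the approach filter is
  nontrivial, so \<open>The\<close> picks exactly this \<open>w\<close>.\<close>

lemma slit_map_conj: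
  assumes z: "0 \<le> Im z"
  shows "slit_map N lam z \<in> closed_cyl N" "cyl_to_disk N (slit_map N lam z)
    = disk_slit (slit_delta N lam) (cyl_to_disk N z)"
proof -
  have "slit_map N lam z \<in> closed_cyl N \<and> cyl_to_disk N (slit_map N lam z)
    = disk_slit (slit_delta N lam) (cyl_to_disk N z)"
  proof (cases "0 < Im z")
    case True
    then show ?thesis using slit_map_interior by (simp add: slit_map_def closed_cyl_def)
  next
    case False
    then have z0: "Im z = 0" using z by simp
    let ?F = "at z within {u. 0 < Im u}"
    have nE: "1 \<le> norm (cyl_to_disk N u) \<longleftrightarrow> 0 \<le> Im u" for u using norm_cyl_to_disk_ge[OF N] .
    have "disk_slit (slit_delta N lam) (cyl_to_disk N z) \<in> cyl_to_disk N ` closed_cyl N"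
      unfolding cyl_to_disk_closed_cyl[OF N] using norm_disk_slit[OF delta_bounds] nE z by simp
    then obtain w where w: "w \<in> closed_cyl N" "cyl_to_disk N w = disk_slit (slit_delta N lam) (cyl_to_disk N z)"
      by (metis imageE)
    have "continuous_on {u. 0 \<le> Im u} (\<lambda>u. disk_slit (slit_delta N lam) (cyl_to_disk N u))"
      by (rule continuous_on_compose2[OF continuous_on_disk_slit[OF delta_bounds] continuous_on_cyl_to_disk[OF N]]) (auto simp: nE)
    then have "((\<lambda>u. disk_slit (slit_delta N lam) (cyl_to_disk N u)) \<longlongrightarrow> cyl_to_disk N w) (at z within {u. 0 \<le> Im u})"
      using z w by (simp add: continuous_on)
    then have "((\<lambda>u. disk_slit (slit_delta N lam) (cyl_to_disk N u)) \<longlongrightarrow> cyl_to_disk N w) ?F"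
      by (rule tendsto_within_subset) auto
    moreover have "eventually (\<lambda>u. disk_slit (slit_delta N lam) (cyl_to_disk N u)
      = cyl_to_disk N (slit_map_interior N lam u)) ?F"
      using slit_map_interior(2) by (auto simp: eventually_at_filter)
    ultimately have lim: "((\<lambda>u. cyl_to_disk N (slit_map_interior N lam u)) \<longlongrightarrow> cyl_to_disk N w) ?F"
      by (rule Lim_transform_eventually)
    have "eventually (\<lambda>u. slit_map_interior N lam u \<in> closed_cyl N) ?F"
      using slit_map_interior(1) by (auto simp: eventually_at_filter closed_cyl_def)
    from limitin_cyl_topology[OF N w(1) this lim]
    have L: "limitin (cyl_topology N) (slit_map_interior N lam) w ?F" .
    have "slit_map N lam z = (THE w. limitin (cyl_topology N) (slit_map_interior N lam) w ?F)"
      using False by (simp add: slit_map_def)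
    also have "\<dots> = w"
      by (rule the_equality, rule L)
        (rule limitin_Hausdorff_unique[OF _ L at_within_upper_half_plane[OF z0] Hausdorff_cyl_topology[OF N]])
    finally show ?thesis using w by simp
  qed
  then show "slit_map N lam z \<in> closed_cyl N" "cyl_to_disk N (slit_map N lam z)
    = disk_slit (slit_delta N lam) (cyl_to_disk N z)" by auto
qed

lemma slit_map_at_conj:
  assumes z: "0 \<le> Im z"
  shows "slit_map_at N lam x z \<in> closed_cyl N" "cyl_to_disk N (slit_map_at N lam x z)
    = rot_slit N (slit_delta N lam) x (cyl_to_disk N z)"
proof -
  have "0 \<le> Im (z - of_real x)" using z by simp
  note S = slit_map_conj[OF this]
  have "0 \<le> Im (slit_map N lam (z - of_real x))" using S(1) by (rule closed_cyl_Im)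
  then show "slit_map_at N lam x z \<in> closed_cyl N"
    unfolding slit_map_at_def by (intro cyl_rep_in_closed_cyl[OF N]) simp
  show "cyl_to_disk N (slit_map_at N lam x z) = rot_slit N (slit_delta N lam) x (cyl_to_disk N z)"
    unfolding slit_map_at_def by (simp add: cyl_to_disk_rep[OF N] cyl_to_disk_add S(2) cyl_to_disk_diff rot_slit_def)
qed

lemma chl_map_conj:
  assumes z: "z \<in> closed_cyl N"
  shows "foldr (\<circ>) (map (slit_map_at N lam) xs) id z \<in> closed_cyl N \<and>
    cyl_to_disk N (foldr (\<circ>) (map (slit_map_at N lam) xs) id z) = disk_chl N (slit_delta N lam) xs (cyl_to_disk N z)"
proof (induction xs)
  case Nil then show ?case using z by (simp add: disk_chl_def)
next
  case (Cons x xs)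
  let ?y = "foldr (\<circ>) (map (slit_map_at N lam) xs) id z"
  have "0 \<le> Im ?y" using closed_cyl_Im[OF conjunct1[OF Cons.IH]] .
  note S = slit_map_at_conj[OF this, of x]
  have 1: "foldr (\<circ>) (map (slit_map_at N lam) (x # xs)) id z = slit_map_at N lam x ?y" by simp
  have 2: "disk_chl N (slit_delta N lam) (x # xs) w
    = rot_slit N (slit_delta N lam) x (disk_chl N (slit_delta N lam) xs w)" for w by (simp add: disk_chl_def)
  show ?case unfolding 1 2 using S conjunct2[OF Cons.IH] by (simp only: simp_thms)
qed

text \<open>The homeomorphism maps cluster minus boundary to cluster minus circle. It induces a
  bijection of components, so the two cardinalities agree.\<close>

lemma num_trees_eq: "num_trees N lam Q t = tree_count N (slit_delta N lam) (arrival_positions Q t)"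
proof -
  let ?C = "chl_map N lam Q t" and ?D = "disk_chl N (slit_delta N lam) (arrival_positions Q t)"
  let ?E = "cyl_to_disk N"
  let ?S = "?C ` cyl_boundary N - cyl_boundary N" and ?T = "?D ` {w. norm w = 1} - {w. norm w = 1}"
  have bd: "cyl_boundary N \<subseteq> closed_cyl N" by (auto simp: closed_cyl_def)
  have C: "?C z \<in> closed_cyl N" "?E (?C z) = ?D (?E z)" if "z \<in> closed_cyl N" for z
    using chl_map_conj[OF that] by (auto simp: chl_map_def)
  have "?E ` ?S = ?E ` (?C ` cyl_boundary N) - ?E ` cyl_boundary N"
    using C(1) bd by (intro inj_on_image_set_diff[OF cyl_to_disk_inj[OF N]]) auto
  also have "?E ` (?C ` cyl_boundary N) = ?D ` ?E ` cyl_boundary N"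
    unfolding image_image using C(2) bd by (intro image_cong) auto
  finally have im: "?E ` ?S = ?T" by (simp add: cyl_to_disk_boundary[OF N])
  have S: "?S \<subseteq> closed_cyl N" using C bd by auto
  then have T: "?T \<subseteq> {w. 1 \<le> norm w}" unfolding im[symmetric] cyl_to_disk_closed_cyl[OF N, symmetric] by blast
  have "homeomorphic_map (subtopology (cyl_topology N) ?S) (subtopology (top_of_set {w. 1 \<le> norm w}) ?T) ?E"
    using S T im by (intro homeomorphic_map_subtopologies[OF homeomorphic_map_cyl_to_disk[OF N]])
      (simp add: topspace_cyl_topology[OF N] inf.absorb2)
  from homeomorphic_map_connected_components_of[OF this]
  have "components ?T = (`) ?E ` chl_trees N lam Q t"
    unfolding chl_trees_def using T
      by (simp add: subtopology_subtopology inf.absorb2 connected_components_of_top_of_set)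
  moreover have "inj_on ((`) ?E) (chl_trees N lam Q t)"
  proof (rule inj_onI)
    fix A B assume AB: "A \<in> chl_trees N lam Q t" "B \<in> chl_trees N lam Q t" "?E ` A = ?E ` B"
    have "D \<subseteq> closed_cyl N" if "D \<in> chl_trees N lam Q t" for D
      using connected_components_of_subset[OF that[unfolded chl_trees_def]]
      unfolding topspace_subtopology topspace_cyl_topology[OF N] by blast
    with AB have "A \<subseteq> closed_cyl N" "B \<subseteq> closed_cyl N" by blast+
    then show "A = B" using AB(3) cyl_to_disk_inj[OF N] by (metis inj_on_image_eq_iff)
  qed
  ultimately show ?thesis by (simp add: num_trees_def tree_count_def card_image)
qed

end

section \<open>Growth of the cluster by one arc at a time\<close>

context
  fixes N a :: real
  assumes N: "0 < N" and a: "0 < a" "a < 1"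
begin

lemma norm_rot_slit: "1 \<le> norm w \<Longrightarrow> 1 \<le> norm (rot_slit N a x w)"
  and norm_rot_slit_gt: "1 < norm w \<Longrightarrow> 1 < norm (rot_slit N a x w)"
  using norm_disk_slit[OF a, of "w / cyl_to_disk N (of_real x)"] norm_disk_slit_gt[OF a, of
    "w / cyl_to_disk N (of_real x)"]
  by (simp_all add: rot_slit_def norm_mult norm_divide)

lemma rot_slit_inj: "inj_on (rot_slit N a x) {w. 1 < norm w}"
proof (rule inj_onI)
  fix v w assume vw: "v \<in> {w. 1 < norm w}" "w \<in> {w. 1 < norm w}" "rot_slit N a x v = rot_slit N a x w"
  let ?e = "cyl_to_disk N (of_real x)"
  have 1: "disk_slit a (v / ?e) = disk_slit a (w / ?e)" using vw(3) by (simp add: rot_slit_def)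
  have 2: "v / ?e \<in> {w. 1 < norm w}" "w / ?e \<in> {w. 1 < norm w}" using vw(1,2) by (simp_all add: norm_divide)
  from inj_onD[OF disk_slit_inj[OF a] 1 2] have "v / ?e = w / ?e" .
  then show "v = w" by simp
qed

lemma continuous_on_rot_slit: "continuous_on {w. 1 \<le> norm w} (rot_slit N a x)"
  unfolding rot_slit_def
  by (intro continuous_on_mult continuous_on_const continuous_on_compose2[OF continuous_on_disk_slit[OF a]])
     (auto intro!: continuous_intros simp: norm_divide)

definition rot_radial_slit :: "real \<Rightarrow> complex set" where
  "rot_radial_slit x = (*) (cyl_to_disk N (of_real x)) ` radial_slit a"

lemma rot_slit_circle: "rot_slit N a x ` {w. norm w = 1} = {w. norm w = 1} \<union> rot_radial_slit x"
proof -
  let ?e = "cyl_to_disk N (of_real x)"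
  have m: "(*) ?e ` {w. norm w = 1} = {w. norm w = 1}"
  proof (intro equalityI subsetI)
    fix w :: complex assume "w \<in> {w. norm w = 1}"
    then show "w \<in> (*) ?e ` {w. norm w = 1}" by (intro image_eqI[of _ _ "w / ?e"]) (auto simp: norm_divide)
  qed (auto simp: norm_mult)
  have "(\<lambda>w. w / ?e) ` {w. norm w = 1} = {w. norm w = 1}"
  proof (intro equalityI subsetI)
    fix w :: complex assume "w \<in> {w. norm w = 1}"
    then show "w \<in> (\<lambda>w. w / ?e) ` {w. norm w = 1}" by (intro image_eqI[of _ _ "w * ?e"]) (auto simp: norm_mult)
  qed (auto simp: norm_divide)
  moreover have "rot_slit N a x ` {w. norm w = 1} = (*) ?e ` disk_slit a ` (\<lambda>w. w / ?e) ` {w. norm w = 1}"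
    unfolding image_image by (simp add: rot_slit_def)
  ultimately have "rot_slit N a x ` {w. norm w = 1} = (*) ?e ` disk_slit a ` {w. norm w = 1}"
    by simp
  then show ?thesis unfolding disk_slit_circle[OF a] image_Un m rot_radial_slit_def .
qed

lemma norm_rot_radial_slit: "w \<in> rot_radial_slit x \<Longrightarrow> 1 < norm w"
  using norm_radial_slit[OF a] by (auto simp: rot_radial_slit_def norm_mult)

lemma rot_slit_notin_rot_radial_slit: "1 < norm w \<Longrightarrow> rot_slit N a x w \<notin> rot_radial_slit x"
  using disk_slit_notin_radial_slit[OF a, of "w / cyl_to_disk N (of_real x)"]
  by (auto simp: rot_slit_def rot_radial_slit_def norm_divide)

text \<open>The slit is a continuous image of (0, a]; adding the parameter 0 adds the foot and makes
  it a compact arc.\<close>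

lemma rot_radial_slit_connected: "connected (rot_radial_slit x)" "rot_radial_slit x \<noteq> {}"
  and rot_radial_slit_insert: "compact (insert (cyl_to_disk N (of_real x)) (rot_radial_slit x))"
    "connected (insert (cyl_to_disk N (of_real x)) (rot_radial_slit x))"
proof -
  let ?e = "cyl_to_disk N (of_real x)"
  let ?f = "\<lambda>y. ?e * of_real ((1 + y) / (1 - y))"
  have eq: "rot_radial_slit x = ?f ` {0<..a}" unfolding rot_radial_slit_def radial_slit_def image_image ..
  have "insert 0 {0<..a} = {0..a}" using a by auto
  then have eq2: "insert ?e (rot_radial_slit x) = ?f ` {0..a}" unfolding eq
    by (metis (no_types, lifting) add_0_right diff_zero div_by_1 image_insert mult.right_neutral of_real_1)
  have c: "continuous_on {0..a} ?f" using a by (intro continuous_intros) auto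
  show "connected (rot_radial_slit x)"
    unfolding eq by (intro connected_continuous_image continuous_on_subset[OF c]) (use a in auto)
  show "rot_radial_slit x \<noteq> {}" unfolding eq using a by simp
  show "compact (insert ?e (rot_radial_slit x))"
    unfolding eq2 by (rule compact_continuous_image[OF c compact_Icc])
  show "connected (insert ?e (rot_radial_slit x))"
    unfolding eq2 by (rule connected_continuous_image[OF c connected_Icc])
qed

text \<open>\<open>foldr\<close> puts the last entry innermost: the newest particle acts on a point
  before all older ones. Inductions therefore run from the right end of the list.\<close>

lemma disk_chl_snoc: "disk_chl N a (xs @ [y]) w = disk_chl N a xs (rot_slit N a y w)"
proof -
  have "foldr (\<circ>) fs h = foldr (\<circ>) fs id \<circ> h" for fs and h :: "complex \<Rightarrow> complex"
    by (induction fs) (auto simp: o_assoc)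
  from fun_cong[OF this[of _ "rot_slit N a y"]] show ?thesis by (simp add: disk_chl_def)
qed

lemma disk_chl_Nil: "disk_chl N a [] w = w" by (simp add: disk_chl_def)

lemma norm_disk_chl:
  "1 \<le> norm w \<Longrightarrow> 1 \<le> norm (disk_chl N a xs w)"
  "1 < norm w \<Longrightarrow> 1 < norm (disk_chl N a xs w)"
proof (induction xs arbitrary: w rule: rev_induct)
  case (snoc y xs)
  { case 1 then show ?case using snoc.IH(1) norm_rot_slit by (simp add: disk_chl_snoc) }
  { case 2 then show ?case using snoc.IH(2) norm_rot_slit_gt by (simp add: disk_chl_snoc) }
qed (simp_all add: disk_chl_Nil)

lemma continuous_on_disk_chl: "continuous_on {w. 1 \<le> norm w} (disk_chl N a xs)"
proof (induction xs rule: rev_induct)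
  case Nil then show ?case by (simp add: disk_chl_def id_def)
next
  case (snoc y xs)
  show ?case unfolding disk_chl_snoc
    by (rule continuous_on_compose2[OF snoc continuous_on_rot_slit]) (auto intro: norm_rot_slit)
qed

lemma disk_chl_inj: "inj_on (disk_chl N a xs) {w. 1 < norm w}"
proof (induction xs rule: rev_induct)
  case Nil then show ?case by (simp add: disk_chl_def)
next
  case (snoc y xs)
  show ?case
  proof (rule inj_onI)
    fix v w assume vw: "v \<in> {w. 1 < norm w}" "w \<in> {w. 1 < norm w}" "disk_chl N a (xs @ [y]) v
      = disk_chl N a (xs @ [y]) w"
    then have "rot_slit N a y v = rot_slit N a y w"
      using snoc norm_rot_slit_gt by (simp add: disk_chl_snoc inj_on_def)
    then show "v = w" using rot_slit_inj vw by (auto simp: inj_on_def)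
  qed
qed

text \<open>The circle image gains only the old image of the new slit. That slit avoids the image of
  the open exterior, and injectivity of the old map there preserves this. Consequently a new arc
  never crosses the existing cluster.\<close>

lemma disk_chl_disjoint:
  "disk_chl N a xs ` {w. norm w = 1} \<inter> disk_chl N a xs ` {w. 1 < norm w} = {}"
proof (induction xs rule: rev_induct)
  case Nil then show ?case by (auto simp: disk_chl_Nil)
next
  case (snoc y xs)
  let ?f = "disk_chl N a xs" and ?g = "rot_slit N a y" and ?C = "{w::complex. norm w = 1}" and ?O =
    "{w::complex. 1 < norm w}"
  have eq: "disk_chl N a (xs @ [y]) ` X = ?f ` ?g ` X" for X by (simp add: disk_chl_snoc image_image)
  have gO: "?g ` ?O \<subseteq> ?O" "?g ` ?O \<inter> rot_radial_slit y = {}"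
    using norm_rot_slit_gt rot_slit_notin_rot_radial_slit by auto
  have "?f ` ?C \<inter> ?f ` ?g ` ?O = {}" using snoc gO(1) by blast
  moreover have "?f ` rot_radial_slit y \<inter> ?f ` ?g ` ?O = {}"
    using gO norm_rot_radial_slit
    by (subst inj_on_image_Int[OF disk_chl_inj, symmetric]) (auto dest: norm_rot_radial_slit)
  ultimately show ?case unfolding eq rot_slit_circle image_Un by blast
qed

text \<open>The old image of the circle is compact and misses the new arc \<open>A\<close>, so
  \<open>K\<close> is closed in \<open>K Un A\<close>. The arc together with its foot is compact;
  the position of the foot decides which of the two component lemmas applies. Finiteness is carried
  along because attaching an arc uses it.\<close>

lemma tree_count_step:
  "finite (components (disk_chl N a xs ` {w. norm w = 1} - {w. norm w = 1})) \<Longrightarrow>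
   finite (components (disk_chl N a (xs @ [y]) ` {w. norm w = 1} - {w. norm w = 1})) \<and>
   tree_count N a (xs @ [y]) = tree_count N a xs + (if exposed N a xs y then 1 else 0)"
proof -
  let ?f = "disk_chl N a xs" and ?C = "{w::complex. norm w = 1}" and ?O = "{w::complex. 1 < norm w}" and ?e =
    "cyl_to_disk N (of_real y)"
  define K where "K = ?f ` ?C - ?C"
  define A where "A = ?f ` rot_radial_slit y"
  assume fin: "finite (components (?f ` ?C - ?C))"
  have A_O: "A \<subseteq> ?O" unfolding A_def using norm_rot_radial_slit norm_disk_chl(2) by auto
  have "A \<subseteq> ?f ` ?O" unfolding A_def using norm_rot_radial_slit by auto
  then have AC: "A \<inter> ?f ` ?C = {}" using disk_chl_disjoint[of xs] by blast
  have new: "disk_chl N a (xs @ [y]) ` ?C - ?C = K \<union> A"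
  proof -
    have "disk_chl N a (xs @ [y]) ` ?C = ?f ` rot_slit N a y ` ?C" by (simp add: disk_chl_snoc image_image)
    also have "\<dots> = ?f ` ?C \<union> A" unfolding rot_slit_circle image_Un A_def ..
    finally show ?thesis using A_O unfolding K_def by auto
  qed
  have KA: "K \<inter> A = {}" using AC unfolding K_def by blast
  have "compact (?f ` ?C)"
    by (rule compact_continuous_image[OF continuous_on_subset[OF continuous_on_disk_chl]])
       (auto simp: compact_eq_bounded_closed bounded_iff intro!: closed_Collect_eq continuous_intros exI[of _ 1])
  then have clC: "closed (?f ` ?C)" by (rule compact_imp_closed)
  have K: "closedin (top_of_set (K \<union> A)) K"
  proof -
    have "K = (K \<union> A) \<inter> ?f ` ?C" using AC unfolding K_def by auto
    then show ?thesis using clC closedin_closed by blast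
  qed
  let ?I = "insert ?e (rot_radial_slit y)"
  have cI: "continuous_on ?I ?f"
    by (rule continuous_on_subset[OF continuous_on_disk_chl]) (auto dest: norm_rot_radial_slit)
  have "compact (?f ` ?I)" by (rule compact_continuous_image[OF cI rot_radial_slit_insert(1)])
  then have clI: "closed (insert (?f ?e) A)" unfolding A_def by (simp add: compact_imp_closed)
  have conI: "connected (insert (?f ?e) A)"
    using connected_continuous_image[OF cI rot_radial_slit_insert(2)] unfolding A_def by simp
  have conA: "connected A" "A \<noteq> {}" unfolding A_def
    using rot_radial_slit_connected by (auto intro!: connected_continuous_image continuous_on_subset[OF cI])
  show ?thesis
  proof (cases "exposed N a xs y")
    case True
    then have "?f ?e \<in> ?C" by (simp add: exposed_def)
    \<comment> \<open>The foot has norm 1, so it lies outside \<open>K Un A\<close>; cutting the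
      closed arc with \<open>K Un A\<close> leaves \<open>A\<close> alone.\<close>
    then have "A = (K \<union> A) \<inter> insert (?f ?e) A" unfolding K_def by auto
    then have "closedin (top_of_set (K \<union> A)) A" using clI closedin_closed by blast
    from components_insert_separated[OF K this KA conA] fin True show ?thesis
      unfolding new tree_count_def K_def[symmetric] by simp
  next
    case False
    then have pK: "?f ?e \<in> K" by (simp add: exposed_def K_def)
    then have "insert (?f ?e) A = (K \<union> A) \<inter> insert (?f ?e) A" by auto
    then have "closedin (top_of_set (K \<union> A)) (insert (?f ?e) A)" using clI closedin_closed by blast
    from components_attach_connected[OF K this KA pK conI] fin False show ?thesis
      unfolding new tree_count_def K_def[symmetric] by simp
  qed
qed

lemma finite_tree_components: "finite (components (disk_chl N a xs ` {w. norm w = 1} - {w. norm w = 1}))"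
proof (induction xs rule: rev_induct)
  case Nil then show ?case by (simp add: disk_chl_def)
next
  case (snoc y xs) then show ?case using tree_count_step by blast
qed

lemma tree_count_snoc: "tree_count N a (xs @ [y]) = tree_count N a xs + (if exposed N a xs y then 1 else 0)"
  using tree_count_step finite_tree_components by blast

lemma tree_count_Nil: "tree_count N a [] = 0"
  by (simp add: tree_count_def disk_chl_def)

lemma tree_count_append: "tree_count N a xs \<le> tree_count N a (xs @ ys)"
  by (induction ys rule: rev_induct) (auto simp: tree_count_snoc simp flip: append_assoc)

lemma tree_count_le_length: "tree_count N a xs \<le> length xs"
  by (induction xs rule: rev_induct) (auto simp: tree_count_snoc tree_count_Nil)

end

section \<open>Exposed boundary points\<close>

definition on_rim :: "real \<Rightarrow> real \<Rightarrow> real \<Rightarrow> bool" where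
  "on_rim N a v \<longleftrightarrow> norm (disk_slit a (cyl_to_disk N (of_real v))) = 1"

text \<open>A real coordinate of the image point; the factor -N inverts the exponent in exp(-iv/N).
  It lifts the boundary motion whenever \<open>on_rim\<close> holds and is a mere default value
  otherwise.\<close>

definition rim_shift :: "real \<Rightarrow> real \<Rightarrow> real \<Rightarrow> real" where
  "rim_shift N a v = - N * Arg (disk_slit a (cyl_to_disk N (of_real v)))"

text \<open>\<open>Arg\<close> is continuous off the nonpositive axis, equals pi on the negative
  axis and 0 at the origin.\<close>

lemma borel_measurable_Arg [measurable]: "Arg \<in> borel_measurable borel"
proof -
  have eq: "Arg = (\<lambda>z. indicator (- \<real>\<^sub>\<le>\<^sub>0) z *\<^sub>R Arg z + pi * indicator (\<real>\<^sub>\<le>\<^sub>0 - {0}) z)"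
  proof
    fix z show "Arg z = indicator (- \<real>\<^sub>\<le>\<^sub>0) z *\<^sub>R Arg z + pi * indicator (\<real>\<^sub>\<le>\<^sub>0 - {0}) z"
    proof (cases "z \<in> \<real>\<^sub>\<le>\<^sub>0 - {0}")
      case True
      then have "Arg z = pi" by (auto simp: Arg_eq_pi complex_nonpos_Reals_iff complex_eq_iff)
      then show ?thesis using True by simp
    next
      case False
      then show ?thesis by (cases "z = 0") (auto simp: Arg_zero)
    qed
  qed
  have "(\<lambda>z. indicator (- \<real>\<^sub>\<le>\<^sub>0) z *\<^sub>R Arg z) \<in> borel_measurable borel"
    by (intro borel_measurable_continuous_on_indicator continuous_at_imp_continuous_on)
       (auto intro: continuous_at_Arg)
  moreover have "\<real>\<^sub>\<le>\<^sub>0 - {0::complex} \<in> sets borel" by (intro sets.Diff borel_closed closed_nonpos_Reals_complex) auto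
  ultimately have "(\<lambda>z. indicator (- \<real>\<^sub>\<le>\<^sub>0) z *\<^sub>R Arg z + pi * indicator (\<real>\<^sub>\<le>\<^sub>0 - {0}) z) \<in> borel_measurable borel"
    by (intro borel_measurable_add borel_measurable_times borel_measurable_const borel_measurable_indicator)
  then show ?thesis by (simp only: eq[symmetric])
qed

lemma cyl_to_disk_periodic: "0 < N \<Longrightarrow> cyl_to_disk N (of_real (x + 2 * pi * N * of_int k)) = cyl_to_disk N (of_real x)"
  by (subst cyl_to_disk_eq_iff) (auto intro!: exI[of _ k])

text \<open>Reduce the shift modulo \<open>c\<close> to r in [0, c), then move the overshoot [c, c +
  r) back to [0, r) by one period.\<close>

lemma nn_integral_periodic_shift:
  fixes f :: "real \<Rightarrow> ennreal"
  assumes c: "0 < c" and f [measurable]: "f \<in> borel_measurable borel" and per: "\<And>x k. f (x + c * of_int k) = f x"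
  shows "(\<integral>\<^sup>+x. f (x + t) * indicator {0..<c} x \<partial>lborel) = (\<integral>\<^sup>+x. f x * indicator {0..<c} x \<partial>lborel)"
proof -
  define r where "r = t - c * of_int \<lfloor>t / c\<rfloor>"
  have r: "0 \<le> r" "r < c"
    using floor_divide_lower[OF c, of t] floor_divide_upper[OF c, of t] by (simp_all add: r_def algebra_simps)
  have ft: "f (x + t) = f (x + r)" for x
    using per[of "x + r" "\<lfloor>t / c\<rfloor>"] by (simp add: r_def algebra_simps)
  have tr: "(\<integral>\<^sup>+x. g x \<partial>lborel) = (\<integral>\<^sup>+x. g (x + s) \<partial>lborel)" if [measurable]: "g \<in> borel_measurable borel"
    for g :: "real \<Rightarrow> ennreal" and s
    using nn_integral_real_affine[of g 1 s] that by (simp add: add.commute)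
  have "(\<integral>\<^sup>+x. f (x + t) * indicator {0..<c} x \<partial>lborel) = (\<integral>\<^sup>+x. f (x + r) * indicator {r..<c + r} (x + r) \<partial>lborel)"
    unfolding ft by (intro nn_integral_cong) (simp split: split_indicator)
  also have "\<dots> = (\<integral>\<^sup>+x. f x * indicator {r..<c + r} x \<partial>lborel)"
    by (subst tr[of "\<lambda>x. f x * indicator {r..<c + r} x" r]) simp_all
  also have "\<dots> = (\<integral>\<^sup>+x. f x * indicator {r..<c} x + f x * indicator {c..<c + r} x \<partial>lborel)"
    using r by (intro nn_integral_cong) (auto split: split_indicator)
  also have "\<dots> = (\<integral>\<^sup>+x. f x * indicator {r..<c} x \<partial>lborel) + (\<integral>\<^sup>+x. f x * indicator {c..<c + r} x \<partial>lborel)"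
    by (intro nn_integral_add) simp_all
  also have "(\<integral>\<^sup>+x. f x * indicator {c..<c + r} x \<partial>lborel) = (\<integral>\<^sup>+x. f (x + c) * indicator {c..<c + r} (x + c)
    \<partial>lborel)"
    by (subst tr[of "\<lambda>x. f x * indicator {c..<c + r} x" c]) simp_all
  also have "\<dots> = (\<integral>\<^sup>+x. f x * indicator {0..<r} x \<partial>lborel)"
    using per[of _ 1] by (intro nn_integral_cong) (simp split: split_indicator)
  also have "(\<integral>\<^sup>+x. f x * indicator {r..<c} x \<partial>lborel) + \<dots> = (\<integral>\<^sup>+x. f x * indicator {r..<c} x + f x
    * indicator {0..<r} x \<partial>lborel)"
    by (intro nn_integral_add[symmetric]) simp_all
  also have "\<dots> = (\<integral>\<^sup>+x. f x * indicator {0..<c} x \<partial>lborel)"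
    using r by (intro nn_integral_cong) (auto split: split_indicator)
  finally show ?thesis .
qed

text \<open>A negative entry encodes that no particle arrives in this step.\<close>

definition landed :: "nat \<Rightarrow> (nat \<Rightarrow> real) \<Rightarrow> real list" where
  "landed m z = filter (\<lambda>x. 0 \<le> x) (map z [0..<m])"

lemma landed_Suc: "landed (Suc m) z = (if 0 \<le> z m then landed m z @ [z m] else landed m z)"
  by (simp add: landed_def)

lemma landed_cong: "(\<And>i. i < m \<Longrightarrow> z i = z' i) \<Longrightarrow> landed m z = landed m z'"
  unfolding landed_def by (intro arg_cong[where f = "filter _"] map_cong) auto

section \<open>The arc destroyed by a slit and its average over the centre\<close>

context
  fixes N a :: real
  assumes N: "0 < N" and a: "0 < a" "a < 1"
begin

lemma exposed_periodic: "exposed N a xs (x + 2 * pi * N * of_int k) \<longleftrightarrow> exposed N a xs x"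
  unfolding exposed_def cyl_to_disk_periodic[OF N] ..

lemma on_rim_periodic: "on_rim N a (x + 2 * pi * N * of_int k) \<longleftrightarrow> on_rim N a x"
  and rim_shift_periodic: "rim_shift N a (x + 2 * pi * N * of_int k) = rim_shift N a x"
  unfolding on_rim_def rim_shift_def cyl_to_disk_periodic[OF N] by simp_all

lemma exposed_Nil: "exposed N a [] x"
  by (simp add: exposed_def disk_chl_def)

text \<open>The newest slit acts first. A point thrown off the circle has norm above 1 and never
  returns; a point that stays is moved along the circle and then faces the older slits. Both effects
  depend on \<open>x - y\<close> alone.\<close>

lemma exposed_snoc: "exposed N a (xs @ [y]) x \<longleftrightarrow> on_rim N a (x - y) \<and> exposed N a xs (y + rim_shift N a (x - y))"
proof -
  let ?E = "\<lambda>x::real. cyl_to_disk N (of_real x)"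
  let ?u = "disk_slit a (?E (x - y))"
  have r: "rot_slit N a y (?E x) = ?E y * ?u"
    by (simp add: rot_slit_def cyl_to_disk_diff)
  show ?thesis
  proof (cases "norm ?u = 1")
    case True
    have "?E (rim_shift N a (x - y)) = exp (\<i> * of_real (Arg ?u))"
      using N by (simp add: cyl_to_disk_def rim_shift_def)
    also have "\<dots> = ?u" using True Arg_eq[of ?u] by force
    finally have "rot_slit N a y (?E x) = ?E (y + rim_shift N a (x - y))"
      unfolding r by (simp add: cyl_to_disk_add)
    then show ?thesis using True by (simp add: exposed_def disk_chl_snoc[OF N a] on_rim_def)
  next
    case False
    have "1 \<le> norm ?u" by (rule norm_disk_slit[OF a]) (simp only: norm_cyl_to_disk_real order_refl)
    with False have "1 < norm ?u" by simp
    then have "1 < norm (rot_slit N a y (?E x))" unfolding r by (simp add: norm_mult)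
    from norm_disk_chl(2)[OF N a this, of xs] show ?thesis
      using False by (simp add: exposed_def disk_chl_snoc[OF N a] on_rim_def)
  qed
qed

lemma measurable_disk_slit_circle [measurable]:
  "(\<lambda>v::real. disk_slit a (cyl_to_disk N (of_real v))) \<in> borel_measurable borel"
  by (intro borel_measurable_continuous_onI continuous_on_compose2[OF continuous_on_disk_slit[OF a]]
      continuous_on_compose2[OF continuous_on_cyl_to_disk[OF N]] continuous_intros) auto

lemma measurable_on_rim [measurable]: "Measurable.pred borel (on_rim N a)"
  unfolding on_rim_def by measurable

lemma measurable_rim_shift [measurable]: "rim_shift N a \<in> borel_measurable borel"
  unfolding rim_shift_def by measurable

lemma measurable_exposed_const [measurable]: "Measurable.pred borel (exposed N a xs)"
proof (induction xs rule: rev_induct)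
  case Nil then show ?case by (simp add: exposed_Nil)
next
  case (snoc y xs)
  note [measurable] = snoc
  show ?case unfolding exposed_snoc by measurable
qed

lemma on_rim_iff: "on_rim N a v \<longleftrightarrow> (cos (v / (2 * N)))\<^sup>2 \<le> 1 - a\<^sup>2"
proof -
  have "cyl_to_disk N (of_real v) = cis (- v / N)"
    by (simp add: cyl_to_disk_def cis_conv_exp)
  then have "(1 + Re (cyl_to_disk N (of_real v))) / 2 = (cos (v / (2 * N)))\<^sup>2"
    using cos_double_cos[of "v / (2 * N)"] by (simp add: field_simps)
  then show ?thesis unfolding on_rim_def using norm_disk_slit_eq_1[OF a, of "cyl_to_disk N (of_real v)"]
    by (simp only: norm_cyl_to_disk_real simp_thms)
qed

text \<open>The v with tan(v/(2N)) = a / sqrt(1 - a^2), where the destroyed arc around 0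
  ends.\<close>

definition half_width :: real where
  "half_width = 2 * N * arctan (a / sqrt (1 - a\<^sup>2))"

lemma half_width: "0 < half_width" "half_width < pi * N"
proof -
  have "0 < a / sqrt (1 - a\<^sup>2)" using a square_bounds[OF a] by simp
  then have "0 < arctan (a / sqrt (1 - a\<^sup>2))" by simp
  then show "0 < half_width" using N by (simp add: half_width_def)
  have "2 * N * arctan (a / sqrt (1 - a\<^sup>2)) < 2 * N * (pi / 2)"
    using N arctan_ubound by (intro mult_strict_left_mono) auto
  then show "half_width < pi * N" by (simp add: half_width_def mult.commute)
qed

text \<open>With t = a / sqrt(1 - a^2), the threshold sqrt(1 - a^2) is cos(arctan t). The half angle
  v/(2N) stays in [0, pi], where cosine decreases, so the bound on |cos| becomes an
  interval.\<close>

lemma on_rim_interval: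
  assumes "0 \<le> v" "v < 2 * pi * N"
  shows "on_rim N a v \<longleftrightarrow> half_width \<le> v \<and> v \<le> 2 * pi * N - half_width"
proof -
  define t where "t = a / sqrt (1 - a\<^sup>2)"
  define s where "s = v / (2 * N)"
  have "1 + t\<^sup>2 = 1 / (1 - a\<^sup>2)" using square_bounds[OF a] by (simp add: t_def power_divide field_simps)
  then have cos_t: "cos (arctan t) = sqrt (1 - a\<^sup>2)" by (simp add: cos_arctan real_sqrt_divide)
  have s: "0 \<le> s" "s \<le> pi" using assms N by (simp_all add: s_def field_simps)
  have at: "0 \<le> arctan t" "arctan t \<le> pi"
    using a square_bounds[OF a] arctan_ubound[of t] pi_gt_zero by (simp add: t_def, linarith)
  have "on_rim N a v \<longleftrightarrow> \<bar>cos s\<bar> \<le> sqrt (1 - a\<^sup>2)"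
    unfolding on_rim_iff s_def[symmetric] using square_bounds[OF a] by (metis real_sqrt_abs real_sqrt_le_iff)
  also have "\<dots> \<longleftrightarrow> cos s \<le> cos (arctan t) \<and> cos (pi - arctan t) \<le> cos s"
    unfolding cos_t[symmetric] by (auto simp: abs_le_iff)
  also have "\<dots> \<longleftrightarrow> arctan t \<le> s \<and> s \<le> pi - arctan t"
    using s at cos_mono_le_eq[of s "arctan t"] cos_mono_le_eq[of "pi - arctan t" s] by (simp only: diff_ge_0_iff_ge)
  also have "\<dots> \<longleftrightarrow> half_width \<le> v \<and> v \<le> 2 * pi * N - half_width"
    using N by (auto simp: half_width_def s_def t_def[symmetric] field_simps)
  finally show ?thesis .
qed

lemma measure_on_rim:
  "(\<integral>\<^sup>+v. indicator {v. on_rim N a v} v * indicator {0..<2 * pi * N} v \<partial>lborel) = ennreal (2 * pi * N - 2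
    * half_width)"
proof -
  have "(\<integral>\<^sup>+v. indicator {v. on_rim N a v} v * indicator {0..<2 * pi * N} v \<partial>lborel) =
    (\<integral>\<^sup>+v. indicator {half_width .. 2 * pi * N - half_width} v \<partial>lborel)"
    using half_width on_rim_interval by (intro nn_integral_cong) (auto split: split_indicator)
  then show ?thesis using half_width by simp
qed

text \<open>
  With \<open>v = x - y\<close> in place of \<open>x\<close>, the point \<open>y + rim_shift N a v\<close> is uniform in \<open>y\<close> for each
  fixed \<open>v\<close>, so no property of \<open>rim_shift\<close> is needed.
\<close>

lemma exposed_snoc_average:
  "(\<integral>\<^sup>+y. (\<integral>\<^sup>+x. indicator {x. exposed N a (xs @ [y]) x} x * indicator {0..<2 * pi * N} x \<partial>lborel)
    * indicator {0..<2 * pi * N} y \<partial>lborel)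
   = ennreal (2 * pi * N - 2 * half_width) * (\<integral>\<^sup>+x. indicator {x. exposed N a xs x} x * indicator {0..<2 * pi
     * N} x \<partial>lborel)"
  (is "?L = ?R")
proof -
  let ?c = "2 * pi * N"
  have c: "0 < ?c" using N by simp
  define R where "R v = (indicator {v. on_rim N a v} v :: ennreal)" for v
  define A where "A x = (indicator {x. exposed N a xs x} x :: ennreal)" for x
  have [measurable]: "R \<in> borel_measurable borel" "A \<in> borel_measurable borel"
    unfolding R_def A_def by measurable
  have inner: "(\<integral>\<^sup>+x. indicator {x. exposed N a (xs @ [y]) x} x * indicator {0..<?c} x \<partial>lborel)
      = (\<integral>\<^sup>+v. R v * A (y + rim_shift N a v) * indicator {0..<?c} v \<partial>lborel)" for y
  proof -
    have "(\<integral>\<^sup>+x. indicator {x. exposed N a (xs @ [y]) x} x * indicator {0..<?c} x \<partial>lborel)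
      = (\<integral>\<^sup>+x. (\<lambda>v. R v * A (y + rim_shift N a v)) (x + - y) * indicator {0..<?c} x \<partial>lborel)"
      by (intro nn_integral_cong) (auto simp: R_def A_def exposed_snoc split: split_indicator)
    also have "\<dots> = (\<integral>\<^sup>+v. R v * A (y + rim_shift N a v) * indicator {0..<?c} v \<partial>lborel)"
      by (rule nn_integral_periodic_shift[OF c]) (simp_all add: R_def on_rim_periodic rim_shift_periodic indicator_def)
    finally show ?thesis .
  qed
  have "?L = (\<integral>\<^sup>+y. (\<integral>\<^sup>+v. R v * A (y + rim_shift N a v) * indicator {0..<?c} v * indicator {0..<?c} y \<partial>lborel)
    \<partial>lborel)"
    unfolding inner by (intro nn_integral_cong nn_integral_multc[symmetric]) measurable
  also have "\<dots> = (\<integral>\<^sup>+v. (\<integral>\<^sup>+y. R v * A (y + rim_shift N a v) * indicator {0..<?c} v * indicator {0..<?c} y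
    \<partial>lborel) \<partial>lborel)"
    by (rule lborel_pair.Fubini') measurable
  also have "\<dots> = (\<integral>\<^sup>+v. R v * indicator {0..<?c} v * (\<integral>\<^sup>+y. A (y + rim_shift N a v) * indicator {0..<?c} y
    \<partial>lborel) \<partial>lborel)"
    by (intro nn_integral_cong, subst nn_integral_cmult[symmetric]) (measurable, auto intro!: nn_integral_cong simp: mult_ac)
  also have "\<dots> = (\<integral>\<^sup>+v. R v * indicator {0..<?c} v * (\<integral>\<^sup>+y. A y * indicator {0..<?c} y \<partial>lborel) \<partial>lborel)"
    by (subst nn_integral_periodic_shift[OF c]) (simp_all add: A_def exposed_periodic indicator_def)
  also have "\<dots> = (\<integral>\<^sup>+v. R v * indicator {0..<?c} v \<partial>lborel) * (\<integral>\<^sup>+y. A y * indicator {0..<?c} y \<partial>lborel)"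
    by (rule nn_integral_multc) measurable
  also have "\<dots> = ?R" unfolding R_def A_def measure_on_rim ..
  finally show ?thesis .
qed

text \<open>The observed point \<open>f\<close> is general because removing the last particle
  replaces it by the moved point, which depends on that particle's position.\<close>

lemma measurable_exposed_landed:
  assumes Z: "\<And>i. i < m \<Longrightarrow> (\<lambda>w. Z w i) \<in> borel_measurable X" and [measurable]: "f \<in> borel_measurable X"
  shows "Measurable.pred X (\<lambda>w. exposed N a (landed m (Z w)) (f w))"
  using assms
proof (induction m arbitrary: f)
  case 0 then show ?case by (simp add: landed_def exposed_Nil)
next
  case (Suc m)
  note [measurable] = Suc.prems(2)
  have [measurable]: "(\<lambda>w. Z w m) \<in> borel_measurable X" using Suc.prems by auto
  have [measurable]: "Measurable.pred X (\<lambda>w. exposed N a (landed m (Z w)) (f w))"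
    using Suc by auto
  have [measurable]: "Measurable.pred X (\<lambda>w. exposed N a (landed m (Z w)) (Z w m + rim_shift N a (f w - Z w m)))"
    by (intro Suc.IH) (auto intro: Suc.prems)
  have "exposed N a (landed (Suc m) (Z w)) (f w) \<longleftrightarrow>
    (if 0 \<le> Z w m then on_rim N a (f w - Z w m) \<and> exposed N a (landed m (Z w)) (Z w m + rim_shift N a (f w - Z w m))
     else exposed N a (landed m (Z w)) (f w))" for w
    by (simp add: landed_Suc exposed_snoc)
  then show ?case by simp
qed

lemma measurable_tree_count_landed:
  assumes Z: "\<And>i. i < m \<Longrightarrow> (\<lambda>w. Z w i) \<in> borel_measurable X"
  shows "(\<lambda>w. tree_count N a (landed m (Z w))) \<in> measurable X (count_space UNIV)"
  using assms
proof (induction m)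
  case 0 then show ?case by (simp add: landed_def)
next
  case (Suc m)
  have [measurable]: "(\<lambda>w. Z w m) \<in> borel_measurable X" using Suc.prems by auto
  have [measurable]: "(\<lambda>w. tree_count N a (landed m (Z w))) \<in> measurable X (count_space UNIV)"
    using Suc by auto
  have [measurable]: "Measurable.pred X (\<lambda>w. exposed N a (landed m (Z w)) (Z w m))"
    using Suc.prems by (intro measurable_exposed_landed) auto
  have "tree_count N a (landed (Suc m) (Z w)) =
    tree_count N a (landed m (Z w)) + (if 0 \<le> Z w m \<and> exposed N a (landed m (Z w)) (Z w m) then 1 else 0)" for w
    by (simp add: landed_Suc tree_count_snoc[OF N a])
  then show ?case by simp
qed

end

section \<open>Independent particles\<close>

definition exposed_length :: "real \<Rightarrow> real \<Rightarrow> real list \<Rightarrow> ennreal" where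
  "exposed_length N a xs = (\<integral>\<^sup>+x. indicator {x. exposed N a xs x} x * indicator {0..<2 * pi * N} x \<partial>lborel)"

section \<open>Steps that bring a particle or nothing\<close>

context
  fixes N a q :: real and \<nu> :: "real measure"
  assumes N: "0 < N" and a: "0 < a" "a < 1" and q: "0 \<le> q"
    and nu: "prob_space \<nu>" "sets \<nu> = sets borel"
    and law: "\<And>f :: real \<Rightarrow> ennreal. f \<in> borel_measurable borel \<Longrightarrow>
      (\<integral>\<^sup>+x. f x * indicator {0..} x \<partial>\<nu>) = ennreal q * (\<integral>\<^sup>+x. f x * indicator {0..<2 * pi * N} x \<partial>lborel)"
begin

interpretation nu: prob_space \<nu> by (rule nu(1))
interpretation P: product_sigma_finite "\<lambda>_::nat. \<nu>" ..

lemmas sets_nu [measurable_cong] = nu(2)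

lemma measurable_component_nu: "i < m \<Longrightarrow> (\<lambda>z. z i) \<in> borel_measurable (Pi\<^sub>M {..<m} (\<lambda>_. \<nu>))"
  using measurable_component_singleton[of i "{..<m}" "\<lambda>_. \<nu>"] measurable_cong_sets[OF refl nu(2)] by blast

lemma measurable_exposed_length:
  assumes Z: "\<And>i. i < m \<Longrightarrow> (\<lambda>w. Z w i) \<in> borel_measurable X"
  shows "(\<lambda>w. exposed_length N a (landed m (Z w))) \<in> borel_measurable X"
proof -
  have [measurable]: "Measurable.pred (X \<Otimes>\<^sub>M lborel) (\<lambda>p. exposed N a (landed m (Z (fst p))) (snd p))"
    by (intro measurable_exposed_landed[OF N a]) (auto intro: measurable_compose[OF measurable_fst] Z)
  have "(\<lambda>w. \<integral>\<^sup>+x. (if exposed N a (landed m (Z w)) x then 1 else 0) * indicator {0..<2 * pi * N} x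
    \<partial>lborel) \<in> borel_measurable X"
    by (intro lborel.borel_measurable_nn_integral) (simp add: split_beta')
  then show ?thesis unfolding exposed_length_def by (simp add: indicator_def)
qed

lemma measurable_exposed_length_snoc: "(\<lambda>y. exposed_length N a (xs @ [y])) \<in> borel_measurable borel"
proof -
  note [measurable] = measurable_on_rim[OF N a] measurable_rim_shift[OF N a] measurable_exposed_const[OF N a]
  have "(\<lambda>y. \<integral>\<^sup>+x. (if on_rim N a (x - y) \<and> exposed N a xs (y + rim_shift N a (x - y)) then 1 else 0)
      * indicator {0..<2 * pi * N} x \<partial>lborel) \<in> borel_measurable borel"
    by measurable
  then show ?thesis unfolding exposed_length_def exposed_snoc[OF N a, symmetric]
    by (simp add: indicator_def of_bool_def)
qed

text \<open>q times 2 pi N is the mass of the nonnegative axis under the law, the probability that a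
  step brings a particle.\<close>

lemma q_le: "q * (2 * pi * N) \<le> 1"
proof -
  have "ennreal q * ennreal (2 * pi * N) = (\<integral>\<^sup>+x. indicator {0..} x \<partial>\<nu>)"
    using law[of "\<lambda>_. 1"] N by simp
  also have "\<dots> \<le> 1" using nu.emeasure_le_1 nu(2) by simp
  finally show ?thesis using q N by (simp add: ennreal_mult'' [symmetric] flip: ennreal_1)
qed

lemma exposed_length_average:
  "(\<integral>\<^sup>+y. exposed_length N a (xs @ [y]) * indicator {0..<2 * pi * N} y \<partial>lborel) =
    ennreal (2 * pi * N - 2 * half_width N a) * exposed_length N a xs"
  unfolding exposed_length_def by (rule exposed_snoc_average[OF N a])

text \<open>Allows the shrinking factor and its powers to be multiplied inside
  \<open>ennreal\<close>, which truncates negative numbers.\<close>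

lemma survival_nonneg: "0 \<le> 1 - 2 * half_width N a * q"
proof -
  have "2 * half_width N a * q \<le> 2 * pi * N * q"
    using half_width[OF N a] q by (intro mult_right_mono) auto
  also have "\<dots> \<le> 1" using q_le by (simp only: mult.commute)
  finally show ?thesis by simp
qed

text \<open>Splits a step into a particle, with density \<open>q\<close> on the positions, and no
  particle, with the remaining mass.\<close>

lemma nn_integral_nu_if:
  assumes [measurable]: "f \<in> borel_measurable borel"
  shows "(\<integral>\<^sup>+y. (if 0 \<le> y then f y else k) \<partial>\<nu>) = ennreal q * (\<integral>\<^sup>+y. f y * indicator {0..<2 * pi * N} y \<partial>lborel)
    + k * ennreal (1 - q * (2 * pi * N))"
proof -
  have 0: "emeasure \<nu> {0..} = ennreal (q * (2 * pi * N))"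
    using law[of "\<lambda>_. 1"] N q nu(2) by (simp add: ennreal_mult)
  have "space \<nu> = UNIV" using nu(2) sets_eq_imp_space_eq by force
  then have "emeasure \<nu> {..<0} = emeasure \<nu> (space \<nu> - {0..})" by (auto intro!: arg_cong[where f = "emeasure \<nu>"])
  also have "\<dots> = 1 - ennreal (q * (2 * pi * N))"
    using nu(2) by (subst emeasure_compl) (auto simp: 0 nu.emeasure_space_1)
  also have "\<dots> = ennreal (1 - q * (2 * pi * N))"
    using q N by (metis ennreal_1 ennreal_minus mult_nonneg_nonneg less_imp_le pi_gt_zero zero_le_numeral)
  finally have 1: "emeasure \<nu> {..<0} = ennreal (1 - q * (2 * pi * N))" .
  have "(\<integral>\<^sup>+y. (if 0 \<le> y then f y else k) \<partial>\<nu>) = (\<integral>\<^sup>+y. f y * indicator {0..} y + k * indicator {..<0} y \<partial>\<nu>)"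
    by (intro nn_integral_cong) (auto split: split_indicator)
  also have "\<dots> = (\<integral>\<^sup>+y. f y * indicator {0..} y \<partial>\<nu>) + (\<integral>\<^sup>+y. k * indicator {..<0} y \<partial>\<nu>)"
    by (intro nn_integral_add) measurable
  finally show ?thesis using 1 nu(2) by (simp add: law nn_integral_cmult_indicator)
qed

lemma landed_upd: "landed (Suc m) (z(m := y)) = (if 0 \<le> y then landed m z @ [y] else landed m z)"
proof -
  have "landed m (z(m := y)) = landed m z" by (intro landed_cong) auto
  then show ?thesis by (simp add: landed_Suc)
qed

text \<open>Integrate out the newest step. With c = 2 pi N and half width h, a particle contributes
  q (c - 2h) by the Fubini average and an empty step 1 - qc, together 1 - 2hq.\<close>

lemma expectation_exposed_length:
  "(\<integral>\<^sup>+z. exposed_length N a (landed m z) \<partial>(Pi\<^sub>M {..<m} (\<lambda>_. \<nu>))) = ennreal (2 * pi * N * (1 - 2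
    * half_width N a * q) ^ m)"
proof (induction m)
  case 0
  have "exposed_length N a [] = ennreal (2 * pi * N)"
    using N by (simp add: exposed_length_def exposed_Nil[OF N a])
  then show ?case by (simp add: landed_def PiM_empty nn_integral_count_space_finite)
next
  case (Suc m)
  let ?c = "2 * pi * N" and ?h = "half_width N a"
  have m: "{..<Suc m} = insert m {..<m}" by auto
  have hw: "2 * ?h \<le> ?c" "0 < ?h" using half_width[OF N a] by auto
  have step: "(\<integral>\<^sup>+y. exposed_length N a (landed (Suc m) (z(m := y))) \<partial>\<nu>) = ennreal (1 - 2 * ?h * q)
    * exposed_length N a (landed m z)" for z
  proof -
    have "(\<integral>\<^sup>+y. exposed_length N a (landed (Suc m) (z(m := y))) \<partial>\<nu>) =
      (\<integral>\<^sup>+y. (if 0 \<le> y then exposed_length N a (landed m z @ [y]) else exposed_length N a (landed m z)) \<partial>\<nu>)"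
      by (intro nn_integral_cong) (simp add: landed_upd)
    also have "\<dots> = ennreal q * (ennreal (?c - 2 * ?h) * exposed_length N a (landed m z))
      + exposed_length N a (landed m z) * ennreal (1 - q * ?c)"
      unfolding nn_integral_nu_if[OF measurable_exposed_length_snoc] exposed_length_average ..
    also have "\<dots> = (ennreal q * ennreal (?c - 2 * ?h) + ennreal (1 - q * ?c)) * exposed_length N a (landed m z)"
      by (simp only: distrib_right mult.assoc) (simp only: mult.commute)
    also have "ennreal q * ennreal (?c - 2 * ?h) + ennreal (1 - q * ?c) = ennreal (q * (?c - 2 * ?h) + (1 - q * ?c))"
    proof -
      have 1: "0 \<le> ?c - 2 * ?h" "0 \<le> 1 - q * ?c" using hw q_le by (simp_all only: diff_ge_0_iff_ge)
      have "ennreal (q * (?c - 2 * ?h) + (1 - q * ?c)) = ennreal (q * (?c - 2 * ?h)) + ennreal (1 - q * ?c)"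
        by (rule ennreal_plus[OF mult_nonneg_nonneg[OF q 1(1)] 1(2)])
      also have "ennreal (q * (?c - 2 * ?h)) = ennreal q * ennreal (?c - 2 * ?h)"
        by (rule ennreal_mult[OF q 1(1)])
      finally show ?thesis ..
    qed
    also have "q * (?c - 2 * ?h) + (1 - q * ?c) = 1 - 2 * ?h * q" by (simp add: algebra_simps)
    finally show ?thesis .
  qed
  note nonneg = survival_nonneg
  have [measurable]: "(\<lambda>z. exposed_length N a (landed m z)) \<in> borel_measurable (Pi\<^sub>M {..<m} (\<lambda>_. \<nu>))"
    by (intro measurable_exposed_length measurable_component_nu)
  have "(\<integral>\<^sup>+z. exposed_length N a (landed (Suc m) z) \<partial>(Pi\<^sub>M {..<Suc m} (\<lambda>_. \<nu>)))
    = (\<integral>\<^sup>+z. (\<integral>\<^sup>+y. exposed_length N a (landed (Suc m) (z(m := y))) \<partial>\<nu>) \<partial>(Pi\<^sub>M {..<m} (\<lambda>_. \<nu>)))"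
    unfolding m by (rule P.product_nn_integral_insert)
      (auto simp flip: m intro!: measurable_exposed_length measurable_component_nu)
  also have "\<dots> = ennreal (1 - 2 * ?h * q) * (\<integral>\<^sup>+z. exposed_length N a (landed m z) \<partial>(Pi\<^sub>M {..<m} (\<lambda>_. \<nu>)))"
    unfolding step by (intro nn_integral_cmult) measurable
  also have "\<dots> = ennreal (?c * (1 - 2 * ?h * q) ^ Suc m)"
    unfolding Suc ennreal_mult'[OF nonneg, symmetric] by (simp only: power_Suc mult_ac)
  finally show ?case .
qed

text \<open>Given the past, a step adds a tree with probability \<open>q\<close> times the exposed
  length; summing the expected lengths yields the geometric series.\<close>

lemma expectation_tree_count:
  "(\<integral>\<^sup>+z. of_nat (tree_count N a (landed m z)) \<partial>(Pi\<^sub>M {..<m} (\<lambda>_. \<nu>))) =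
    ennreal (\<Sum>j<m. q * (2 * pi * N) * (1 - 2 * half_width N a * q) ^ j)"
proof (induction m)
  case 0
  have "of_nat (tree_count N a (landed 0 z)) = (0 :: ennreal)" for z
    by (simp add: landed_def tree_count_Nil[OF N a])
  then show ?case by (simp only: nn_integral_const mult_zero_left lessThan_0 sum.empty ennreal_0)
next
  case (Suc m)
  let ?c = "2 * pi * N" and ?h = "half_width N a"
  have m: "{..<Suc m} = insert m {..<m}" by auto
  have hw: "2 * ?h \<le> ?c" "0 < ?h" using half_width[OF N a] by auto
  note nonneg = survival_nonneg
  have step: "(\<integral>\<^sup>+y. of_nat (tree_count N a (landed (Suc m) (z(m := y)))) \<partial>\<nu>)
    = of_nat (tree_count N a (landed m z)) + ennreal q * exposed_length N a (landed m z)" for z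
  proof -
    have [measurable]: "Measurable.pred borel (exposed N a (landed m z))" by (rule measurable_exposed_const[OF N a])
    have "(\<integral>\<^sup>+y. of_nat (tree_count N a (landed (Suc m) (z(m := y)))) \<partial>\<nu>) =
      (\<integral>\<^sup>+y. of_nat (tree_count N a (landed m z))
        + (if 0 \<le> y then indicator {x. exposed N a (landed m z) x} y else 0) \<partial>\<nu>)"
      by (intro nn_integral_cong) (auto simp add: landed_upd tree_count_snoc[OF N a] split: split_indicator)
    also have "\<dots> = (\<integral>\<^sup>+y. of_nat (tree_count N a (landed m z)) \<partial>\<nu>)
      + (\<integral>\<^sup>+y. (if 0 \<le> y then indicator {x. exposed N a (landed m z) x} y else 0) \<partial>\<nu>)"
      by (intro nn_integral_add) measurable
    also have "\<dots> = of_nat (tree_count N a (landed m z)) + ennreal q * exposed_length N a (landed m z)"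
      by (subst nn_integral_nu_if) (simp_all add: exposed_length_def nu.emeasure_space_1)
    finally show ?thesis .
  qed
  have [measurable]: "(\<lambda>z. exposed_length N a (landed m z)) \<in> borel_measurable (Pi\<^sub>M {..<m} (\<lambda>_. \<nu>))"
    by (intro measurable_exposed_length measurable_component_nu)
  have tc: "(\<lambda>z. of_nat (tree_count N a (landed k z)) :: ennreal) \<in> borel_measurable (Pi\<^sub>M {..<k} (\<lambda>_. \<nu>))" for k
    by (rule measurable_compose[OF measurable_tree_count_landed[OF N a measurable_component_nu]]) auto
  note [measurable] = tc[of m]
  have "(\<integral>\<^sup>+z. of_nat (tree_count N a (landed (Suc m) z)) \<partial>(Pi\<^sub>M {..<Suc m} (\<lambda>_. \<nu>)))
    = (\<integral>\<^sup>+z. (\<integral>\<^sup>+y. of_nat (tree_count N a (landed (Suc m) (z(m := y)))) \<partial>\<nu>) \<partial>(Pi\<^sub>M {..<m} (\<lambda>_. \<nu>)))"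
    unfolding m by (rule P.product_nn_integral_insert) (use tc[of "Suc m"] in \<open>auto simp flip: m\<close>)
  also have "\<dots> = (\<integral>\<^sup>+z. of_nat (tree_count N a (landed m z)) \<partial>(Pi\<^sub>M {..<m} (\<lambda>_. \<nu>))) + ennreal q
    * (\<integral>\<^sup>+z. exposed_length N a (landed m z) \<partial>(Pi\<^sub>M {..<m} (\<lambda>_. \<nu>)))"
    unfolding step by (subst nn_integral_add) (simp_all add: nn_integral_cmult)
  also have "\<dots> = ennreal (\<Sum>j<m. q * ?c * (1 - 2 * ?h * q) ^ j) + ennreal (q * ?c * (1 - 2 * ?h * q) ^ m)"
    unfolding Suc expectation_exposed_length using q N nonneg by (simp add: ennreal_mult[symmetric] mult_ac)
  also have "\<dots> = ennreal (\<Sum>j<Suc m. q * ?c * (1 - 2 * ?h * q) ^ j)"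
    using q N nonneg by (subst ennreal_plus[symmetric]) (auto intro!: sum_nonneg mult_nonneg_nonneg)
  finally show ?case .
qed

end

section \<open>Marks of a Poisson process\<close>

abbreviation positions :: "real \<Rightarrow> real set" where
  "positions N \<equiv> {0..<2 * pi * N}"

definition slot :: "real \<Rightarrow> nat \<Rightarrow> real set" where
  "slot h j = {real j * h <.. real (Suc j) * h}"

text \<open>
  The position of the point in a slot that contains exactly one, and \<open>-1\<close> for all other slots; such
  events are determined by counts.
\<close>

definition mark :: "real \<Rightarrow> real \<Rightarrow> (real \<times> real) set \<Rightarrow> nat \<Rightarrow> real" where
  "mark N h Q j = (if card (Q \<inter> slot h j \<times> {0..<2 * pi * N}) = 1
     then (THE x. \<exists>s. (s, x) \<in> Q \<inter> slot h j \<times> {0..<2 * pi * N}) else -1)"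

lemma mark_singleton:
  assumes "Q \<inter> slot h j \<times> {0..<2 * pi * N} = {(s, x)}" shows "mark N h Q j = x"
  using assms by (simp add: mark_def)

lemma mark_cases:
  obtains "mark N h Q j = -1" "card (Q \<inter> slot h j \<times> {0..<2 * pi * N}) \<noteq> 1"
  | s x where "Q \<inter> slot h j \<times> {0..<2 * pi * N} = {(s, x)}" "mark N h Q j = x" "x \<in> {0..<2 * pi * N}" "s \<in> slot h j"
proof (cases "card (Q \<inter> slot h j \<times> {0..<2 * pi * N}) = 1")
  case True
  then obtain p where "Q \<inter> slot h j \<times> {0..<2 * pi * N} = {p}" by (metis card_1_singletonE)
  moreover obtain s x where "p = (s, x)" by force
  ultimately have eq: "Q \<inter> slot h j \<times> {0..<2 * pi * N} = {(s, x)}" by simp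
  then have "(s, x) \<in> Q \<inter> slot h j \<times> {0..<2 * pi * N}" by simp
  then have "x \<in> {0..<2 * pi * N}" "s \<in> slot h j" by auto
  then show ?thesis using that(2)[OF eq mark_singleton[OF eq]] by blast
next
  case False
  then show ?thesis by (intro that(1)) (simp_all add: mark_def)
qed

text \<open>Expresses the event by two counts, which gives measurability.\<close>

lemma mark_in_iff:
  assumes B: "B \<subseteq> {0..<2 * pi * N}"
  shows "mark N h Q j \<in> B \<longleftrightarrow> card (Q \<inter> slot h j \<times> {0..<2 * pi * N}) = 1 \<and> card (Q \<inter> slot h j \<times> B) = 1"
proof (cases rule: mark_cases[of N h Q j])
  case 1
  then show ?thesis using B by auto
next
  case (2 s x)
  have "Q \<inter> slot h j \<times> B = {(s, x)} \<inter> slot h j \<times> B" unfolding 2(1)[symmetric] using B by blast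
  also have "\<dots> = (if x \<in> B then {(s, x)} else {})" using 2(4) by auto
  finally show ?thesis unfolding 2(1,2) by simp
qed

text \<open>Here the two cells are disjoint, as independence of counts demands. Finiteness enters
  because an infinite set also has \<open>card\<close> 0.\<close>

lemma mark_in_iff_counts:
  assumes B: "B \<subseteq> {0..<2 * pi * N}" and fin: "finite (Q \<inter> slot h j \<times> {0..<2 * pi * N})"
  shows "mark N h Q j \<in> B \<longleftrightarrow> card (Q \<inter> slot h j \<times> B) = 1 \<and> card (Q \<inter> slot h j \<times> ({0..<2 * pi * N} - B)) = 0"
proof -
  let ?T = "{0..<2 * pi * N}"
  have "Q \<inter> slot h j \<times> ?T = (Q \<inter> slot h j \<times> B) \<union> (Q \<inter> slot h j \<times> (?T - B))" using B by blast
  moreover have "(Q \<inter> slot h j \<times> B) \<inter> (Q \<inter> slot h j \<times> (?T - B)) = {}" by blast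
  ultimately have "card (Q \<inter> slot h j \<times> ?T) = card (Q \<inter> slot h j \<times> B) + card (Q \<inter> slot h j \<times> (?T - B))"
    using fin by (metis card_Un_disjoint finite_Un)
  then show ?thesis unfolding mark_in_iff[OF B] by auto
qed

lemma sets_space_time:
  assumes "A \<in> sets borel" "A \<subseteq> {0..} \<times> {0..<2 * pi * N}"
  shows "A \<in> sets (space_time_measure N)" "emeasure (space_time_measure N) A = emeasure lborel A"
proof -
  have "{0..} \<times> {0..<2 * pi * N} \<in> sets (borel :: (real \<times> real) measure)"
    unfolding borel_prod[symmetric] by (rule pair_measureI) auto
  then have 1: "{0..} \<times> {0..<2 * pi * N} \<inter> space lborel \<in> sets (lborel :: (real \<times> real) measure)" by simp
  show "A \<in> sets (space_time_measure N)"
    unfolding space_time_measure_def using assms by (subst sets_restrict_space_iff[OF 1]) auto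
  show "emeasure (space_time_measure N) A = emeasure lborel A"
    unfolding space_time_measure_def using assms by (subst emeasure_restrict_space[OF 1]) auto
qed

lemma space_time_Times:
  assumes "I \<in> sets borel" "B \<in> sets borel" "I \<subseteq> {0..}" "B \<subseteq> {0..<2 * pi * N}"
  shows "I \<times> B \<in> sets (space_time_measure N)"
    "emeasure (space_time_measure N) (I \<times> B) = emeasure lborel I * emeasure lborel B"
proof -
  have IB: "I \<times> B \<in> sets borel" unfolding borel_prod[symmetric] using assms by (intro pair_measureI)
  have sub: "I \<times> B \<subseteq> {0..} \<times> {0..<2 * pi * N}" using assms by blast
  show "I \<times> B \<in> sets (space_time_measure N)" using sets_space_time[OF IB sub] by simp
  have "emeasure (space_time_measure N) (I \<times> B) = emeasure (lborel \<Otimes>\<^sub>M lborel) (I \<times> B)"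
    unfolding sets_space_time(2)[OF IB sub] lborel_prod ..
  also have "\<dots> = emeasure lborel I * emeasure lborel B"
    using assms by (intro lborel.emeasure_pair_measure_Times) auto
  finally show "emeasure (space_time_measure N) (I \<times> B) = emeasure lborel I * emeasure lborel B" .
qed

lemma slot_basic: "0 < h \<Longrightarrow> slot h j \<subseteq> {0..}" "0 < h \<Longrightarrow> emeasure lborel (slot h j) = ennreal h" "slot h j \<in> sets borel"
proof -
  assume h: "0 < h"
  have "0 \<le> real j * h" using h by simp
  then show "slot h j \<subseteq> {0..}" by (auto simp: slot_def)
  show "emeasure lborel (slot h j) = ennreal h"
    unfolding slot_def using h by (subst emeasure_lborel_Ioc) (simp_all add: algebra_simps)
qed (simp add: slot_def)

lemma slot_disjoint:
  assumes h: "0 < h" and ij: "i \<noteq> j" shows "slot h i \<inter> slot h j = {}"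
proof -
  have *: "slot h i \<inter> slot h j = {}" if "i < j" for i j
  proof -
    have "real (Suc i) * h \<le> real j * h" using that h by (intro mult_right_mono) auto
    then show ?thesis by (auto simp: slot_def)
  qed
  show ?thesis using *[of i j] *[of j i] ij by (cases "i < j") auto
qed

section \<open>Joint law of the marks\<close>

context
  fixes N :: real and M :: "'a measure" and P :: "'a \<Rightarrow> (real \<times> real) set"
  assumes N: "0 < N" and ppp: "poisson_point_process M (space_time_measure N) P"
begin

interpretation prob_space M using ppp by (simp add: poisson_point_process_def)

lemma ppp_count:
  assumes "A \<in> sets (space_time_measure N)" "emeasure (space_time_measure N) A < \<infinity>"
  shows "AE \<omega> in M. finite (P \<omega> \<inter> A)" "(\<lambda>\<omega>. card (P \<omega> \<inter> A)) \<in> measurable M (count_space UNIV)"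
    "prob {\<omega>\<in>space M. card (P \<omega> \<inter> A) = k} = measure (space_time_measure N) A ^ k / fact k
      * exp (- measure (space_time_measure N) A)"
  using ppp assms unfolding poisson_point_process_def by blast+

lemma ppp_subset: "\<omega> \<in> space M \<Longrightarrow> P \<omega> \<subseteq> {0..} \<times> positions N"
  using ppp by (auto simp: poisson_point_process_def space_time_measure_def space_restrict_space)

lemma emeasure_positions: assumes "B \<in> sets borel" "B \<subseteq> positions N" shows "emeasure lborel B
  = ennreal (measure lborel B)" "measure lborel B \<le> 2 * pi * N"
    "measure lborel (positions N - B) = 2 * pi * N - measure lborel B"
proof -
  have T: "emeasure lborel (positions N) = ennreal (2 * pi * N)" using N by simp
  have "emeasure lborel B \<le> emeasure lborel (positions N)" using assms by (intro emeasure_mono) auto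
  then have f: "emeasure lborel B \<noteq> \<infinity>" unfolding T by (auto simp: top_unique)
  then show "emeasure lborel B = ennreal (measure lborel B)" by (simp add: emeasure_eq_ennreal_measure)
  have mT: "measure lborel (positions N) = 2 * pi * N" using N by (simp add: measure_def)
  show "measure lborel (positions N - B) = 2 * pi * N - measure lborel B"
    using assms f N by (subst measure_Diff) (auto simp: mT)
  then show "measure lborel B \<le> 2 * pi * N" by (metis diff_ge_0_iff_ge measure_nonneg)
qed

lemma count_slot:
  assumes h: "0 < h" and B: "B \<in> sets borel" "B \<subseteq> positions N"
  shows "slot h j \<times> B \<in> sets (space_time_measure N)" "emeasure (space_time_measure N) (slot h j \<times> B) < \<infinity>"
    "measure (space_time_measure N) (slot h j \<times> B) = h * measure lborel B"
    "AE \<omega> in M. finite (P \<omega> \<inter> slot h j \<times> B)"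
    "(\<lambda>\<omega>. card (P \<omega> \<inter> slot h j \<times> B)) \<in> measurable M (count_space UNIV)"
    "prob {\<omega>\<in>space M. card (P \<omega> \<inter> slot h j \<times> B) = k} = (h * measure lborel B) ^ k / fact k * exp (- (h
      * measure lborel B))"
proof -
  note st = space_time_Times[OF slot_basic(3) B(1) slot_basic(1)[OF h] B(2), of j]
  show 1: "slot h j \<times> B \<in> sets (space_time_measure N)" by (rule st(1))
  have e: "emeasure (space_time_measure N) (slot h j \<times> B) = ennreal (h * measure lborel B)"
    unfolding st(2) slot_basic(2)[OF h] emeasure_positions(1)[OF B] using h by (simp add: ennreal_mult)
  then show 2: "emeasure (space_time_measure N) (slot h j \<times> B) < \<infinity>" by simp
  show 3: "measure (space_time_measure N) (slot h j \<times> B) = h * measure lborel B"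
    unfolding measure_def[of "space_time_measure N"] e using h by simp
  show "AE \<omega> in M. finite (P \<omega> \<inter> slot h j \<times> B)"
    "(\<lambda>\<omega>. card (P \<omega> \<inter> slot h j \<times> B)) \<in> measurable M (count_space UNIV)"
    "prob {\<omega>\<in>space M. card (P \<omega> \<inter> slot h j \<times> B) = k} = (h * measure lborel B) ^ k / fact k * exp (- (h
      * measure lborel B))"
    using ppp_count[OF 1 2] unfolding 3 by blast+
qed

lemma mark_event:
  assumes h: "0 < h" and B: "B \<in> sets borel" "B \<subseteq> positions N"
  shows "{\<omega>\<in>space M. mark N h (P \<omega>) j \<in> B} \<in> events"
proof -
  note [measurable] = count_slot(5)[OF h B, of j] count_slot(5)[OF h, of "positions N" j, simplified]
  show ?thesis unfolding mark_in_iff[OF B(2)] by measurable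
qed

text \<open>The only value outside the positions is -1, so passing to the complement when -1 belongs
  to \<open>A\<close> reduces every Borel event to sets of positions.\<close>

lemma mark_vimage:
  "\<omega> \<in> space M \<Longrightarrow> mark N h (P \<omega>) j \<in> A
    \<longleftrightarrow> (if -1 \<in> A then mark N h (P \<omega>) j \<notin> (positions N) - A else mark N h (P \<omega>) j \<in> A \<inter> positions N)"
  by (cases rule: mark_cases[of N h "P \<omega>" j]) auto

lemma measurable_mark: assumes h: "0 < h" shows "(\<lambda>\<omega>. mark N h (P \<omega>) j) \<in> borel_measurable M"
proof (rule measurableI)
  fix A :: "real set" assume A: "A \<in> sets borel"
  have 1: "{\<omega>\<in>space M. mark N h (P \<omega>) j \<in> positions N - A} \<in> events"
    "{\<omega>\<in>space M. mark N h (P \<omega>) j \<in> A \<inter> positions N} \<in> events"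
    using A by (intro mark_event[OF h]; auto)+
  have "(\<lambda>\<omega>. mark N h (P \<omega>) j) -` A \<inter> space M =
    (if -1 \<in> A then space M - {\<omega>\<in>space M. mark N h (P \<omega>) j \<in> positions N - A} else {\<omega>\<in>space M. mark N h (P \<omega>) j \<in> A \<inter> positions N})"
    using mark_vimage[of _ h j A] by (cases "-1 \<in> A") (simp_all only: if_True if_False, blast+)
  then show "(\<lambda>\<omega>. mark N h (P \<omega>) j) -` A \<inter> space M \<in> events" using 1 by auto
qed simp

text \<open>Each event asks for one point in \<open>slot h j\<close> over \<open>B j\<close> and
  none over the rest. These cells are disjoint for all j, so the Poisson counts are independent and
  the probability factorizes.\<close>

lemma prob_marks:
  assumes h: "0 < h" and J: "finite J" "J \<noteq> {}" and B: "\<And>j. j \<in> J \<Longrightarrow> B j \<in> sets borel" "\<And>j. j \<in> J \<Longrightarrow> B j \<subseteq> positions N"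
  shows "prob (\<Inter>j\<in>J. {\<omega>\<in>space M. mark N h (P \<omega>) j \<in> B j}) = (\<Prod>j\<in>J. h * exp (- (h * (2 * pi * N)))
    * measure lborel (B j))"
proof -
  \<comment> \<open>Two cells per slot in one family indexed by naturals: index 2j is the cell over
    \<open>B j\<close>, to contain one point, and 2j + 1 the cell over its complement, to be
    empty.\<close>
  define A where "A i = slot h (i div 2) \<times> (if even i then B (i div 2) else (positions N) - B (i div 2))" for i
  define v where "v i = (if even i then 1 else 0 :: nat)" for i :: nat
  define I where "I = (\<lambda>j. 2 * j) ` J \<union> (\<lambda>j. 2 * j + 1) ` J"
  have I: "finite I" "I \<noteq> {}" using J by (auto simp: I_def)
  have IJ: "i div 2 \<in> J" if "i \<in> I" for i using that by (auto simp: I_def)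
  have Bs: "(if even i then B (i div 2) else (positions N) - B (i div 2)) \<in> sets borel"
    "(if even i then B (i div 2) else (positions N) - B (i div 2)) \<subseteq> positions N" if "i \<in> I" for i
    using B[OF IJ[OF that]] by auto
  have A: "A i \<in> sets (space_time_measure N)" "emeasure (space_time_measure N) (A i) < \<infinity>" if "i \<in> I" for i
    unfolding A_def using count_slot(1,2)[OF h Bs[OF that]] by blast+
  have "disjoint_family_on A I"
    unfolding disjoint_family_on_def
  proof (intro ballI impI)
    fix i k :: nat assume ik: "i \<in> I" "k \<in> I" "i \<noteq> k"
    show "A i \<inter> A k = {}"
    proof (cases "i div 2 = k div 2")
      case True
      with ik have "even i \<noteq> even k" by presburger
      then show ?thesis unfolding A_def True by auto
    next
      case False
      from slot_disjoint[OF h this] show ?thesis unfolding A_def by blast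
    qed
  qed
  then have "indep_vars (\<lambda>_. count_space UNIV) (\<lambda>i \<omega>. card (P \<omega> \<inter> A i)) I"
    using ppp I(1) A unfolding poisson_point_process_def by blast
  from indep_varsD_finite[OF this I(2,1), of "\<lambda>i. {v i}"]
  have ind: "prob (\<Inter>i\<in>I. (\<lambda>\<omega>. card (P \<omega> \<inter> A i)) -` {v i} \<inter> space M)
    = (\<Prod>i\<in>I. prob ((\<lambda>\<omega>. card (P \<omega> \<inter> A i)) -` {v i} \<inter> space M))"
    by simp
  let ?X = "\<lambda>i. {\<omega>\<in>space M. card (P \<omega> \<inter> A i) = v i}"
  have vim: "(\<lambda>\<omega>. card (P \<omega> \<inter> A i)) -` {v i} \<inter> space M = ?X i" for i by auto
  note [measurable] = ppp_count(2)[OF A]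
  have ev: "?X i \<in> events" if "i \<in> I" for i using that by measurable
  have evm: "{\<omega>\<in>space M. mark N h (P \<omega>) j \<in> B j} \<in> events" if "j \<in> J" for j
    by (rule mark_event[OF h B[OF that]])
  have fin: "AE \<omega> in M. \<forall>j\<in>J. finite (P \<omega> \<inter> slot h j \<times> positions N)"
    using count_slot(4)[OF h, of "positions N"] J(1) by (intro AE_finite_allI) auto
  have "prob (\<Inter>j\<in>J. {\<omega>\<in>space M. mark N h (P \<omega>) j \<in> B j}) = prob (\<Inter>i\<in>I. ?X i)"
  proof (rule finite_measure_eq_AE)
    show "(\<Inter>j\<in>J. {\<omega>\<in>space M. mark N h (P \<omega>) j \<in> B j}) \<in> events" using evm J by (intro sets.finite_INT) auto
    show "(\<Inter>i\<in>I. ?X i) \<in> events" using ev I by (intro sets.finite_INT) auto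
    show "AE \<omega> in M. (\<omega> \<in> (\<Inter>j\<in>J. {\<omega>\<in>space M. mark N h (P \<omega>) j \<in> B j})) = (\<omega> \<in> (\<Inter>i\<in>I. ?X i))"
      using fin
    proof (rule AE_mp[OF _ AE_I2[OF impI]])
      fix \<omega> assume w: "\<omega> \<in> space M" and f: "\<forall>j\<in>J. finite (P \<omega> \<inter> slot h j \<times> positions N)"
      have "mark N h (P \<omega>) j \<in> B j \<longleftrightarrow> card (P \<omega> \<inter> A (2 * j)) = v (2 * j) \<and> card (P \<omega> \<inter> A (2 * j + 1)) = v (2 * j
        + 1)" if "j \<in> J" for j
        using mark_in_iff_counts[OF B(2)[OF that]] f that by (simp add: A_def v_def)
      then have "(\<forall>j\<in>J. mark N h (P \<omega>) j \<in> B j) \<longleftrightarrow> (\<forall>i\<in>I. card (P \<omega> \<inter> A i) = v i)"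
        unfolding I_def by blast
      then show "(\<omega> \<in> (\<Inter>j\<in>J. {\<omega>\<in>space M. mark N h (P \<omega>) j \<in> B j})) = (\<omega> \<in> (\<Inter>i\<in>I. ?X i))"
        using w J(2) I(2) by auto
    qed
  qed
  also have "\<dots> = (\<Prod>i\<in>I. prob (?X i))" using ind unfolding vim .
  also have "\<dots> = (\<Prod>j\<in>J. prob (?X (2 * j))) * (\<Prod>j\<in>J. prob (?X (2 * j + 1)))"
  proof -
    have "(\<lambda>j. 2 * j) ` J \<inter> (\<lambda>j. 2 * j + 1) ` J = {}" by (auto, presburger)
    then show ?thesis unfolding I_def using J(1)
      by (subst prod.union_disjoint) (auto simp: prod.reindex inj_on_def)
  qed
  also have "\<dots> = (\<Prod>j\<in>J. h * exp (- (h * (2 * pi * N))) * measure lborel (B j))"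
    unfolding prod.distrib[symmetric]
  proof (rule prod.cong[OF refl])
    fix j assume j: "j \<in> J"
    have TB: "positions N - B j \<in> sets borel" "positions N - B j \<subseteq> positions N" using B[OF j] by auto
    have p1: "prob (?X (2 * j)) = h * measure lborel (B j) * exp (- (h * measure lborel (B j)))"
      using count_slot(6)[OF h B[OF j], of j 1] by (simp add: A_def v_def)
    have p2: "prob (?X (2 * j + 1)) = exp (- (h * (2 * pi * N - measure lborel (B j))))"
      using count_slot(6)[OF h TB, of j 0] by (simp add: A_def v_def emeasure_positions(3)[OF B[OF j]])
    \<comment> \<open>The two void factors combine to one independent of \<open>B j\<close>: the
      mark has constant density on the positions.\<close>
    have e: "exp (- (h * measure lborel (B j))) * exp (- (h * (2 * pi * N - measure lborel (B j)))) = exp (- (h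
      * (2 * pi * N)))"
      by (simp add: exp_add[symmetric] algebra_simps)
    have "prob (?X (2 * j)) * prob (?X (2 * j + 1)) = h * measure lborel (B j) * (exp (- (h
      * measure lborel (B j))) * exp (- (h * (2 * pi * N - measure lborel (B j)))))"
      unfolding p1 p2 by (simp only: mult.assoc)
    also have "\<dots> = h * exp (- (h * (2 * pi * N))) * measure lborel (B j)" unfolding e
      by (simp only: mult.assoc mult.commute[of "exp _"])
    finally show "prob (?X (2 * j)) * prob (?X (2 * j + 1)) = h * exp (- (h * (2 * pi * N))) * measure lborel (B j)" .
  qed
  finally show ?thesis .
qed

lemma prob_mark:
  assumes h: "0 < h" and B: "B \<in> sets borel" "B \<subseteq> positions N"
  shows "prob {\<omega>\<in>space M. mark N h (P \<omega>) j \<in> B} = h * exp (- (h * (2 * pi * N))) * measure lborel B"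
  using prob_marks[OF h, of "{j}" "\<lambda>_. B"] B by simp

text \<open>Events with \<open>B\<close> inside the positions are closed under intersection and
  generate each mark's sigma-algebra, the value -1 being reached by complements. The product formula
  on them therefore suffices.\<close>

lemma indep_marks:
  assumes h: "0 < h"
  shows "indep_vars (\<lambda>_. borel) (\<lambda>j \<omega>. mark N h (P \<omega>) j) I"
proof -
  define F where "F j = {{\<omega>\<in>space M. mark N h (P \<omega>) j \<in> B} | B. B \<in> sets borel \<and> B \<subseteq> positions N}" for j
  have "indep_sets F I"
  proof (rule indep_setsI)
    show "F i \<subseteq> events" for i unfolding F_def using mark_event[OF h] by blast
  next
    fix A J assume J: "J \<noteq> {}" "J \<subseteq> I" "finite J" and A: "\<forall>j\<in>J. A j \<in> F j"
    then have "\<forall>j\<in>J. \<exists>B. A j = {\<omega>\<in>space M. mark N h (P \<omega>) j \<in> B} \<and> B \<in> sets borel \<and> B \<subseteq> positions N"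
      unfolding F_def by blast
    from bchoice[OF this] obtain B where "\<forall>j\<in>J. A j = {\<omega>\<in>space M. mark N h (P \<omega>) j \<in> B j} \<and> B j \<in> sets borel
      \<and> B j \<subseteq> positions N" ..
    then have B: "\<And>j. j \<in> J \<Longrightarrow> A j = {\<omega>\<in>space M. mark N h (P \<omega>) j \<in> B j}" "\<And>j. j \<in> J \<Longrightarrow> B j \<in> sets borel"
      "\<And>j. j \<in> J \<Longrightarrow> B j \<subseteq> positions N"
      by blast+
    have "prob (\<Inter>j\<in>J. A j) = prob (\<Inter>j\<in>J. {\<omega>\<in>space M. mark N h (P \<omega>) j \<in> B j})" using B(1) by simp
    also have "\<dots> = (\<Prod>j\<in>J. h * exp (- (h * (2 * pi * N))) * measure lborel (B j))"
      by (rule prob_marks[OF h J(3,1) B(2,3)])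
    also have "\<dots> = (\<Prod>j\<in>J. prob (A j))" using B prob_mark[OF h] by (intro prod.cong) auto
    finally show "prob (\<Inter>j\<in>J. A j) = (\<Prod>j\<in>J. prob (A j))" .
  qed
  then have sig: "indep_sets (\<lambda>i. sigma_sets (space M) (F i)) I"
  proof (rule indep_sets_sigma)
    fix i show "Int_stable (F i)"
    proof (rule Int_stableI)
      fix X Y assume "X \<in> F i" "Y \<in> F i"
      then obtain B C where "X = {\<omega>\<in>space M. mark N h (P \<omega>) i \<in> B}" "Y = {\<omega>\<in>space M. mark N h (P \<omega>) i \<in> C}"
        "B \<in> sets borel" "C \<in> sets borel" "B \<subseteq> positions N" "C \<subseteq> positions N" unfolding F_def by blast
      then show "X \<inter> Y \<in> F i" unfolding F_def by (intro CollectI exI[of _ "B \<inter> C"]) auto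
    qed
  qed
  show ?thesis unfolding indep_vars_def2
  proof (intro conjI ballI measurable_mark[OF h] indep_sets_mono_sets[OF sig])
    fix i assume "i \<in> I"
    show "{(\<lambda>\<omega>. mark N h (P \<omega>) i) -` A \<inter> space M |A. A \<in> sets borel} \<subseteq> sigma_sets (space M) (F i)"
    proof clarify
      fix A :: "real set" assume A: "A \<in> sets borel"
      have 1: "{\<omega>\<in>space M. mark N h (P \<omega>) i \<in> positions N - A} \<in> F i"
        "{\<omega>\<in>space M. mark N h (P \<omega>) i \<in> A \<inter> positions N} \<in> F i"
        unfolding F_def using A by (intro CollectI exI[of _ "positions N - A"] exI[of _
          "A \<inter> positions N"] conjI refl; auto)+
      have "(\<lambda>\<omega>. mark N h (P \<omega>) i) -` A \<inter> space M =
        (if -1 \<in> A then space M - {\<omega>\<in>space M. mark N h (P \<omega>) i \<in> positions N - A} else {\<omega>\<in>space M. mark N h (P \<omega>) i \<in> A \<inter> positions N})"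
        using mark_vimage[of _ h i A] by (cases "-1 \<in> A") (simp_all only: if_True if_False, blast+)
      then show "(\<lambda>\<omega>. mark N h (P \<omega>) i) -` A \<inter> space M \<in> sigma_sets (space M) (F i)"
        using 1 by (simp add: sigma_sets.Basic sigma_sets.Compl)
    qed
  qed
qed

lemma distr_mark:
  assumes h: "0 < h"
  shows "distr M borel (\<lambda>\<omega>. mark N h (P \<omega>) j) = distr M borel (\<lambda>\<omega>. mark N h (P \<omega>) 0)"
proof -
  have "emeasure (distr M borel (\<lambda>\<omega>. mark N h (P \<omega>) i)) A = ennreal (if -1 \<in> A then 1 - h * exp (- (h * (2 * pi
    * N))) * measure lborel (positions N - A)
      else h * exp (- (h * (2 * pi * N))) * measure lborel (A \<inter> positions N))" if A: "A \<in> sets borel" for A i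
  proof -
    have s: "positions N - A \<in> sets borel" "A \<inter> positions N \<in> sets borel" using A by auto
    have "emeasure (distr M borel (\<lambda>\<omega>. mark N h (P \<omega>) i)) A = emeasure M ((\<lambda>\<omega>. mark N h (P \<omega>) i) -` A \<inter> space M)"
      using A by (intro emeasure_distr measurable_mark[OF h]) auto
    also have "(\<lambda>\<omega>. mark N h (P \<omega>) i) -` A \<inter> space M =
        (if -1 \<in> A then space M - {\<omega>\<in>space M. mark N h (P \<omega>) i \<in> positions N - A} else {\<omega>\<in>space M. mark N h (P \<omega>) i \<in> A \<inter> positions N})"
        using mark_vimage[of _ h i A] by (cases "-1 \<in> A") (simp_all only: if_True if_False, blast+)
    finally show ?thesis
      using prob_compl[OF mark_event[OF h s(1), of i]] prob_mark[OF h s(1), of i] prob_mark[OF h s(2), of i]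
      by (auto simp: emeasure_eq_measure)
  qed
  then show ?thesis by (intro measure_eqI) simp_all
qed

text \<open>The step law required above, with q = h exp(-2 pi N h), the Poisson density for a single
  point in a slot.\<close>

lemma law_mark:
  assumes h: "0 < h" and f: "f \<in> borel_measurable borel"
  shows "(\<integral>\<^sup>+x. f x * indicator {0..} x \<partial>(distr M borel (\<lambda>\<omega>. mark N h (P \<omega>) j))) =
    ennreal (h * exp (- (h * (2 * pi * N)))) * (\<integral>\<^sup>+x. f x * indicator (positions N) x \<partial>lborel)"
proof -
  let ?q = "h * exp (- (h * (2 * pi * N)))" and ?\<nu> = "distr M borel (\<lambda>\<omega>. mark N h (P \<omega>) j)"
  note [measurable] = f
  have eq: "density ?\<nu> (indicator {0..}) = density lborel (\<lambda>x. ennreal ?q * indicator (positions N) x)"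
  proof (rule measure_eqI)
    fix A assume "A \<in> sets (density ?\<nu> (indicator {0..}))"
    then have A [measurable]: "A \<in> sets borel" by simp
    have s: "A \<inter> positions N \<in> sets borel" "A \<inter> positions N \<subseteq> positions N" using A by auto
    have "emeasure (density ?\<nu> (indicator {0..})) A = emeasure ?\<nu> ({0..} \<inter> A)"
      by (simp add: emeasure_density indicator_inter_arith[symmetric])
    also have "\<dots> = emeasure M ((\<lambda>\<omega>. mark N h (P \<omega>) j) -` ({0..} \<inter> A) \<inter> space M)"
      by (intro emeasure_distr measurable_mark[OF h]) auto
    also have "(\<lambda>\<omega>. mark N h (P \<omega>) j) -` ({0..} \<inter> A) \<inter> space M = {\<omega>\<in>space M. mark N h (P \<omega>) j \<in> A \<inter> positions N}"
    proof -
      have "mark N h (P \<omega>) j \<in> {0..} \<inter> A \<longleftrightarrow> mark N h (P \<omega>) j \<in> A \<inter> positions N" for \<omega>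
        by (cases rule: mark_cases[of N h "P \<omega>" j]) auto
      then show ?thesis by blast
    qed
    also have "emeasure M \<dots> = ennreal (?q * measure lborel (A \<inter> positions N))"
      using prob_mark[OF h s, of j] by (simp add: emeasure_eq_measure)
    also have "\<dots> = ennreal ?q * emeasure lborel (positions N \<inter> A)"
      using h by (simp add: ennreal_mult emeasure_positions(1)[OF s] Int_commute)
    also have "\<dots> = emeasure (density lborel (\<lambda>x. ennreal ?q * indicator (positions N) x)) A"
      by (simp add: emeasure_density mult.assoc indicator_inter_arith[symmetric] nn_integral_cmult)
    finally show "emeasure (density ?\<nu> (indicator {0..})) A = emeasure (density lborel (\<lambda>x. ennreal ?q
      * indicator (positions N) x)) A" .
  qed simp
  have "(\<integral>\<^sup>+x. f x * indicator {0..} x \<partial>?\<nu>) = (\<integral>\<^sup>+x. f x \<partial>(density ?\<nu> (indicator {0..})))"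
    by (subst nn_integral_density) (auto simp: mult.commute)
  also have "\<dots> = ennreal ?q * (\<integral>\<^sup>+x. f x * indicator (positions N) x \<partial>lborel)"
    unfolding eq by (subst nn_integral_density) (auto simp: mult.assoc nn_integral_cmult mult.commute[of "f _"])
  finally show ?thesis .
qed

lemma expectation_marks:
  assumes h: "0 < h" and a: "0 < a" "a < 1" and m: "0 < m"
  shows "(\<integral>\<^sup>+\<omega>. of_nat (tree_count N a (landed m (mark N h (P \<omega>)))) \<partial>M) =
    ennreal (\<Sum>j<m. h * exp (- (h * (2 * pi * N))) * (2 * pi * N) * (1 - 2 * half_width N a * (h * exp (- (h * (2
      * pi * N))))) ^ j)"
proof -
  let ?\<nu> = "distr M borel (\<lambda>\<omega>. mark N h (P \<omega>) 0)"
  have nu: "prob_space ?\<nu>" "sets ?\<nu> = sets borel" by (auto intro!: prob_space_distr measurable_mark[OF h])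
  have q: "0 \<le> h * exp (- (h * (2 * pi * N)))" using h by simp
  have "{..<m} \<noteq> {}" using m by auto
  then have "distr M (Pi\<^sub>M {..<m} (\<lambda>_. borel)) (\<lambda>\<omega>. \<lambda>j\<in>{..<m}. mark N h (P \<omega>) j)
    = Pi\<^sub>M {..<m} (\<lambda>i. distr M borel (\<lambda>\<omega>. mark N h (P \<omega>) i))"
    using indep_marks[OF h, of "{..<m}"] measurable_mark[OF h] by (subst (asm) indep_vars_iff_distr_eq_PiM') blast+
  also have "\<dots> = Pi\<^sub>M {..<m} (\<lambda>_. ?\<nu>)" by (intro PiM_cong refl distr_mark[OF h])
  finally have dist: "distr M (Pi\<^sub>M {..<m} (\<lambda>_. borel)) (\<lambda>\<omega>. \<lambda>j\<in>{..<m}. mark N h (P \<omega>) j) = Pi\<^sub>M {..<m} (\<lambda>_. ?\<nu>)" .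
  have cnt: "(\<lambda>z. of_nat (tree_count N a (landed m z)) :: ennreal) \<in> borel_measurable (Pi\<^sub>M {..<m} (\<lambda>_. borel))"
    by (rule measurable_compose[OF measurable_tree_count_landed[OF N a]]) (auto intro: measurable_component_singleton)
  have "(\<integral>\<^sup>+z. of_nat (tree_count N a (landed m z)) \<partial>(Pi\<^sub>M {..<m} (\<lambda>_. ?\<nu>))) =
    (\<integral>\<^sup>+\<omega>. of_nat (tree_count N a (landed m (\<lambda>j\<in>{..<m}. mark N h (P \<omega>) j))) \<partial>M)"
    unfolding dist[symmetric]
    using cnt by (subst nn_integral_distr) (auto intro!: measurable_restrict measurable_mark[OF h])
  moreover have "landed m (\<lambda>j\<in>{..<m}. mark N h (P \<omega>) j) = landed m (mark N h (P \<omega>))" for \<omega>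
    by (rule landed_cong) simp
  ultimately show ?thesis using expectation_tree_count[OF N a q nu law_mark[OF h], of m] by simp
qed

end

section \<open>Fine time slots see every arrival\<close>

text \<open>The deterministic properties under which the slots work. Time 0 is excluded since slots
  are open on the left. The last clause, with finiteness, also forces distinct arrival
  times.\<close>

definition good_points :: "real \<Rightarrow> (real \<times> real) set \<Rightarrow> bool" where
  "good_points N Q \<longleftrightarrow> Q \<subseteq> {0..} \<times> {0..<2 * pi * N} \<and> (\<forall>n::nat. finite (Q \<inter> {0..real n} \<times> {0..<2 * pi * N})) \<and>
     Q \<inter> {0} \<times> {0..<2 * pi * N} = {} \<and>
     (\<forall>n::nat. \<exists>k. \<forall>j < n * 2 ^ k. card (Q \<inter> slot (1 / 2 ^ k) j \<times> {0..<2 * pi * N}) \<le> 1)"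

text \<open>Dyadic meshes are nested, so a mesh that separates the points is followed only by
  separating ones.\<close>

lemma slot_refine:
  "slot (1 / 2 ^ (k + d)) j \<subseteq> slot (1 / 2 ^ k) (j div 2 ^ d)"
proof -
  let ?b = "(2::nat) ^ d"
  have j: "j div ?b * ?b \<le> j" "Suc j \<le> Suc (j div ?b) * ?b"
  proof -
    have "j = j div ?b * ?b + j mod ?b" "j mod ?b < ?b"
      using div_mult_mod_eq[of j ?b] by simp_all
    then show "j div ?b * ?b \<le> j" "Suc j \<le> Suc (j div ?b) * ?b" unfolding mult_Suc by linarith+
  qed
  have e: "real x * (1 / 2 ^ k) = real (x * ?b) * (1 / 2 ^ (k + d))" for x
    by (simp add: power_add)
  have "real (j div ?b * ?b) * (1 / 2 ^ (k + d)) \<le> real j * (1 / 2 ^ (k + d))"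
    "real (Suc j) * (1 / 2 ^ (k + d)) \<le> real (Suc (j div ?b) * ?b) * (1 / 2 ^ (k + d))"
    using j by (intro mult_right_mono of_nat_mono; simp)+
  then show ?thesis unfolding slot_def e by auto
qed

lemma sorted_list_of_set_append:
  fixes A B :: "'a::linorder set"
  assumes "finite A" "finite B" "\<And>x y. x \<in> A \<Longrightarrow> y \<in> B \<Longrightarrow> x < y"
  shows "sorted_list_of_set (A \<union> B) = sorted_list_of_set A @ sorted_list_of_set B"
proof (rule sorted_distinct_set_unique)
  show "sorted (sorted_list_of_set A @ sorted_list_of_set B)"
    using assms by (auto simp: sorted_append intro: less_imp_le)
  show "distinct (sorted_list_of_set A @ sorted_list_of_set B)"
    using assms by (fastforce simp: set_sorted_list_of_set)
qed (use assms in auto)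

definition arrival_times :: "(real \<times> real) set \<Rightarrow> real \<Rightarrow> real set" where
  "arrival_times Q t = {s. s \<le> t \<and> (\<exists>x. (s, x) \<in> Q)}"

lemma arrival_positions_eq: "arrival_positions Q t
  = map (\<lambda>s. THE x. (s, x) \<in> Q) (sorted_list_of_set (arrival_times Q t))"
  by (simp add: arrival_positions_def arrival_times_def)

context
  fixes N :: real and Q :: "(real \<times> real) set"
  assumes Q: "good_points N Q"
begin

lemma good_pointsD:
  "Q \<subseteq> {0..} \<times> positions N" "finite (Q \<inter> {0..real n} \<times> positions N)" "Q \<inter> {0} \<times> positions N = {}"
  "\<exists>k. \<forall>j < n * 2 ^ k. card (Q \<inter> slot (1 / 2 ^ k) j \<times> positions N) \<le> 1"
  using Q unfolding good_points_def by blast+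

lemma finite_arrival_times: "finite (arrival_times Q t)"
proof -
  obtain n :: nat where n: "t \<le> real n" using real_arch_simple by blast
  have "arrival_times Q t \<subseteq> fst ` (Q \<inter> {0..real n} \<times> positions N)"
  proof
    fix s assume "s \<in> arrival_times Q t"
    then obtain x where "(s, x) \<in> Q" "s \<le> t" by (auto simp: arrival_times_def)
    then show "s \<in> fst ` (Q \<inter> {0..real n} \<times> positions N)" using good_pointsD(1) n by (intro image_eqI[of _ _
      "(s, x)"]) auto
  qed
  then show ?thesis using good_pointsD(2) finite_surj by blast
qed

text \<open>Later points have larger times, so sorting only appends; with
  \<open>tree_count_append\<close> the tree count is monotone in time.\<close>

lemma arrival_positions_prefix:
  assumes "t \<le> u" shows "\<exists>ys. arrival_positions Q u = arrival_positions Q t @ ys"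
proof -
  have eq: "arrival_times Q u = arrival_times Q t \<union> (arrival_times Q u \<inter> {t<..})"
    using assms by (auto simp: arrival_times_def)
  have "sorted_list_of_set (arrival_times Q u)
    = sorted_list_of_set (arrival_times Q t) @ sorted_list_of_set (arrival_times Q u \<inter> {t<..})"
    by (subst eq, rule sorted_list_of_set_append) (auto simp: finite_arrival_times, auto simp: arrival_times_def)
  then show ?thesis unfolding arrival_positions_eq by auto
qed

text \<open>Slot by slot, at most one new time appears, and it exceeds all earlier ones; both lists
  are extended by the same entry or by nothing.\<close>

lemma landed_prefix_eq_arrival_positions:
  assumes sep: "\<forall>j < m. card (Q \<inter> slot h j \<times> positions N) \<le> 1" and h: "0 < h" and fin:
    "\<forall>j < m. finite (Q \<inter> slot h j \<times> positions N)"
  shows "landed m (mark N h Q) = arrival_positions Q (real m * h)"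
  using sep fin
proof (induction m)
  case 0
  have "arrival_times Q 0 = {}" using good_pointsD(1,3) by (fastforce simp: arrival_times_def)
  then show ?case by (simp add: landed_def arrival_positions_eq)
next
  case (Suc m)
  have IH: "landed m (mark N h Q) = arrival_positions Q (real m * h)" using Suc by auto
  have le: "real m * h \<le> real (Suc m) * h" using h by (intro mult_right_mono) auto
  have split: "arrival_times Q (real (Suc m) * h) = arrival_times Q (real m * h) \<union> fst ` (Q \<inter> slot h m \<times> positions N)"
  proof (intro equalityI subsetI)
    fix s assume s: "s \<in> arrival_times Q (real (Suc m) * h)"
    then obtain x where x: "(s, x) \<in> Q" "s \<le> real (Suc m) * h" by (auto simp: arrival_times_def)
    show "s \<in> arrival_times Q (real m * h) \<union> fst ` (Q \<inter> slot h m \<times> positions N)"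
    proof (cases "s \<le> real m * h")
      case True then show ?thesis using x by (auto simp: arrival_times_def)
    next
      case False
      then have "(s, x) \<in> Q \<inter> slot h m \<times> positions N" using x good_pointsD(1) by (auto simp: slot_def)
      then show ?thesis by force
    qed
  next
    fix s assume "s \<in> arrival_times Q (real m * h) \<union> fst ` (Q \<inter> slot h m \<times> positions N)"
    then show "s \<in> arrival_times Q (real (Suc m) * h)" using le by (auto simp: arrival_times_def slot_def)
  qed
  have fin: "finite (Q \<inter> slot h m \<times> positions N)" using Suc.prems by auto
  have "sorted_list_of_set (arrival_times Q (real (Suc m) * h)) = sorted_list_of_set (arrival_times Q (real m
    * h)) @ sorted_list_of_set (fst ` (Q \<inter> slot h m \<times> positions N))"
    unfolding split using fin
      by (intro sorted_list_of_set_append finite_arrival_times finite_imageI) (auto simp: arrival_times_def slot_def)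
  then have app: "arrival_positions Q (real (Suc m) * h) = arrival_positions Q (real m
    * h) @ map (\<lambda>s. THE x. (s, x) \<in> Q) (sorted_list_of_set (fst ` (Q \<inter> slot h m \<times> positions N)))"
    unfolding arrival_positions_eq by simp
  show ?case
  proof (cases rule: mark_cases[of N h Q m])
    case 1
    then have "card (Q \<inter> slot h m \<times> positions N) = 0" using Suc.prems by (metis le_less lessI less_one)
    then have "Q \<inter> slot h m \<times> positions N = {}" using fin by simp
    then show ?thesis using 1 IH app by (simp add: landed_Suc)
  next
    case (2 s x)
    \<comment> \<open>Any point at time \<open>s\<close> lies in the same slot, which holds only
      one.\<close>
    have "(THE y. (s, y) \<in> Q) = x"
    proof (rule the_equality)
      show "(s, x) \<in> Q" using 2(1) by blast
      fix y assume "(s, y) \<in> Q"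
      then have "(s, y) \<in> Q \<inter> slot h m \<times> positions N" using 2(4) good_pointsD(1) by auto
      then show "y = x" unfolding 2(1) by simp
    qed
    then show ?thesis using 2 IH app by (simp add: landed_Suc)
  qed
qed

lemma eventually_landed:
  "eventually (\<lambda>k. landed (n * 2 ^ k) (mark N (1 / 2 ^ k) Q) = arrival_positions Q (real n)) sequentially"
proof -
  obtain k where k: "\<forall>j < n * 2 ^ k. card (Q \<inter> slot (1 / 2 ^ k) j \<times> positions N) \<le> 1" using good_pointsD(4) by blast
  have "landed (n * 2 ^ l) (mark N (1 / 2 ^ l) Q) = arrival_positions Q (real n)" if "k \<le> l" for l
  proof -
    obtain d where l: "l = k + d" using \<open>k \<le> l\<close> le_Suc_ex by blast
    have sub: "slot (1 / 2 ^ l') j \<subseteq> {0..real n}" if "j < n * 2 ^ l'" for j l'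
    proof -
      have "Suc j \<le> n * 2 ^ l'" using that by simp
      then have "real (Suc j) \<le> real (n * 2 ^ l')" by (rule of_nat_mono)
      then have "real (Suc j) * (1 / 2 ^ l') \<le> real (n * 2 ^ l') * (1 / 2 ^ l')" by (rule mult_right_mono) simp
      then have "real (Suc j) * (1 / 2 ^ l') \<le> real n" by simp
      moreover have "0 \<le> real j * (1 / 2 ^ l')" by simp
      ultimately show ?thesis unfolding slot_def
        by (intro subsetI) (simp only: greaterThanAtMost_iff atLeastAtMost_iff, linarith)
    qed
    have fin: "finite (Q \<inter> slot (1 / 2 ^ l') j \<times> positions N)" if "j < n * 2 ^ l'" for j l'
      by (rule finite_subset[OF _ good_pointsD(2)[of n]]) (use sub[OF that] in blast)
    have "card (Q \<inter> slot (1 / 2 ^ l) j \<times> positions N) \<le> 1" if j: "j < n * 2 ^ l" for j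
    proof -
      have jj: "j div 2 ^ d < n * 2 ^ k" using j unfolding l
        by (simp add: power_add less_mult_imp_div_less mult.assoc)
      have "card (Q \<inter> slot (1 / 2 ^ l) j \<times> positions N) \<le> card (Q \<inter> slot (1 / 2 ^ k) (j div 2 ^ d) \<times> positions N)"
        using slot_refine[of k d j] unfolding l by (intro card_mono fin[OF jj]) blast
      then show ?thesis using k jj by (meson le_trans)
    qed
    then have "landed (n * 2 ^ l) (mark N (1 / 2 ^ l) Q) = arrival_positions Q (real (n * 2 ^ l) * (1 / 2 ^ l))"
      using fin by (intro landed_prefix_eq_arrival_positions) auto
    then show ?thesis by simp
  qed
  then show ?thesis unfolding eventually_sequentially by blast
qed

text \<open>A bound that does not depend on the mesh for a fixed end time: the integrable majorant
  for dominated convergence.\<close>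

lemma length_landed_le:
  assumes h: "0 < h" shows "length (landed m (mark N h Q)) \<le> card (Q \<inter> {0..real m * h} \<times> positions N)"
proof -
  obtain n :: nat where n: "real m * h \<le> real n" using real_arch_simple by blast
  have fin: "finite (Q \<inter> {0..t} \<times> positions N)" if "t \<le> real m * h" for t
    by (rule finite_subset[OF _ good_pointsD(2)[of n]]) (use that n in auto)
  show ?thesis using fin
  proof (induction m)
    case 0 then show ?case by (simp add: landed_def)
  next
    case (Suc m)
    have le: "real m * h \<le> real (Suc m) * h" using h by (intro mult_right_mono) auto
    have IH: "length (landed m (mark N h Q)) \<le> card (Q \<inter> {0..real m * h} \<times> positions N)"
      using Suc.prems le by (intro Suc.IH) (meson order_trans)
    have dis: "(Q \<inter> {0..real m * h} \<times> positions N) \<inter> (Q \<inter> slot h m \<times> positions N) = {}" by (auto simp: slot_def)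
    have sub: "(Q \<inter> {0..real m * h} \<times> positions N) \<union> (Q \<inter> slot h m \<times> positions N) \<subseteq> Q \<inter> {0..real (Suc m)
      * h} \<times> positions N"
      using le good_pointsD(1) by (auto simp: slot_def simp del: of_nat_Suc)
    have f: "finite (Q \<inter> {0..real (Suc m) * h} \<times> positions N)" using Suc.prems by simp
    have "card (Q \<inter> {0..real m * h} \<times> positions N)
      + card (Q \<inter> slot h m \<times> positions N) \<le> card (Q \<inter> {0..real (Suc m) * h} \<times> positions N)"
      using card_mono[OF f sub] finite_subset[OF sub f] dis by (subst (asm) card_Un_disjoint) auto
    moreover have "length (landed (Suc m) (mark N h Q)) \<le> length (landed m (mark N h Q))
      + card (Q \<inter> slot h m \<times> positions N)"
      by (cases rule: mark_cases[of N h Q m]) (auto simp: landed_Suc)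
    ultimately show ?case using IH by linarith
  qed
qed

end

section \<open>The limit\<close>

lemma tendsto_at_top_mono_nat:
  fixes f :: "real \<Rightarrow> real"
  assumes mono: "\<And>s t. s \<le> t \<Longrightarrow> f s \<le> f t" and lim: "(\<lambda>i. f (real (Suc i))) \<longlonglongrightarrow> y"
  shows "(f \<longlongrightarrow> y) at_top"
proof (rule order_tendstoI)
  fix a assume "a < y"
  from order_tendstoD(1)[OF lim this] obtain i where i: "a < f (real (Suc i))" by (auto simp: eventually_sequentially)
  show "eventually (\<lambda>t. a < f t) at_top"
    using eventually_ge_at_top[of "real (Suc i)"] by eventually_elim (use mono i in \<open>meson less_le_trans\<close>)
next
  fix a assume a: "y < a"
  have le: "f (real (Suc i)) \<le> y" for i
    using lim by (rule incseq_le[rotated]) (auto simp: incseq_def intro!: mono)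
  have "f t < a" for t
  proof -
    obtain i where "t \<le> real (Suc i)" by (meson le_SucI of_nat_mono order_trans real_arch_simple le_Suc_eq order_refl)
    from order_trans[OF mono[OF this] le] show ?thesis using a by simp
  qed
  then show "eventually (\<lambda>t. f t < a) at_top" by simp
qed

text \<open>Since 2^k q tends to 1, this is the usual exponential limit. It is proved for a real
  variable with \<open>powr\<close> and specialized to 2^k once the base is positive.\<close>

lemma survival_limit:
  fixes al c :: real and n :: nat
  shows "(\<lambda>k. (1 - 2 * al * (1 / 2 ^ k * exp (- (1 / 2 ^ k * c)))) ^ (n * 2 ^ k)) \<longlonglongrightarrow> exp (- 2 * al * real n)"
proof -
  have X: "filterlim (\<lambda>k::nat. (2::real) ^ k) at_top sequentially" by real_asymp
  have "((\<lambda>X::real. (1 - 2 * al * (exp (- c / X) / X)) powr (real n * X)) \<longlongrightarrow> exp (- 2 * al * real n)) at_top"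
    by real_asymp
  from filterlim_compose[OF this X]
  have lim: "(\<lambda>k. (1 - 2 * al * (exp (- c / 2 ^ k) / 2 ^ k)) powr (real n * 2 ^ k)) \<longlonglongrightarrow> exp (- 2 * al * real n)" .
  have "eventually (\<lambda>X::real. 0 < 1 - 2 * al * (exp (- c / X) / X)) at_top" by real_asymp
  from eventually_compose_filterlim[OF this X]
  have "eventually (\<lambda>k::nat. (1 - 2 * al * (exp (- c / 2 ^ k) / 2 ^ k)) powr (real n * 2 ^ k) =
    (1 - 2 * al * (1 / 2 ^ k * exp (- (1 / 2 ^ k * c)))) ^ (n * 2 ^ k)) sequentially"
  proof eventually_elim
    case (elim k)
    from powr_realpow[OF elim, of "n * 2 ^ k"] show ?case by simp
  qed
  with lim show ?thesis by (rule Lim_transform_eventually)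
qed

text \<open>Using k <= 2^k, the series of the mean is dominated by the exponential series at
  2m.\<close>

lemma (in prob_space) integrable_poisson_count:
  fixes X :: "'a \<Rightarrow> nat"
  assumes [measurable]: "X \<in> measurable M (count_space UNIV)" and m: "0 \<le> m"
    and X: "\<And>k. prob {\<omega>\<in>space M. X \<omega> = k} = m ^ k / fact k * exp (- m)"
  shows "integrable M (\<lambda>\<omega>. real (X \<omega>))"
proof (rule integrableI_bounded)
  have "(\<integral>\<^sup>+\<omega>. norm (real (X \<omega>)) \<partial>M) = (\<integral>\<^sup>+\<omega>. (\<Sum>k. ennreal (real k) * indicator {\<omega>\<in>space M. X \<omega> = k} \<omega>) \<partial>M)"
  proof (rule nn_integral_cong)
    fix \<omega> assume w: "\<omega> \<in> space M"
    have "(\<Sum>k. ennreal (real k) * indicator {\<omega>\<in>space M. X \<omega> = k} \<omega>) = (\<Sum>k\<in>{X \<omega>}. ennreal (real k)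
      * indicator {\<omega>\<in>space M. X \<omega> = k} \<omega>)"
      by (rule suminf_finite) auto
    then show "ennreal (norm (real (X \<omega>))) = (\<Sum>k. ennreal (real k) * indicator {\<omega>\<in>space M. X \<omega> = k} \<omega>)" using w
      by simp
  qed
  also have "\<dots> = (\<Sum>k. \<integral>\<^sup>+\<omega>. ennreal (real k) * indicator {\<omega>\<in>space M. X \<omega> = k} \<omega> \<partial>M)"
    by (rule nn_integral_suminf) measurable
  also have "\<dots> = (\<Sum>k. ennreal (real k * (m ^ k / fact k * exp (- m))))"
  proof (rule suminf_cong)
    fix k
    have "(\<integral>\<^sup>+\<omega>. ennreal (real k) * indicator {\<omega>\<in>space M. X \<omega> = k} \<omega> \<partial>M) = ennreal (real k)
      * ennreal (m ^ k / fact k * exp (- m))"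
      by (subst nn_integral_cmult_indicator) (simp_all add: emeasure_eq_measure X)
    then show "(\<integral>\<^sup>+\<omega>. ennreal (real k) * indicator {\<omega>\<in>space M. X \<omega> = k} \<omega> \<partial>M) = ennreal (real k
      * (m ^ k / fact k * exp (- m)))"
      by (simp only: ennreal_mult'[OF of_nat_0_le_iff])
  qed
  also have "\<dots> < \<infinity>"
  proof -
    have "summable (\<lambda>k. (2 * m) ^ k / fact k)" using summable_exp[of "2 * m"]
      by (simp add: divide_inverse mult.commute)
    then have "summable (\<lambda>k. real k * (m ^ k / fact k * exp (- m)))"
    proof (rule summable_comparison_test_ev[rotated], intro always_eventually allI)
      fix k
      have "real k \<le> 2 ^ k" using of_nat_less_two_power[of k, where ?'a = real] by simp
      then have "real k * (m ^ k / fact k * exp (- m)) \<le> 2 ^ k * (m ^ k / fact k * 1)"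
        using m by (intro mult_mono) (auto intro!: mult_nonneg_nonneg)
      then show "norm (real k * (m ^ k / fact k * exp (- m))) \<le> (2 * m) ^ k / fact k" using m
        by (simp add: power_mult_distrib)
    qed
    then show ?thesis using m by (subst suminf_ennreal2) (auto intro!: mult_nonneg_nonneg divide_nonneg_nonneg)
  qed
  finally show "(\<integral>\<^sup>+\<omega>. norm (real (X \<omega>)) \<partial>M) < \<infinity>" .
qed measurable

section \<open>Almost sure regularity and removal of the mesh\<close>

context
  fixes N :: real and M :: "'a measure" and P :: "'a \<Rightarrow> (real \<times> real) set"
  assumes N: "0 < N" and ppp: "poisson_point_process M (space_time_measure N) P"
begin

interpretation prob_space M using ppp by (simp add: poisson_point_process_def)

lemma time_box:
  "{0..real n} \<times> positions N \<in> sets (space_time_measure N)"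
    "emeasure (space_time_measure N) ({0..real n} \<times> positions N) < \<infinity>"
proof -
  have s: "{0..real n} \<in> sets borel" "positions N \<in> sets borel" "{0..real n} \<subseteq> {0..}" "positions N
    \<subseteq> positions N" by auto
  show "{0..real n} \<times> positions N \<in> sets (space_time_measure N)" by (rule space_time_Times(1)[OF s])
  show "emeasure (space_time_measure N) ({0..real n} \<times> positions N) < \<infinity>"
    unfolding space_time_Times(2)[OF s] using N by (simp add: ennreal_mult_less_top)
qed

lemma AE_no_point_at_0: "AE \<omega> in M. P \<omega> \<inter> {0} \<times> positions N = {}"
proof -
  have s: "{0::real} \<in> sets borel" "positions N \<in> sets borel" "{0::real} \<subseteq> {0..}" "positions N \<subseteq> positions N" by auto
  have A: "{0} \<times> positions N \<in> sets (space_time_measure N)" by (rule space_time_Times(1)[OF s])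
  have e: "emeasure (space_time_measure N) ({0} \<times> positions N) = 0" unfolding space_time_Times(2)[OF s] by simp
  then have "emeasure (space_time_measure N) ({0} \<times> positions N) < \<infinity>" by simp
  note c = ppp_count[OF N ppp A this]
  have "prob {\<omega>\<in>space M. card (P \<omega> \<inter> {0} \<times> positions N) = 0} = 1" using c(3)[of 0] e by (simp add: measure_def)
  moreover have "{\<omega>\<in>space M. card (P \<omega> \<inter> {0} \<times> positions N) = 0} \<in> events"
    using c(2) by measurable
  ultimately have "AE \<omega> in M. \<omega> \<in> {\<omega>\<in>space M. card (P \<omega> \<inter> {0} \<times> positions N) = 0}" by (simp only: prob_eq_1)
  with c(1) show ?thesis by eventually_elim auto
qed

text \<open>A slot holds several points with probability at most (2 pi N / 2^k)^2. There are n 2^k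
  slots, so \<open>Bad k\<close> has probability of order 2^(-k), and the event that every mesh
  fails is null.\<close>

lemma AE_separated: "AE \<omega> in M. \<exists>k. \<forall>j < n * 2 ^ k. card (P \<omega> \<inter> slot (1 / 2 ^ k) j \<times> positions N) \<le> 1"
proof -
  let ?c = "2 * pi * N"
  define bad where "bad k j = {\<omega>\<in>space M. \<not> card (P \<omega> \<inter> slot (1 / 2 ^ k) j \<times> positions N) \<le> 1}" for k j
  define Bad where "Bad k = (\<Union>j<n * 2 ^ k. bad k j)" for k
  have pos: "positions N \<in> sets borel" "positions N \<subseteq> positions N" by auto
  have mT: "measure lborel (positions N) = ?c" using N by (simp add: measure_def)
  have h: "0 < (1::real) / 2 ^ k" for k :: nat by simp
  note cs = count_slot[OF N ppp h pos]
  have ev: "bad k j \<in> events" for k j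
  proof -
    note [measurable] = cs(5)[of k j]
    show ?thesis unfolding bad_def by measurable
  qed
  have pb: "prob (bad k j) \<le> (1 / 2 ^ k * ?c)\<^sup>2" for k j
  proof -
    let ?x = "1 / 2 ^ k * ?c"
    note [measurable] = cs(5)[of k j]
    have x: "0 \<le> ?x" using N by simp
    let ?E = "\<lambda>i. {\<omega>\<in>space M. card (P \<omega> \<inter> slot (1 / 2 ^ k) j \<times> positions N) = i}"
    have "bad k j = space M - (?E 0 \<union> ?E 1)" unfolding bad_def by (auto simp: le_Suc_eq)
    moreover have "?E 0 \<in> events" "?E 1 \<in> events" by measurable
    ultimately have "prob (bad k j) = 1 - (prob (?E 0) + prob (?E 1))"
    proof -
      assume bad: "bad k j = space M - (?E 0 \<union> ?E 1)" and E: "?E 0 \<in> events" "?E 1 \<in> events"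
      have "?E 0 \<inter> ?E 1 = {}" by auto
      from finite_measure_Union[OF E this] show ?thesis unfolding bad by (simp only: prob_compl[OF sets.Un[OF E]])
    qed
    also have "\<dots> = 1 - (1 + ?x) * exp (- ?x)"
      unfolding cs(6) mT by (simp add: algebra_simps)
    \<comment> \<open>From exp(-x) >= 1 - x, leaving exactly x^2.\<close>
    also have "\<dots> \<le> 1 - (1 + ?x) * (1 - ?x)"
      using exp_ge_add_one_self[of "- ?x"] x by (intro diff_left_mono mult_left_mono) auto
    also have "\<dots> = ?x\<^sup>2" by (simp add: power2_eq_square algebra_simps)
    finally show ?thesis .
  qed
  have evB: "Bad k \<in> events" for k unfolding Bad_def using ev by auto
  have pB: "prob (Bad k) \<le> real n * ?c\<^sup>2 * (1 / 2) ^ k" for k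
  proof -
    have "prob (Bad k) \<le> (\<Sum>j<n * 2 ^ k. prob (bad k j))" unfolding Bad_def using ev
      by (intro finite_measure_subadditive_finite) auto
    also have "\<dots> \<le> (\<Sum>j<n * 2 ^ k. (1 / 2 ^ k * ?c)\<^sup>2)" by (intro sum_mono pb)
    also have "\<dots> = real n * ?c\<^sup>2 * (1 / 2) ^ k" by (simp add: power2_eq_square field_simps)
    finally show ?thesis .
  qed
  have evI: "(\<Inter>k. Bad k) \<in> events" using evB by auto
  have "prob (\<Inter>k. Bad k) \<le> real n * ?c\<^sup>2 * (1 / 2) ^ k" for k
    by (rule order_trans[OF finite_measure_mono pB[of k]]) (use evB in auto)
  moreover have "(\<lambda>k. real n * ?c\<^sup>2 * (1 / 2) ^ k) \<longlonglongrightarrow> real n * ?c\<^sup>2 * 0"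
    by (intro tendsto_intros LIMSEQ_power_zero) auto
  ultimately have "prob (\<Inter>k. Bad k) \<le> 0" by (intro LIMSEQ_le_const) auto
  then have "prob (\<Inter>k. Bad k) = 0" using measure_nonneg[of M "\<Inter>k. Bad k"] by linarith
  then have "AE \<omega> in M. \<omega> \<notin> (\<Inter>k. Bad k)" using prob_eq_0[OF evI] by simp
  then show ?thesis
    by (rule AE_mp) (rule AE_I2, auto simp: Bad_def bad_def)
qed

lemma AE_good_points: "AE \<omega> in M. good_points N (P \<omega>)"
proof -
  have 1: "AE \<omega> in M. P \<omega> \<subseteq> {0..} \<times> positions N" using ppp_subset[OF N ppp] by (intro AE_I2) auto
  have 2: "AE \<omega> in M. \<forall>n. finite (P \<omega> \<inter> {0..real n} \<times> positions N)"
    unfolding AE_all_countable using ppp_count(1)[OF N ppp time_box] by auto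
  have 3: "AE \<omega> in M. \<forall>n. \<exists>k. \<forall>j < n * 2 ^ k. card (P \<omega> \<inter> slot (1 / 2 ^ k) j \<times> positions N) \<le> 1"
    unfolding AE_all_countable using AE_separated by auto
  from 1 2 AE_no_point_at_0 3 show ?thesis unfolding good_points_def by eventually_elim blast
qed

context
  fixes a :: real
  assumes a: "0 < a" "a < 1"
begin

text \<open>A limit of measurable functions of the marks: it is measurable by construction and
  equals the tree count at time n on good points.\<close>

definition trees_at :: "nat \<Rightarrow> 'a \<Rightarrow> real" where
  "trees_at n \<omega> = lim (\<lambda>k. real (tree_count N a (landed (n * 2 ^ k) (mark N (1 / 2 ^ k) (P \<omega>)))))"

lemma measurable_discretized:
  "(\<lambda>\<omega>. real (tree_count N a (landed (n * 2 ^ k) (mark N (1 / 2 ^ k) (P \<omega>))))) \<in> borel_measurable M"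
  by (rule measurable_compose[OF measurable_tree_count_landed[OF N a]]) (auto intro!: measurable_mark[OF N ppp])

lemma measurable_trees_at: "trees_at n \<in> borel_measurable M"
  unfolding trees_at_def by (intro borel_measurable_lim_metric measurable_discretized)

lemma discretized_tendsto:
  assumes "good_points N (P \<omega>)"
  shows "(\<lambda>k. real (tree_count N a (landed (n * 2 ^ k) (mark N (1 / 2 ^ k) (P \<omega>)))))
    \<longlonglongrightarrow> real (tree_count N a (arrival_positions (P \<omega>) (real n)))"
  by (rule tendsto_eventually) (use eventually_landed[OF assms, of n] in eventually_elim, simp)

lemma trees_at_eq:
  assumes "good_points N (P \<omega>)" shows "trees_at n \<omega> = real (tree_count N a (arrival_positions (P \<omega>) (real n)))"
  unfolding trees_at_def by (rule limI[OF discretized_tendsto[OF assms]])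

text \<open>The geometric sum has prefactor 2 pi N q / (1 - r) with 1 - r = 2 q
  \<open>half_width N a\<close>; \<open>q\<close> cancels, leaving it only inside the power.\<close>

lemma integral_discretized:
  assumes n: "0 < n"
  shows "(\<integral>\<omega>. real (tree_count N a (landed (n * 2 ^ k) (mark N (1 / 2 ^ k) (P \<omega>)))) \<partial>M) =
    pi * N / half_width N a * (1 - (1 - 2 * half_width N a * (1 / 2 ^ k * exp (- (1 / 2 ^ k * (2 * pi
      * N))))) ^ (n * 2 ^ k))"
proof -
  define q where "q = 1 / 2 ^ k * exp (- (1 / 2 ^ k * (2 * pi * N)))"
  define r where "r = 1 - 2 * half_width N a * q"
  have q: "0 < q" by (simp add: q_def)
  have hw: "0 < half_width N a" using half_width[OF N a] by simp
  have "(\<integral>\<^sup>+\<omega>. of_nat (tree_count N a (landed (n * 2 ^ k) (mark N (1 / 2 ^ k) (P \<omega>)))) \<partial>M) =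
    ennreal (\<Sum>j<n * 2 ^ k. q * (2 * pi * N) * r ^ j)"
    using expectation_marks[OF N ppp _ a, of "1 / 2 ^ k" "n * 2 ^ k"] n unfolding q_def r_def by simp
  also have "(\<Sum>j<n * 2 ^ k. q * (2 * pi * N) * r ^ j) = pi * N / half_width N a * (1 - r ^ (n * 2 ^ k))"
  proof -
    have "(\<Sum>j<n * 2 ^ k. q * (2 * pi * N) * r ^ j) = q * (2 * pi * N) * (\<Sum>j<n * 2 ^ k. r ^ j)"
      by (simp only: sum_distrib_left)
    also have "(\<Sum>j<n * 2 ^ k. r ^ j) = (1 - r ^ (n * 2 ^ k)) / (1 - r)"
      using q hw by (subst sum_gp_strict) (auto simp: r_def)
    also have "1 - r = 2 * half_width N a * q" by (simp add: r_def)
    also have "q * (2 * pi * N) * ((1 - R) / (2 * half_width N a * q)) = pi * N / half_width N a * (1 - R)" for R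
      using q hw by (simp add: field_simps)
    finally show ?thesis .
  qed
  finally have *: "(\<integral>\<^sup>+\<omega>. ennreal (real (tree_count N a (landed (n * 2 ^ k) (mark N (1 / 2 ^ k) (P \<omega>))))) \<partial>M) =
    ennreal (pi * N / half_width N a * (1 - r ^ (n * 2 ^ k)))"
    by (simp add: ennreal_of_nat_eq_real_of_nat)
  \<comment> \<open>As x <= exp x, a slot has probability at most 1. With r in [0, 1] the closed
    form is nonnegative and the \<open>ennreal\<close> equation descends to the reals.\<close>
  have "0 \<le> r"
  proof -
    have "q * (2 * pi * N) \<le> 1"
    proof -
      have "1 / 2 ^ k * (2 * pi * N) \<le> exp (1 / 2 ^ k * (2 * pi * N))" using exp_ge_add_one_self[of "1 / 2 ^ k
        * (2 * pi * N)"] by linarith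
      then show ?thesis by (simp add: q_def exp_minus field_simps)
    qed
    moreover have "2 * half_width N a * q \<le> 2 * pi * N * q" using half_width[OF N a] q by (intro mult_right_mono) auto
    ultimately show ?thesis unfolding r_def by (simp only: mult.commute[of q])
  qed
  moreover have "r \<le> 1" using q hw by (simp add: r_def)
  ultimately have "0 \<le> pi * N / half_width N a * (1 - r ^ (n * 2 ^ k))"
    using N hw by (intro mult_nonneg_nonneg) (auto simp: power_le_one)
  then show ?thesis using * unfolding q_def[symmetric] r_def[symmetric]
    by (subst integral_eq_nn_integral) (auto intro: measurable_discretized)
qed

lemma integral_trees_at:
  assumes n: "0 < n"
  shows "integrable M (trees_at n)" "(\<integral>\<omega>. trees_at n \<omega> \<partial>M) = pi * N / half_width N a * (1 - exp (- 2
    * half_width N a * real n))"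
proof -
  let ?K = "\<lambda>\<omega>. card (P \<omega> \<inter> {0..real n} \<times> positions N)"
  let ?D = "\<lambda>k \<omega>. real (tree_count N a (landed (n * 2 ^ k) (mark N (1 / 2 ^ k) (P \<omega>))))"
  have K: "integrable M (\<lambda>\<omega>. real (?K \<omega>))"
    by (rule integrable_poisson_count[OF ppp_count(2)[OF N ppp time_box] measure_nonneg ppp_count(3)[OF N ppp time_box]])
  have lim: "AE \<omega> in M. (\<lambda>k. ?D k \<omega>) \<longlonglongrightarrow> trees_at n \<omega>"
    using AE_good_points by eventually_elim (simp add: trees_at_eq discretized_tendsto)
  have bound: "AE \<omega> in M. norm (?D k \<omega>) \<le> real (?K \<omega>)" for k
    using AE_good_points
  proof eventually_elim
    case (elim \<omega>)
    have "?D k \<omega> \<le> real (length (landed (n * 2 ^ k) (mark N (1 / 2 ^ k) (P \<omega>))))"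
      by (rule of_nat_mono[OF tree_count_le_length[OF N a]])
    also have "\<dots> \<le> real (card (P \<omega> \<inter> {0..real (n * 2 ^ k) * (1 / 2 ^ k)} \<times> positions N))"
      by (rule of_nat_mono[OF length_landed_le[OF elim]]) simp
    finally show ?case by simp
  qed
  note dc = integral_dominated_convergence[OF measurable_trees_at measurable_discretized K lim bound]
    integrable_dominated_convergence[OF measurable_trees_at measurable_discretized K lim bound]
  show "integrable M (trees_at n)" by (rule dc(2))
  have "(\<lambda>k. pi * N / half_width N a * (1 - (1 - 2 * half_width N a * (1 / 2 ^ k * exp (- (1 / 2 ^ k * (2 * pi
    * N))))) ^ (n * 2 ^ k)))
     \<longlonglongrightarrow> pi * N / half_width N a * (1 - exp (- 2 * half_width N a * real n))"
    by (intro tendsto_mult tendsto_diff tendsto_const survival_limit)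
  with dc(1) show "(\<integral>\<omega>. trees_at n \<omega> \<partial>M) = pi * N / half_width N a * (1 - exp (- 2 * half_width N a * real n))"
    unfolding integral_discretized[OF n] by (rule LIMSEQ_unique)
qed

lemma tree_count_arrival_mono:
  assumes "good_points N Q" "s \<le> t"
  shows "tree_count N a (arrival_positions Q s) \<le> tree_count N a (arrival_positions Q t)"
proof -
  obtain ys where "arrival_positions Q t = arrival_positions Q s @ ys" using arrival_positions_prefix[OF assms]
    by blast
  then show ?thesis using tree_count_append[OF N a] by simp
qed

text \<open>Monotone convergence along integer times, where the expectations increase to the bound;
  monotonicity then extends the almost sure limit to real times.\<close>

lemma limit_tree_count:
  "\<exists>Y. Y \<in> borel_measurable M \<and> (AE \<omega> in M. ((\<lambda>t. real (tree_count N a (arrival_positions (P \<omega>) t))) \<longlongrightarrow> Y \<omega>) at_top) \<and>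
     integrable M Y \<and> (\<integral>\<omega>. Y \<omega> \<partial>M) = pi * N / half_width N a"
proof -
  define X where "X i = trees_at (Suc i)" for i
  have Xm [measurable]: "X i \<in> borel_measurable M" for i unfolding X_def by (rule measurable_trees_at)
  have hw: "0 < half_width N a" using half_width[OF N a] by simp
  have Xi: "integrable M (X i)" "(\<integral>\<omega>. X i \<omega> \<partial>M) = pi * N / half_width N a * (1 - exp (- 2 * half_width N a
    * real (Suc i)))" for i
    unfolding X_def using integral_trees_at[of "Suc i"] by auto
  have mono: "mono (\<lambda>i. X i \<omega>)" and nonneg: "0 \<le> X i \<omega>" if "good_points N (P \<omega>)" for \<omega> i
    unfolding X_def trees_at_eq[OF that] using tree_count_arrival_mono[OF that] by (auto simp: mono_def)
  define Y where "Y \<omega> = lim (\<lambda>i. X i \<omega>)" for \<omega>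
  have Ym: "Y \<in> borel_measurable M" unfolding Y_def by (intro borel_measurable_lim_metric Xm)
  have nn: "(\<integral>\<^sup>+\<omega>. ennreal (X i \<omega>) \<partial>M) \<le> ennreal (pi * N / half_width N a)" for i
  proof -
    have "AE \<omega> in M. 0 \<le> X i \<omega>" using AE_good_points by eventually_elim (rule nonneg)
    then have "(\<integral>\<^sup>+\<omega>. ennreal (X i \<omega>) \<partial>M) = ennreal (\<integral>\<omega>. X i \<omega> \<partial>M)" by (rule nn_integral_eq_integral[OF Xi(1)])
    also have "\<dots> \<le> ennreal (pi * N / half_width N a)"
      unfolding Xi(2) using N hw by (intro ennreal_leI mult_left_le) auto
    finally show ?thesis .
  qed
  \<comment> \<open>The expectations are bounded uniformly in i, so the supremum is almost surely
    finite; this turns the formal \<open>lim\<close> in \<open>Y\<close> into a true limit.\<close>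
  have "(\<integral>\<^sup>+\<omega>. (SUP i. ennreal (X i \<omega>)) \<partial>M) = (SUP i. \<integral>\<^sup>+\<omega>. ennreal (X i \<omega>) \<partial>M)"
  proof (rule nn_integral_monotone_convergence_SUP_AE)
    show "AE \<omega> in M. ennreal (X i \<omega>) \<le> ennreal (X (Suc i) \<omega>)" for i
      using AE_good_points by eventually_elim (use mono in \<open>auto intro!: ennreal_leI simp: mono_def\<close>)
  qed measurable
  also have "\<dots> \<le> ennreal (pi * N / half_width N a)" by (rule SUP_least) (rule nn)
  finally have "(\<integral>\<^sup>+\<omega>. (SUP i. ennreal (X i \<omega>)) \<partial>M) \<noteq> \<infinity>" by (auto simp: top_unique)
  from nn_integral_PInf_AE[OF _ this]
  have fin: "AE \<omega> in M. (SUP i. ennreal (X i \<omega>)) \<noteq> \<infinity>" by measurable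
  have lim: "AE \<omega> in M. (\<lambda>i. X i \<omega>) \<longlonglongrightarrow> Y \<omega>"
    using fin AE_good_points
  proof eventually_elim
    case (elim \<omega>)
    obtain B where B: "0 \<le> B" "(SUP i. ennreal (X i \<omega>)) = ennreal B" using elim(1) by (cases
      "SUP i. ennreal (X i \<omega>)") auto
    have "ennreal (X i \<omega>) \<le> ennreal B" for i unfolding B(2)[symmetric] by (rule SUP_upper) simp
    then have "X i \<omega> \<le> B" for i using B(1) by (simp add: ennreal_le_iff)
    then have "convergent (\<lambda>i. X i \<omega>)" using mono[OF elim(2)] nonneg[OF elim(2)]
      by (intro Bseq_monoseq_convergent BseqI'[of _ B]) (auto simp: incseq_imp_monoseq)
    then show ?case unfolding Y_def by (simp add: convergent_LIMSEQ_iff)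
  qed
  have AEmono: "AE \<omega> in M. mono (\<lambda>i. X i \<omega>)" using AE_good_points by eventually_elim (rule mono)
  have elim: "(\<lambda>i. \<integral>\<omega>. X i \<omega> \<partial>M) \<longlonglongrightarrow> pi * N / half_width N a"
  proof -
    have "(\<lambda>i. exp (- 2 * half_width N a * real (Suc i))) \<longlonglongrightarrow> 0" using hw by real_asymp
    from tendsto_mult[OF tendsto_const tendsto_diff[OF tendsto_const this], of "pi * N / half_width N a" 1]
    show ?thesis unfolding Xi(2) by simp
  qed
  have int: "integrable M Y" "(\<integral>\<omega>. Y \<omega> \<partial>M) = pi * N / half_width N a"
    using integrable_monotone_convergence[OF Xi(1) AEmono lim elim Ym] integral_monotone_convergence[OF Xi(1) AEmono lim elim Ym] by auto
  have "AE \<omega> in M. ((\<lambda>t. real (tree_count N a (arrival_positions (P \<omega>) t))) \<longlongrightarrow> Y \<omega>) at_top"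
    using lim AE_good_points
  proof eventually_elim
    case (elim \<omega>)
    show ?case
    proof (rule tendsto_at_top_mono_nat)
      show "real (tree_count N a (arrival_positions (P \<omega>) s)) \<le> real (tree_count N a (arrival_positions (P \<omega>) t))" if "s \<le> t" for s t
        using tree_count_arrival_mono[OF elim(2) that] by simp
      show "(\<lambda>i. real (tree_count N a (arrival_positions (P \<omega>) (real (Suc i))))) \<longlonglongrightarrow> Y \<omega>"
        using elim(1) unfolding X_def trees_at_eq[OF elim(2)] .
    qed
  qed
  then show ?thesis using Ym int by blast
qed

end
end

text \<open>delta equals tanh(lam/(2N)), so both it and the arctangent behave like lam/(2N).\<close>

lemma expected_trees_asymptotics:
  assumes "0 < lam"
  shows "((\<lambda>N. pi / (2 * arctan (slit_delta N lam / sqrt (1 - (slit_delta N lam)\<^sup>2))) / N) \<longlongrightarrow> pi / lam) at_top"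
proof -
  have "((\<lambda>N. pi / (2 * arctan (slit_delta N lam / sqrt (1 - (slit_delta N lam)\<^sup>2))) / N) \<longlongrightarrow> pi * inverse lam) at_top"
    unfolding slit_delta_def using assms by real_asymp
  then show ?thesis by (simp only: divide_inverse[symmetric])
qed

lemma limit_num_trees:
  assumes N: "0 < N" and lam: "0 < lam" and ppp: "poisson_point_process M (space_time_measure N) P"
  shows "\<exists>Ninf :: 'a \<Rightarrow> real. Ninf \<in> borel_measurable M \<and>
      (AE \<omega> in M. ((\<lambda>t. real (num_trees N lam (P \<omega>) t)) \<longlongrightarrow> Ninf \<omega>) at_top) \<and>
      integrable M Ninf \<and>
      (\<integral>\<omega>. Ninf \<omega> \<partial>M) = pi / (2 * arctan (slit_delta N lam / sqrt (1 - (slit_delta N lam)\<^sup>2)))"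
proof -
  note delta_bounds = slit_delta_bounds(1)[OF lam N] slit_delta_bounds(2)[of N lam]
  have "pi * N / half_width N (slit_delta N lam) = pi / (2
    * arctan (slit_delta N lam / sqrt (1 - (slit_delta N lam)\<^sup>2)))"
    using N by (simp add: half_width_def[OF N delta_bounds])
  then show ?thesis using limit_tree_count[OF N ppp delta_bounds] unfolding num_trees_eq[OF N lam] by simp
qed

theorem theorem1p7:
  fixes lam :: real
  assumes "lam > 0"
  shows "(\<forall>N \<ge> 1. \<forall>(M :: 'a measure) P.
            poisson_point_process M (space_time_measure N) P \<longrightarrow>
            (\<exists>Ninf :: 'a \<Rightarrow> real.
               Ninf \<in> borel_measurable M \<and>
               (AE \<omega> in M. ((\<lambda>t. real (num_trees N lam (P \<omega>) t)) \<longlongrightarrow> Ninf \<omega>) at_top) \<and>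
               integrable M Ninf \<and>
               (\<integral>\<omega>. Ninf \<omega> \<partial>M) =
                 pi / (2 * arctan (slit_delta N lam / sqrt (1 - (slit_delta N lam)\<^sup>2)))))
       \<and> (\<forall>(M :: real \<Rightarrow> 'a measure) P (Ninf :: real \<Rightarrow> 'a \<Rightarrow> real).
            (\<forall>N \<ge> 1. poisson_point_process (M N) (space_time_measure N) (P N) \<and>
               Ninf N \<in> borel_measurable (M N) \<and>
               (AE \<omega> in M N. ((\<lambda>t. real (num_trees N lam (P N \<omega>) t)) \<longlongrightarrow> Ninf N \<omega>) at_top)) \<longrightarrow>
            ((\<lambda>N. (\<integral>\<omega>. Ninf N \<omega> \<partial>M N) / N) \<longlongrightarrow> pi / lam) at_top)"
proof (intro conjI allI impI)
  fix N :: real and M :: "'a measure" and P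
  assume "1 \<le> N" "poisson_point_process M (space_time_measure N) P"
  then show "\<exists>Ninf :: 'a \<Rightarrow> real.
      Ninf \<in> borel_measurable M \<and>
      (AE \<omega> in M. ((\<lambda>t. real (num_trees N lam (P \<omega>) t)) \<longlongrightarrow> Ninf \<omega>) at_top) \<and>
      integrable M Ninf \<and>
      (\<integral>\<omega>. Ninf \<omega> \<partial>M) = pi / (2 * arctan (slit_delta N lam / sqrt (1 - (slit_delta N lam)\<^sup>2)))"
    using assms by (intro limit_num_trees) auto
next
  fix M :: "real \<Rightarrow> 'a measure" and P and Ninf :: "real \<Rightarrow> 'a \<Rightarrow> real"
  assume H: "\<forall>N \<ge> 1. poisson_point_process (M N) (space_time_measure N) (P N) \<and>
      Ninf N \<in> borel_measurable (M N) \<and>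
      (AE \<omega> in M N. ((\<lambda>t. real (num_trees N lam (P N \<omega>) t)) \<longlongrightarrow> Ninf N \<omega>) at_top)"
  \<comment> \<open>\<open>Ninf\<close> is arbitrary here, but almost sure limits are unique, so it
    has the integral already computed.\<close>
  have eq: "(\<integral>\<omega>. Ninf N \<omega> \<partial>M N) = pi / (2 * arctan (slit_delta N lam / sqrt (1 - (slit_delta N lam)\<^sup>2)))" if N:
    "1 \<le> N" for N
  proof -
    have ppp: "poisson_point_process (M N) (space_time_measure N) (P N)" and meas: "Ninf N \<in> borel_measurable (M N)"
      and lim: "AE \<omega> in M N. ((\<lambda>t. real (num_trees N lam (P N \<omega>) t)) \<longlongrightarrow> Ninf N \<omega>) at_top"
      using H N by auto
    have N0: "0 < N" using N by simp
    from limit_num_trees[OF N0 assms ppp] obtain Y where Y: "Y \<in> borel_measurable (M N)"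
      "AE \<omega> in M N. ((\<lambda>t. real (num_trees N lam (P N \<omega>) t)) \<longlongrightarrow> Y \<omega>) at_top"
      "(\<integral>\<omega>. Y \<omega> \<partial>M N) = pi / (2 * arctan (slit_delta N lam / sqrt (1 - (slit_delta N lam)\<^sup>2)))" by blast
    have "AE \<omega> in M N. Ninf N \<omega> = Y \<omega>"
      using lim Y(2) by eventually_elim (rule tendsto_unique[OF trivial_limit_at_top_linorder])
    then show ?thesis using integral_cong_AE[OF meas Y(1)] Y(3) by simp
  qed
  have "eventually (\<lambda>N. pi / (2 * arctan (slit_delta N lam / sqrt (1 - (slit_delta N lam)\<^sup>2))) / N
    = (\<integral>\<omega>. Ninf N \<omega> \<partial>M N) / N) at_top"
    using eventually_ge_at_top[of 1] by eventually_elim (simp only: eq)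
  then show "((\<lambda>N. (\<integral>\<omega>. Ninf N \<omega> \<partial>M N) / N) \<longlongrightarrow> pi / lam) at_top"
    by (rule Lim_transform_eventually[OF expected_trees_asymptotics[OF assms]])
qed

end
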